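(* Consider the single-master-multiple-slaves (SMMS) teleoperation system with $N\ge2$ slaves, whose closed-loop dynamics under the Round-Robin (RR) scheduling protocol are, for $t\ge t_{N-1}$ and $i=1,\dots,N$, $$f_m(t)=M_m(q_m(t))\ddot q_m(t)+C_m(q_m(t),\dot q_m(t))\dot q_m(t)+\frac1N\sum_{i=1}^N\Big[K_i^p\big(q_m(t)-q_{si}(t-d_{si}(t))\big)+K_i^d\dot q_m(t)\Big],$$ $$f_{si}(t)=M_{si}(q_{si}(t))\ddot q_{si}(t)+C_{si}(q_{si}(t),\dot q_{si}(t))\dot q_{si}(t)+K_i^d\dot q_{si}(t)+K_i^p\big(\check q_{si}(t)-q_m(t-d_m(t))\big),$$ where $\check q_{si}=q_{si}-\gamma_i$, $d_{si}(t)\in[0,h_S]$, $d_m(t)\in[0,h_M]$, $h_M=MATI+MAD$, $h_S=N\cdot MATI+MAD$, and all objects are as in the context. Suppose there exist positive definite matrices $0<R_m\in\mathbb R^{n\times n}$ and $0<R_{si}\in\mathbb R^{n\times n}$, $i=1,\dots,N$, such that for every $i=1,\dots,N$ $$\Pi_i=\begin{bmatrix}-2K_i^d+h_MR_m&0&0&-K_i^p\\ *&-2K_i^d+h_SR_{si}&-K_i^p&0\\ *&*&-h_M^{-1}R_m&0\\ *&*&*&-h_S^{-1}R_{si}\end{bmatrix}<0.$$ Then the following claims hold. 1. If the teleoperation system is in free motion, that is, $f_m(t)=f_{si}(t)\equiv0$, $i=1,\dots,N$, then all the signals are bounded for $t\ge t_{N-1}$, and the position coordination errors and velocities asymptotically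 converge to zero, that is, $\lim_{t\to\infty}(q_m(t)-\check q_{si}(t))=\lim_{t\to\infty}\dot q_m(t)=\lim_{t\to\infty}\dot q_{si}(t)=0$, $i=1,\dots,N$, which implies that $q_m\to\bar q_s$ and $q_{si}\to q_m+\gamma_i$ as $t\to\infty$ (in the sense that the differences tend to $0$). 2. If $f_m\in\mathcal L_\infty$ and $f_{si}\in\mathcal L_\infty$ ($i=1,\dots,N$), then $\dot q_m(t),\dot q_{si}(t)\in\mathcal L_\infty$ for all $t\ge t_{N-1}$. 3. If $f_m\in\mathcal L_2$ and $f_{si}\in\mathcal L_2$ ($i=1,\dots,N$), then all the signals are bounded for all $t\ge t_{N-1}$, and $\lim_{t\to\infty}(q_m(t)-\check q_{si}(t))=\lim_{t\to\infty}\dot q_m(t)=\lim_{t\to\infty}\dot q_{si}(t)=0$, which implies that $q_m\to\bar q_s$ and $q_{si}\to q_m+\gamma_i$ as $t\to\infty$. 4. Force tracking is guaranteed when the teleoperation system is in steady state (that is, $\dot q_m=\dot q_{si}=0$ and $\ddot q_m=\ddot q_{si}=0$, $i=1,\dots,N$): $f_m=-\bar f_s$, where $\bar f_s=\frac1N\sum_{i=1}^Nf_{si}$.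
   Context: Conventions: $A>0$ (resp. $A<0$) means that $A$ is symmetric positive (resp. negative) definite; $*$ denotes blocks determined by symmetry; $|\cdot|$ is the Euclidean norm; $\mathbb N=\{0,1,2,\dots\}$, $\mathbb N^+=\{1,2,\dots\}$. $f\in\mathcal L_\infty$ means $\sup_{t\ge0}|f(t)|<\infty$; $f\in\mathcal L_2$ means $\int_0^\infty|f(t)|^2dt<\infty$. Robots: the system consists of one master and $N\ge2$ slaves, all with $n$ degrees of freedom, with dynamics $M_j(q_j)\ddot q_j+C_j(q_j,\dot q_j)\dot q_j+G_j(q_j)=f_j+\tau_j$, $j\in\{m,s1,\dots,sN\}$, where $q_j\in\mathbb R^n$ are joint positions, $M_j$ inertia matrices, $C_j$ Coriolis/centrifugal matrices, $G_j$ gravity terms, $f_j$ external forces and $\tau_j$ control forces. For each $j$: (P1) $M_j(q_j)$ is symmetric positive definite with $0<\lambda_j^mI\le M_j(q_j)\le\lambda_j^MI<\infty$ for positive scalars $\lambda_j^m,\lambda_j^M$; (P2) $\dot M_j(q_j)-2C_j(q_j,\dot q_j)$ is skew symmetric; (P3) there is $c_j>0$ with $|C_j(q_j,x)y|\le c_j|x||y|$ for all $q_j,x,y\in\mathbb R^n$; (P4) if $\ddot q_j$ and $\dot q_j$ are bounded, the time derivative of $C_j(q_j,\dot q_j)$ is bounded. Formation: $\gamma_1,\dots,\gamma_N\in\mathbb R^n$ are constant, $\gamma_i\ne\gamma_j$ for $i\ne j$, $\sum_{i=1}^N\gamma_i=0$; $\check q_{si}=q_{si}-\gamma_i$; $\bar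 q_s=\frac1N\sum_{i=1}^Nq_{si}$. Sampling and delays: sampling instants $0=s_0<s_1<\cdots$ with $s_k\to\infty$; $T_k$ is the time needed to transmit the data sampled at $s_k$; $t_k=s_k+T_k$ are the update instants. There are positive constants $MATI$, $MAD$ with $s_{k+1}-s_k\le MATI$ and $0\le T_k\le MAD$ for all $k\in\mathbb N$. Delays may exceed the sampling interval, provided an old sample does not reach the remote side after the most recent one (so $t_k<t_{k+1}$). RR protocol: at each $s_k$ exactly one slave $i_k^*\in\{1,\dots,N\}$ transmits its position to the master; $i_k^*=i_{k+N}^*$ for each $k\in\mathbb N^+$, and $i_p^*\ne i_q^*$ for $0<p<q\le N$. The most recently received positions are $\hat q_{si}(s_k)=q_{si}(s_k)$ if $i=i_k^*$ and $\hat q_{si}(s_k)=\hat q_{si}(s_{k-1})$ otherwise. Controllers: with gains $K_i^p>0$, $K_i^d>0$ in $\mathbb R^{n\times n}$, for $t\in[t_k,t_{k+1})$, $\tau_m(t)=-\frac1N\sum_{i=1}^N[K_i^p(q_m(t)-\hat q_{si}(s_k))+K_i^d\dot q_m(t)]+G_m(q_m)$ and $\tau_{si}(t)=-K_i^p(\check q_{si}(t)-q_m(s_k))-K_i^d\dot q_{si}(t)+G_{si}(q_{si})$. Once all the slaves' measurements have been transmitted at least once, i.e. for $t\ge t_{N-1}$, one has $\hat q_{si}(s_k)=q_{si}(s_{k-j})$ for some $j\in\{0,\dots,N-1\}$; for $t\in[t_k,t_{k+1})$ set $d_{si}(t)=t-s_{k-j}$ and $d_m(t)=t-s_k$, so that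 $0\le d_{si}(t)\le h_S$, $0\le d_m(t)\le h_M$; this yields the closed-loop system in the claim. Its initial condition is $\mathrm{col}\{q_m,\dot q_m,\check q_{s1},\dot q_{s1},\dots,\check q_{sN},\dot q_{sN}\}(t)=\varphi(t)$, $t\in[-h_S,0]$, where $\mathrm{col}$ stacks its entries vertically.
   Formalization: Claims 1, 3, 4 additionally assume Σ K_i^p γ_i = 0, without which they fail; in claim 3 "all signals" means velocities, coordination errors and delayed differences, as positions and accelerations may be unbounded; steady state in claim 4 means zero velocity over the window [t−h_S, t]. *)

theory Defs
  imports "HOL-Analysis.Analysis"
begin

definition pos_def :: "real^'m^'m \<Rightarrow> bool" where
  "pos_def A \<longleftrightarrow> transpose A = A \<and> (\<forall>x. x \<noteq> 0 \<longrightarrow> x \<bullet> (A *v x) > 0)"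

definition neg_def :: "real^'m^'m \<Rightarrow> bool" where
  "neg_def A \<longleftrightarrow> transpose A = A \<and> (\<forall>x. x \<noteq> 0 \<longrightarrow> x \<bullet> (A *v x) < 0)"

definition skew_symmetric :: "real^'m^'m \<Rightarrow> bool" where
  "skew_symmetric A \<longleftrightarrow> transpose A = - A"

text \<open>The matrix of size \<open>b n\<close> assembled from a \<open>b\<close> by \<open>b\<close> array of \<open>n\<close> by \<open>n\<close> blocks;
  an index is a pair (block, position inside the block).\<close>

definition flatten_blocks :: "(real^'n^'n)^'b^'b \<Rightarrow> real^('b \<times> 'n)^('b \<times> 'n)" where
  "flatten_blocks B = (\<chi> r c. B $ fst r $ fst c $ snd r $ snd c)"

definition lmi_matrix ::
    "real \<Rightarrow> real \<Rightarrow> real^'n^'n \<Rightarrow> real^'n^'n \<Rightarrow> real^'n^'n \<Rightarrow> real^'n^'n \<Rightarrow> real^(4 \<times> 'n)^(4 \<times> 'n)" where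
  "lmi_matrix hM hS Kp Kd Rm Rs = flatten_blocks (vector
     [vector [- (2 *\<^sub>R Kd) + hM *\<^sub>R Rm, 0, 0, - Kp],
      vector [0, - (2 *\<^sub>R Kd) + hS *\<^sub>R Rs, - Kp, 0],
      vector [0, - transpose Kp, - ((1 / hM) *\<^sub>R Rm), 0],
      vector [- transpose Kp, 0, 0, - ((1 / hS) *\<^sub>R Rs)]])"

text \<open>Properties of one robot with inertia matrix \<open>M\<close> and Coriolis/centrifugal matrix \<open>C\<close>.
  They are structural: time derivatives of \<open>M\<close> and \<open>C\<close> are taken along arbitrary motions.\<close>

definition inertia_bounded :: "(real^'n \<Rightarrow> real^'n^'n) \<Rightarrow> bool" where
  "inertia_bounded M \<longleftrightarrow>
     (\<exists>l u. 0 < l \<and> 0 < u \<and>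
        (\<forall>q. pos_def (M q) \<and> (\<forall>x. l * (x \<bullet> x) \<le> x \<bullet> (M q *v x) \<and> x \<bullet> (M q *v x) \<le> u * (x \<bullet> x))))"

definition inertia_coriolis_skew ::
    "(real^'n \<Rightarrow> real^'n^'n) \<Rightarrow> (real^'n \<Rightarrow> real^'n \<Rightarrow> real^'n^'n) \<Rightarrow> bool" where
  "inertia_coriolis_skew M C \<longleftrightarrow>
     (\<forall>q v t. (q has_vector_derivative v) (at t) \<longrightarrow>
        (\<exists>D. ((\<lambda>\<tau>. M (q \<tau>)) has_vector_derivative D) (at t) \<and> skew_symmetric (D - 2 *\<^sub>R C (q t) v)))"

definition coriolis_bounded :: "(real^'n \<Rightarrow> real^'n \<Rightarrow> real^'n^'n) \<Rightarrow> bool" where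
  "coriolis_bounded C \<longleftrightarrow> (\<exists>c>0. \<forall>q x y. norm (C q x *v y) \<le> c * norm x * norm y)"

definition coriolis_rate_bounded :: "(real^'n \<Rightarrow> real^'n \<Rightarrow> real^'n^'n) \<Rightarrow> bool" where
  "coriolis_rate_bounded C \<longleftrightarrow>
     (\<forall>I q v a. is_interval I \<longrightarrow>
        (\<forall>t\<in>I. (q has_vector_derivative v t) (at t within I) \<and>
               (v has_vector_derivative a t) (at t within I)) \<longrightarrow>
        bounded (v ` I) \<longrightarrow> bounded (a ` I) \<longrightarrow>
        (\<exists>D. (\<forall>t\<in>I. ((\<lambda>\<tau>. C (q \<tau>) (v \<tau>)) has_vector_derivative D t) (at t within I)) \<and>
             bounded (D ` I)))"

definition robot :: "(real^'n \<Rightarrow> real^'n^'n) \<Rightarrow> (real^'n \<Rightarrow> real^'n \<Rightarrow> real^'n^'n) \<Rightarrow> bool" where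
  "robot M C \<longleftrightarrow> inertia_bounded M \<and> inertia_coriolis_skew M C \<and> coriolis_bounded C \<and>
     coriolis_rate_bounded C"

definition formation :: "nat \<Rightarrow> (nat \<Rightarrow> real^'n) \<Rightarrow> bool" where
  "formation N \<gamma> \<longleftrightarrow> inj_on \<gamma> {1..N} \<and> (\<Sum>i=1..N. \<gamma> i) = 0"

text \<open>The master feeds back \<open>qm - qs i\<close> instead of \<open>qm - (qs i - \<gamma> i)\<close>, so at a formation
  \<open>qs i = qm + \<gamma> i\<close> it is driven by the constant force \<open>(\<Sum>i=1..N. Kp i *v \<gamma> i) / N\<close>. The
  formation is an equilibrium of the force-free closed loop only if this force vanishes, which
  \<open>(\<Sum>i=1..N. \<gamma> i) = 0\<close> guarantees when the gains coincide, but not for arbitrary gains.\<close>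

definition balanced_gains :: "nat \<Rightarrow> (nat \<Rightarrow> real^'n^'n) \<Rightarrow> (nat \<Rightarrow> real^'n) \<Rightarrow> bool" where
  "balanced_gains N Kp \<gamma> \<longleftrightarrow> (\<Sum>i=1..N. Kp i *v \<gamma> i) = 0"

lemma balanced_gains_common_gain:
  assumes "formation N \<gamma>" and "\<forall>i\<in>{1..N}. Kp i = K"
  shows "balanced_gains N Kp \<gamma>"
proof -
  have "(\<Sum>i=1..N. Kp i *v \<gamma> i) = (\<Sum>i=1..N. K *v \<gamma> i)"
    using assms(2) by (intro sum.cong) auto
  also have "\<dots> = K *v (\<Sum>i=1..N. \<gamma> i)"
    using linear_sum[OF matrix_vector_mul_linear, of K \<gamma> "{1..N}"] by simp
  finally show ?thesis
    using assms(1) by (simp add: balanced_gains_def formation_def)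
qed

text \<open>\<open>s k\<close> is a sampling instant, \<open>T k\<close> the transmission time, \<open>s k + T k\<close> the update instant.\<close>

definition sampling :: "real \<Rightarrow> real \<Rightarrow> (nat \<Rightarrow> real) \<Rightarrow> (nat \<Rightarrow> real) \<Rightarrow> bool" where
  "sampling MATI MAD s T \<longleftrightarrow>
     0 < MATI \<and> 0 < MAD \<and>
     s 0 = 0 \<and> strict_mono s \<and> filterlim s at_top sequentially \<and>
     (\<forall>k. s (Suc k) - s k \<le> MATI) \<and> (\<forall>k. 0 \<le> T k \<and> T k \<le> MAD) \<and>
     (\<forall>k. s k + T k < s (Suc k) + T (Suc k))"

definition rr_protocol :: "nat \<Rightarrow> (nat \<Rightarrow> nat) \<Rightarrow> bool" where
  "rr_protocol N istar \<longleftrightarrow>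
     (\<forall>k. istar k \<in> {1..N}) \<and>
     (\<forall>k\<ge>1. istar k = istar (k + N)) \<and>
     (\<forall>p q. 0 < p \<and> p < q \<and> q \<le> N \<longrightarrow> istar p \<noteq> istar q)"

text \<open>\<open>qhat i k\<close> is the position of slave \<open>i\<close> most recently received when the sample taken at
  \<open>s k\<close> has arrived. For a slave not scheduled at \<open>k = 0\<close> the value \<open>qhat i 0\<close> is arbitrary.\<close>

definition received_positions ::
    "nat \<Rightarrow> (nat \<Rightarrow> real) \<Rightarrow> (nat \<Rightarrow> nat) \<Rightarrow> (nat \<Rightarrow> real \<Rightarrow> real^'n) \<Rightarrow> (nat \<Rightarrow> nat \<Rightarrow> real^'n) \<Rightarrow> bool" where
  "received_positions N s istar qs qhat \<longleftrightarrow>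
     (\<forall>i\<in>{1..N}. \<forall>k. (istar k = i \<longrightarrow> qhat i k = qs i (s k)) \<and>
                     (istar k \<noteq> i \<and> 0 < k \<longrightarrow> qhat i k = qhat i (k - 1)))"

definition network_delays ::
    "nat \<Rightarrow> (nat \<Rightarrow> real) \<Rightarrow> (nat \<Rightarrow> real) \<Rightarrow> (nat \<Rightarrow> real \<Rightarrow> real^'n) \<Rightarrow> (nat \<Rightarrow> nat \<Rightarrow> real^'n) \<Rightarrow>
     (real \<Rightarrow> real) \<Rightarrow> (nat \<Rightarrow> real \<Rightarrow> real) \<Rightarrow> bool" where
  "network_delays N s T qs qhat dm ds \<longleftrightarrow>
     (\<forall>k\<ge>N - 1.
        (\<forall>t\<in>{s k + T k..<s (Suc k) + T (Suc k)}. dm t = t - s k) \<and>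
        (\<forall>i\<in>{1..N}. \<exists>j\<le>N - 1. qhat i k = qs i (s (k - j)) \<and>
           (\<forall>t\<in>{s k + T k..<s (Suc k) + T (Suc k)}. ds i t = t - s (k - j))))"

text \<open>The ranges of the delays.\<close>

lemma network_delays_bounds:
  assumes S: "sampling MATI MAD s T" and D: "network_delays N s T qs qhat dm ds" and "N \<ge> 1"
    and k: "k \<ge> N - 1" and t: "t \<in> {s k + T k..<s (Suc k) + T (Suc k)}"
  shows "dm t \<in> {0..MATI + MAD}" and "i \<in> {1..N} \<Longrightarrow> ds i t \<in> {0..real N * MATI + MAD}"
proof -
  have mono: "s a \<le> s b" if "a \<le> b" for a b
    using S that by (auto simp: sampling_def strict_mono_less_eq)
  have T: "0 \<le> T l" "T l \<le> MAD" for l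
    using S by (auto simp: sampling_def)
  have step: "s (Suc l) - s l \<le> MATI" for l
    using S by (auto simp: sampling_def)
  have steps: "s (l + m) - s l \<le> real m * MATI" for l m
  proof (induction m)
    case (Suc m)
    then show ?case using step[of "l + m"] by (simp add: algebra_simps)
  qed simp
  have "dm t = t - s k"
    using D k t by (auto simp: network_delays_def)
  then show "dm t \<in> {0..MATI + MAD}"
    using t T[of k] T[of "Suc k"] step[of k] by auto
  show "ds i t \<in> {0..real N * MATI + MAD}" if "i \<in> {1..N}"
  proof -
    obtain j where j: "j \<le> N - 1" "ds i t = t - s (k - j)"
      using D k t \<open>i \<in> {1..N}\<close> unfolding network_delays_def by blast
    have "s (Suc k) - s (k - j) \<le> real (Suc j) * MATI"
      using steps[of "k - j" "Suc j"] j k by simp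
    also have "\<dots> \<le> real N * MATI"
      using j \<open>N \<ge> 1\<close> S by (intro mult_right_mono) (auto simp: sampling_def)
    finally show ?thesis
      using t j T[of k] T[of "Suc k"] mono[of "k - j" k] by auto
  qed
qed

text \<open>Position \<open>q\<close>, velocity \<open>v\<close> and acceleration \<open>a\<close> of a robot. The control forces jump at the
  update instants and external forces may be discontinuous, so solutions are taken in the
  Caratheodory sense: on \<open>{t0..}\<close> the velocity is an indefinite (Henstock-Kurzweil) integral of the
  acceleration. This covers velocities that are continuous and differentiable between update
  instants.\<close>

definition motion ::
    "real \<Rightarrow> real \<Rightarrow> (real \<Rightarrow> real^'n) \<Rightarrow> (real \<Rightarrow> real^'n) \<Rightarrow> (real \<Rightarrow> real^'n) \<Rightarrow> bool" where
  "motion h t0 q v a \<longleftrightarrow>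
     (\<forall>t\<ge>-h. (q has_vector_derivative v t) (at t within {-h..})) \<and>
     continuous_on {-h..} v \<and>
     (\<forall>t\<ge>t0. (a has_integral (v t - v t0)) {t0..t})"

text \<open>The initial function: entry 0 is the pair of the master, entry \<open>i\<close> that of slave \<open>i\<close>.\<close>

definition initial_condition ::
    "nat \<Rightarrow> real \<Rightarrow> (nat \<Rightarrow> real^'n) \<Rightarrow> (nat \<Rightarrow> real \<Rightarrow> (real^'n) \<times> (real^'n)) \<Rightarrow>
     (real \<Rightarrow> real^'n) \<Rightarrow> (real \<Rightarrow> real^'n) \<Rightarrow> (nat \<Rightarrow> real \<Rightarrow> real^'n) \<Rightarrow> (nat \<Rightarrow> real \<Rightarrow> real^'n) \<Rightarrow> bool" where
  "initial_condition N h \<gamma> \<phi> qm vm qs vs \<longleftrightarrow>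
     (\<forall>t\<in>{-h..0}. (qm t, vm t) = \<phi> 0 t \<and> (\<forall>i\<in>{1..N}. (qs i t - \<gamma> i, vs i t) = \<phi> i t))"

definition signal_Linf :: "(real \<Rightarrow> real^'n) \<Rightarrow> bool" where
  "signal_Linf f \<longleftrightarrow> bounded (f ` {0..})"

definition signal_L2 :: "(real \<Rightarrow> real^'n) \<Rightarrow> bool" where
  "signal_L2 f \<longleftrightarrow> f \<in> borel_measurable (lebesgue_on {0..}) \<and>
     integrable (lebesgue_on {0..}) (\<lambda>t. (norm (f t))\<^sup>2)"

text \<open>Boundedness of the signals of the closed loop in error coordinates: velocities, coordination
  errors, and the delayed position differences fed back by the controllers. The absolute positions
  enter the loop only through \<open>M\<close> and \<open>C\<close>.\<close>

definition loop_signals_bounded ::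
    "nat \<Rightarrow> real \<Rightarrow> (nat \<Rightarrow> real^'n) \<Rightarrow> (real \<Rightarrow> real) \<Rightarrow> (nat \<Rightarrow> real \<Rightarrow> real) \<Rightarrow>
     (real \<Rightarrow> real^'n) \<Rightarrow> (real \<Rightarrow> real^'n) \<Rightarrow> (nat \<Rightarrow> real \<Rightarrow> real^'n) \<Rightarrow> (nat \<Rightarrow> real \<Rightarrow> real^'n) \<Rightarrow> bool" where
  "loop_signals_bounded N t0 \<gamma> dm ds qm vm qs vs \<longleftrightarrow>
     bounded (vm ` {t0..}) \<and>
     (\<forall>i\<in>{1..N}.
        bounded (vs i ` {t0..}) \<and>
        bounded ((\<lambda>t. qm t - (qs i t - \<gamma> i)) ` {t0..}) \<and>
        bounded ((\<lambda>t. qm t - qs i (t - ds i t)) ` {t0..}) \<and>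
        bounded ((\<lambda>t. (qs i t - \<gamma> i) - qm (t - dm t)) ` {t0..}))"

definition coordination ::
    "nat \<Rightarrow> (nat \<Rightarrow> real^'n) \<Rightarrow>
     (real \<Rightarrow> real^'n) \<Rightarrow> (real \<Rightarrow> real^'n) \<Rightarrow> (nat \<Rightarrow> real \<Rightarrow> real^'n) \<Rightarrow> (nat \<Rightarrow> real \<Rightarrow> real^'n) \<Rightarrow> bool" where
  "coordination N \<gamma> qm vm qs vs \<longleftrightarrow>
     (vm \<longlongrightarrow> 0) at_top \<and>
     (\<forall>i\<in>{1..N}. ((\<lambda>t. qm t - (qs i t - \<gamma> i)) \<longlongrightarrow> 0) at_top \<and> (vs i \<longlongrightarrow> 0) at_top) \<and>
     ((\<lambda>t. qm t - (1 / real N) *\<^sub>R (\<Sum>i=1..N. qs i t)) \<longlongrightarrow> 0) at_top \<and>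
     (\<forall>i\<in>{1..N}. ((\<lambda>t. qs i t - (qm t + \<gamma> i)) \<longlongrightarrow> 0) at_top)"

end

theory Submission
  imports Defs
begin

text \<open>Put \<open>e\<^sub>i = q\<^sub>m - (q\<^sub>s\<^sub>i - \<gamma>\<^sub>i)\<close>. The kinetic energies, the spring energies \<open>e\<^sub>i \<bullet> K\<^sub>p e\<^sub>i\<close> and
  Krasovskii terms for the velocities over the delay windows form an energy whose rate is, by Jensen's
  inequality, at most the quadratic form of the matrix inequality plus the power of the external
  forces. This rate controls the velocities but not the errors \<open>e\<^sub>i\<close>. A small multiple of the
  cross terms \<open>- \<phi>(e\<^sub>i) \<bullet> M\<^sub>i v\<^sub>i\<close> with \<open>\<phi>(e) = e / sqrt (1 + |e|\<^sup>2)\<close> is therefore subtracted: it adds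
  dissipation of order \<open>|e\<^sub>i|\<close>, and since \<open>\<phi>\<close> is bounded, the Coriolis term it creates is at most
  \<open>c |v\<^sub>i|\<^sup>2\<close>. For the resulting functional \<open>W\<close>, bounded forces make \<open>W\<close> decrease wherever it is
  large, which bounds the velocities. For square integrable forces \<open>W\<close> is bounded, so the errors are
  bounded, the saturation can be undone, and \<open>W' \<le> - c W + |f|\<^sup>2 / k\<close> yields \<open>W \<rightarrow> 0\<close>. Without forces
  \<open>W\<close> decays exponentially, hence so do the velocities, and the positions stay bounded.\<close>

section \<open>Absolutely continuous primitives\<close>

text \<open>The motions supply accelerations only as Henstock-Kurzweil densities of the velocities,
  so the kinetic energies need not be differentiable at every time. The equations of motion
  themselves make the accelerations absolutely integrable; the product rule and the comparison
  arguments are then proved for densities.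

  The equation of the master contains the mean of its couplings to the slaves. Its kinetic energy is
  therefore weighted by \<open>N\<close>, and each slave gets its own copy of the delay term of the
  master: after summation the couplings cancel, and each slave uses exactly its own matrix
  inequality.

  The constant force left by unbalanced gains is counted as part of the load of the master. A
  bounded load may contain it, a square integrable one may not; balanced gains remove it where
  convergence is claimed.

  The order of the estimates matters. The error is bounded first, and the rate constant of the
  quadratic estimate then depends on that bound. Positions are integrals of velocities: exponential
  decay bounds them, whereas \<open>W \<rightarrow> 0\<close> without a rate would not.\<close>

text \<open>The integral form of absolute continuity. It replaces differentiability almost everywhere:
  all rates below are densities in this sense.\<close>

definition primitive :: "real \<Rightarrow> (real \<Rightarrow> 'a::euclidean_space) \<Rightarrow> (real \<Rightarrow> 'a) \<Rightarrow> bool" where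
  "primitive a F f \<longleftrightarrow>
     (\<forall>b\<ge>a. f absolutely_integrable_on {a..b} \<and> (f has_integral F b - F a) {a..b})"

lemma primitive_absolutely_integrable:
  assumes "primitive a F f" "a \<le> s"
  shows "f absolutely_integrable_on {s..t}"
proof (cases "s \<le> t")
  case True
  with assms have "f absolutely_integrable_on {a..t}" by (auto simp: primitive_def)
  then show ?thesis
    by (rule absolutely_integrable_on_subinterval) (use assms in auto)
qed simp

lemma primitive_has_integral:
  assumes "primitive a F f" "a \<le> s" "s \<le> t"
  shows "(f has_integral F t - F s) {s..t}"
proof -
  have i: "(f has_integral F s - F a) {a..s}" "(f has_integral F t - F a) {a..t}"
    using assms by (auto simp: primitive_def)
  have "f integrable_on {s..t}"
    using primitive_absolutely_integrable[OF assms(1,2)] set_lebesgue_integral_eq_integral(1) by blast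
  then obtain I where I: "(f has_integral I) {s..t}" by blast
  have "(f has_integral (F s - F a) + I) {a..t}"
    using has_integral_combine[OF assms(2,3) i(1) I] .
  then have "(F s - F a) + I = F t - F a"
    using i(2) has_integral_unique by blast
  then have "I = F t - F s" by (simp add: algebra_simps)
  then show ?thesis using I by simp
qed

lemma primitive_continuous_on:
  assumes "primitive a F f"
  shows "continuous_on {a..b} F"
proof -
  have "continuous_on {a..b} (\<lambda>t. F a + integral {a..t} f)"
    using primitive_absolutely_integrable[OF assms, of a b] set_lebesgue_integral_eq_integral(1)
    by (intro continuous_intros indefinite_integral_continuous_1) blast
  moreover have "F a + integral {a..t} f = F t" if "t \<in> {a..b}" for t
    using primitive_has_integral[OF assms order_refl, of t] that by (auto dest: integral_unique)
  ultimately show ?thesis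
    using continuous_on_cong[of "{a..b}" "{a..b}" "\<lambda>t. F a + integral {a..t} f" F] by blast
qed

text \<open>The fundamental theorem gives a gauge integral; boundedness on compact intervals
  upgrades it to an absolute one. Continuity of the density is avoided because the rate of the
  inertia matrix is only known to be bounded.\<close>

lemma primitive_of_derivative:
  fixes F :: "real \<Rightarrow> 'a::euclidean_space"
  assumes "\<And>t. a \<le> t \<Longrightarrow> (F has_vector_derivative f t) (at t)"
    and "\<And>b. \<exists>K. \<forall>t\<in>{a..b}. norm (f t) \<le> K"
  shows "primitive a F f"
  unfolding primitive_def
proof (intro allI impI)
  fix b assume b: "a \<le> b"
  have I: "(f has_integral F b - F a) {a..b}"
    by (rule fundamental_theorem_of_calculus[OF b])
       (use assms(1) in \<open>auto intro: has_vector_derivative_at_within\<close>)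
  obtain K where K: "\<forall>t\<in>{a..b}. norm (f t) \<le> K" using assms(2) by blast
  have "f absolutely_integrable_on {a..b}"
    by (rule measurable_bounded_by_integrable_imp_absolutely_integrable[where g = "\<lambda>_. K"])
       (use I K in \<open>auto intro!: integrable_imp_measurable simp: integrable_on_def\<close>)
  with I show "f absolutely_integrable_on {a..b} \<and> (f has_integral F b - F a) {a..b}" by simp
qed

lemma primitive_of_continuous_derivative:
  fixes F :: "real \<Rightarrow> 'a::euclidean_space"
  assumes "\<And>t. a \<le> t \<Longrightarrow> (F has_vector_derivative f t) (at t)" and "continuous_on {a..} f"
  shows "primitive a F f"
proof (rule primitive_of_derivative[OF assms(1)])
  fix b
  have "compact (f ` {a..b})"
    by (intro compact_continuous_image continuous_on_subset[OF assms(2)]) auto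
  then show "\<exists>K. \<forall>t\<in>{a..b}. norm (f t) \<le> K"
    using compact_imp_bounded bounded_iff by (metis image_eqI)
qed

lemma primitive_add:
  "primitive a F f \<Longrightarrow> primitive a G g \<Longrightarrow> primitive a (\<lambda>t. F t + G t) (\<lambda>t. f t + g t)"
  unfolding primitive_def
  by (auto intro!: set_integral_add simp: add_diff_add dest: has_integral_add)

lemma primitive_scaleR: "primitive a F f \<Longrightarrow> primitive a (\<lambda>t. c *\<^sub>R F t) (\<lambda>t. c *\<^sub>R f t)"
  unfolding primitive_def
  by (auto simp: scaleR_diff_right[symmetric] intro!: has_integral_cmul)

lemma primitive_cmult: "primitive a F f \<Longrightarrow> primitive a (\<lambda>t. c * F t) (\<lambda>t. c * f t)"
  for F :: "real \<Rightarrow> real"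
  using primitive_scaleR[of a F f c] by simp

lemma primitive_sum:
  assumes "\<And>i. i \<in> I \<Longrightarrow> primitive a (F i) (f i)"
  shows "primitive a (\<lambda>t. \<Sum>i\<in>I. F i t) (\<lambda>t. \<Sum>i\<in>I. f i t)"
  using assms
proof (induction I rule: infinite_finite_induct)
  case (insert i I)
  then show ?case using primitive_add[of a "F i" "f i" "\<lambda>t. \<Sum>i\<in>I. F i t"] by simp
qed (auto simp: primitive_def)

text \<open>Telescoping over steps of length at most \<open>\<delta>\<close> carries the local
  estimate to the whole interval with the same \<open>\<epsilon>\<close>, which is arbitrary. It
  takes the place of an argument by vanishing derivatives, which would need a derivative at every
  point.\<close>

lemma constant_of_local_estimate:
  fixes E :: "real \<Rightarrow> 'a::euclidean_space" and K :: "real \<Rightarrow> real"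
  assumes ab: "a \<le> b"
    and loc: "\<And>\<epsilon>. 0 < \<epsilon> \<Longrightarrow> \<exists>\<delta>>0. \<forall>s t. a \<le> s \<and> s \<le> t \<and> t \<le> b \<and> t - s \<le> \<delta> \<longrightarrow>
                norm (E t - E s) \<le> \<epsilon> * (K t - K s)"
  shows "E b = E a"
proof -
  have bound: "norm (E b - E a) \<le> \<epsilon> * (K b - K a)" if "0 < \<epsilon>" for \<epsilon>
  proof -
    obtain \<delta> where "0 < \<delta>" and \<delta>: "\<forall>s t. a \<le> s \<and> s \<le> t \<and> t \<le> b \<and> t - s \<le> \<delta> \<longrightarrow>
        norm (E t - E s) \<le> \<epsilon> * (K t - K s)"
      using loc[of \<epsilon>] \<open>0 < \<epsilon>\<close> by blast
    have "norm (E t - E a) \<le> \<epsilon> * (K t - K a)" if "t \<in> {a..b}" "t \<le> a + real n * \<delta>" for t n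
      using that
    proof (induction n arbitrary: t)
      case 0
      then show ?case by simp
    next
      case (Suc n)
      \<comment> \<open>One step back from \<open>t\<close>, clipped at \<open>a\<close>: the
        induction counts steps of length \<open>\<delta>\<close>.\<close>
      define r where "r = max a (t - \<delta>)"
      have r: "a \<le> r" "r \<le> t" "t - r \<le> \<delta>" "r \<le> a + real n * \<delta>"
        using Suc.prems \<open>0 < \<delta>\<close> by (auto simp: r_def algebra_simps)
      have "norm (E r - E a) \<le> \<epsilon> * (K r - K a)"
        using Suc.IH[of r] r Suc.prems by simp
      moreover have "norm (E t - E r) \<le> \<epsilon> * (K t - K r)"
        using \<delta> r Suc.prems by simp
      moreover have "norm (E t - E a) \<le> norm (E t - E r) + norm (E r - E a)"
        by (metis diff_add_cancel add_diff_eq norm_triangle_ineq)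
      ultimately show ?case by (simp add: algebra_simps)
    qed
    moreover obtain n :: nat where "(b - a) / \<delta> \<le> real n" using real_arch_simple by blast
    ultimately show ?thesis
      using ab \<open>0 < \<delta>\<close> by (auto simp: field_simps)
  qed
  have "norm (E b - E a) \<le> 0"
  proof (rule field_le_epsilon)
    fix e :: real assume "0 < e"
    \<comment> \<open>The added 1 keeps the divisor positive even if \<open>K\<close> has no
      increment.\<close>
    define k where "k = \<bar>K b - K a\<bar> + 1"
    have "norm (E b - E a) \<le> e / k * (K b - K a)"
      using bound[of "e / k"] \<open>0 < e\<close> by (simp add: k_def)
    also have "\<dots> \<le> e / k * k"
      using \<open>0 < e\<close> by (intro mult_left_mono) (auto simp: k_def)
    also have "\<dots> = e" by (simp add: k_def)
    finally show "norm (E b - E a) \<le> 0 + e" by simp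
  qed
  then show ?thesis by simp
qed

text \<open>The product rule. The defect \<open>E\<close> between \<open>h (F t) (G t)\<close> and
  the integral of the expected density changes over a short interval by at most the oscillation of
  \<open>F\<close> and \<open>G\<close> times the integral of
  \<open>norm (f t) + norm (g t)\<close>. Uniform continuity makes this oscillation small, so the
  defect is constant.\<close>

lemma primitive_bilinear:
  fixes h :: "'a::euclidean_space \<Rightarrow> 'b::euclidean_space \<Rightarrow> 'c::euclidean_space"
  assumes h: "bilinear h" and F: "primitive a F f" and G: "primitive a G g"
  shows "primitive a (\<lambda>t. h (F t) (G t)) (\<lambda>t. h (f t) (G t) + h (F t) (g t))"
  unfolding primitive_def
proof (intro allI impI)
  fix b assume ab: "a \<le> b"
  interpret h: bounded_bilinear h using h by (simp add: bilinear_conv_bounded_bilinear)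
  obtain B where B: "B > 0" "\<And>x y. norm (h x y) \<le> norm x * norm y * B"
    using h.pos_bounded by blast
  have cont: "continuous_on {a..b} F" "continuous_on {a..b} G"
    using F G primitive_continuous_on by auto
  have bdd: "bounded (F ` {a..b})" "bounded (G ` {a..b})"
    using cont by (auto intro!: compact_imp_bounded compact_continuous_image)
  have meas: "F \<in> borel_measurable (lebesgue_on {a..b})" "G \<in> borel_measurable (lebesgue_on {a..b})"
    using cont by (auto intro: continuous_imp_measurable_on_sets_lebesgue)
  have fg: "f absolutely_integrable_on {a..b}" "g absolutely_integrable_on {a..b}"
    using F G ab by (auto simp: primitive_def)
  \<comment> \<open>The product lemma takes the bounded measurable factor first, hence the flipped
    arguments for \<open>h (f t) (G t)\<close>.\<close>
  have "bilinear (\<lambda>x y. h y x)" using h by (auto simp: bilinear_def)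
  then have ai: "(\<lambda>t. h (f t) (G t)) absolutely_integrable_on {a..b}"
    using absolutely_integrable_bounded_measurable_product[of "\<lambda>x y. h y x" G "{a..b}" f] meas bdd fg
    by auto
  have ai2: "(\<lambda>t. h (F t) (g t)) absolutely_integrable_on {a..b}"
    using absolutely_integrable_bounded_measurable_product[of h F "{a..b}" g] h meas bdd fg by auto
  define p where "p = (\<lambda>t. h (f t) (G t) + h (F t) (g t))"
  have p: "p absolutely_integrable_on {a..b}"
    unfolding p_def using ai ai2 by (rule set_integral_add)
  define k where "k = (\<lambda>t. norm (f t) + norm (g t))"
  have k: "k absolutely_integrable_on {a..b}"
    unfolding k_def using fg by (intro set_integral_add) (auto intro: set_integrable_norm)
  define E where "E = (\<lambda>t. h (F t) (G t) - integral {a..t} p)"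
  define K where "K = (\<lambda>t. integral {a..t} k)"
  have "E b = E a"
  proof (rule constant_of_local_estimate[OF ab, where K = K])
    fix \<epsilon> :: real assume "0 < \<epsilon>"
    define \<eta> where "\<eta> = \<epsilon> / B"
    have \<eta>: "0 < \<eta>" using \<open>0 < \<epsilon>\<close> B by (simp add: \<eta>_def)
    have "uniformly_continuous_on {a..b} F" "uniformly_continuous_on {a..b} G"
      using cont by (auto intro: compact_uniformly_continuous)
    then obtain d1 d2 where d: "d1 > 0" "d2 > 0"
      and d1: "\<And>x y. x \<in> {a..b} \<Longrightarrow> y \<in> {a..b} \<Longrightarrow> dist x y < d1 \<Longrightarrow> dist (F x) (F y) < \<eta>"
      and d2: "\<And>x y. x \<in> {a..b} \<Longrightarrow> y \<in> {a..b} \<Longrightarrow> dist x y < d2 \<Longrightarrow> dist (G x) (G y) < \<eta>"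
      unfolding uniformly_continuous_on_def using \<eta> by metis
    \<comment> \<open>Halved because uniform continuity asks for a strict inequality while
      \<open>t - s \<le> \<delta>\<close> is not strict.\<close>
    define \<delta> where "\<delta> = min d1 d2 / 2"
    have "norm (E t - E s) \<le> \<epsilon> * (K t - K s)" if st: "a \<le> s" "s \<le> t" "t \<le> b" "t - s \<le> \<delta>" for s t
    proof -
      have sub: "{s..t} \<subseteq> {a..b}" "{a..t} \<subseteq> {a..b}" using st by auto
      have int: "p integrable_on {a..t}" "k integrable_on {a..t}" "p integrable_on {s..t}"
         "k integrable_on {s..t}"
        using p k sub absolutely_integrable_on_subinterval set_lebesgue_integral_eq_integral(1) by blast+
      have "integral {a..s} p + integral {s..t} p = integral {a..t} p"
           "integral {a..s} k + integral {s..t} k = integral {a..t} k"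
        using int st by (auto intro: Henstock_Kurzweil_Integration.integral_combine)
      then have Kd: "K t - K s = integral {s..t} k"
        and Ed: "E t - E s = h (F t) (G t) - h (F s) (G s) - integral {s..t} p"
        by (auto simp: K_def E_def algebra_simps)
      have "(f has_integral F t - F s) {s..t}" "(g has_integral G t - G s) {s..t}"
        using primitive_has_integral[OF F st(1,2)] primitive_has_integral[OF G st(1,2)] .
      \<comment> \<open>The increment of the product splits into two parts with one factor frozen,
        \<open>G\<close> at \<open>t\<close> and \<open>F\<close> at \<open>s\<close>; both are
        integrals of known densities.\<close>
      then have 1: "((\<lambda>x. h (f x) (G t)) has_integral h (F t - F s) (G t)) {s..t}"
        and 2: "((\<lambda>x. h (F s) (g x)) has_integral h (F s) (G t - G s)) {s..t}"
        using has_integral_linear[OF _ h.bounded_linear_left]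
          has_integral_linear[OF _ h.bounded_linear_right] by (auto simp: o_def)
      have "((\<lambda>x. (h (f x) (G t) + h (F s) (g x)) - p x) has_integral
          (h (F t - F s) (G t) + h (F s) (G t - G s)) - integral {s..t} p) {s..t}"
        using 1 2 int by (intro has_integral_diff has_integral_add integrable_integral)
      moreover have "h (F t - F s) (G t) + h (F s) (G t - G s) = h (F t) (G t) - h (F s) (G s)"
        by (simp add: h.diff_left h.diff_right)
      ultimately have I: "((\<lambda>x. (h (f x) (G t) + h (F s) (g x)) - p x) has_integral E t - E s) {s..t}"
        by (simp add: Ed)
      have "norm (integral {s..t} (\<lambda>x. (h (f x) (G t) + h (F s) (g x)) - p x))
          \<le> integral {s..t} (\<lambda>x. \<epsilon> * k x)"
      proof (rule integral_norm_bound_integral)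
        show "(\<lambda>x. (h (f x) (G t) + h (F s) (g x)) - p x) integrable_on {s..t}" using I by blast
        show "(\<lambda>x. \<epsilon> * k x) integrable_on {s..t}" using integrable_cmul[OF int(4), of \<epsilon>] by simp
      next
        fix x assume x: "x \<in> {s..t}"
        have "(h (f x) (G t) + h (F s) (g x)) - p x = h (f x) (G t - G x) + h (F s - F x) (g x)"
          by (simp add: p_def h.diff_left h.diff_right)
        moreover have "norm (h (f x) (G t - G x)) \<le> norm (f x) * \<eta> * B"
        proof -
          have "norm (G t - G x) \<le> \<eta>"
            using d2[of t x] x st d by (auto simp: dist_norm \<delta>_def)
          then have "norm (f x) * norm (G t - G x) * B \<le> norm (f x) * \<eta> * B"
            using B(1) by (intro mult_right_mono mult_left_mono) auto
          then show ?thesis using B(2) order_trans by blast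
        qed
        moreover have "norm (h (F s - F x) (g x)) \<le> \<eta> * norm (g x) * B"
        proof -
          have "norm (F s - F x) \<le> \<eta>"
            using d1[of s x] x st d by (auto simp: dist_norm \<delta>_def)
          then have "norm (F s - F x) * norm (g x) * B \<le> \<eta> * norm (g x) * B"
            using B(1) by (intro mult_right_mono) auto
          then show ?thesis using B(2) order_trans by blast
        qed
        moreover have "norm (f x) * \<eta> * B + \<eta> * norm (g x) * B = \<epsilon> * k x"
          using B(1) by (simp add: \<eta>_def k_def field_simps)
        ultimately show "norm ((h (f x) (G t) + h (F s) (g x)) - p x) \<le> \<epsilon> * k x"
          by (metis norm_triangle_mono)
      qed
      then show ?thesis
        using integral_unique[OF I] by (simp add: Kd)
    qed
    then show "\<exists>\<delta>>0. \<forall>s t. a \<le> s \<and> s \<le> t \<and> t \<le> b \<and> t - s \<le> \<delta> \<longrightarrow>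
                norm (E t - E s) \<le> \<epsilon> * (K t - K s)"
      using d by (intro exI[of _ \<delta>]) (auto simp: \<delta>_def)
  qed
  then have "integral {a..b} p = h (F b) (G b) - h (F a) (G a)"
    by (simp add: E_def algebra_simps)
  then have "(p has_integral h (F b) (G b) - h (F a) (G a)) {a..b}"
    using p set_lebesgue_integral_eq_integral(1) by (metis integrable_integral)
  then show "(\<lambda>t. h (f t) (G t) + h (F t) (g t)) absolutely_integrable_on {a..b} \<and>
      ((\<lambda>t. h (f t) (G t) + h (F t) (g t)) has_integral h (F b) (G b) - h (F a) (G a)) {a..b}"
    using p by (simp add: p_def)
qed

section \<open>Quadratic forms and the matrix inequality\<close>

lemma symmetric_inner_commute:
  fixes A :: "real^'n^'n"
  assumes "transpose A = A"
  shows "x \<bullet> (A *v y) = y \<bullet> (A *v x)"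
  by (metis assms dot_lmul_matrix inner_commute transpose_matrix_vector)

text \<open>The minimum of the form on the compact unit sphere is positive; homogeneity carries it
  to all vectors.\<close>

lemma pos_def_coercive:
  fixes A :: "real^'n^'n"
  assumes "pos_def A"
  obtains \<kappa> where "0 < \<kappa>" "\<And>x. \<kappa> * (x \<bullet> x) \<le> x \<bullet> (A *v x)"
proof -
  have "\<exists>x\<in>sphere 0 1. \<forall>y\<in>sphere 0 1. x \<bullet> (A *v x) \<le> y \<bullet> (A *v y)"
  proof (rule continuous_attains_inf)
    have "axis undefined 1 \<in> sphere (0::real^'n) 1" by (simp add: norm_axis_1)
    then show "sphere (0::real^'n) 1 \<noteq> {}" by blast
    show "continuous_on (sphere 0 1) (\<lambda>x. x \<bullet> (A *v x))"
      by (intro continuous_intros matrix_vector_mult_linear_continuous_on)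
  qed simp
  then obtain z :: "real^'n" where z: "norm z = 1"
    and min: "\<And>y. norm y = 1 \<Longrightarrow> z \<bullet> (A *v z) \<le> y \<bullet> (A *v y)"
    by auto
  define \<kappa> where "\<kappa> = z \<bullet> (A *v z)"
  have "0 < \<kappa>" using assms z unfolding \<kappa>_def pos_def_def by (metis norm_zero zero_neq_one)
  moreover have "\<kappa> * (x \<bullet> x) \<le> x \<bullet> (A *v x)" for x
  proof (cases "x = 0")
    case False
    then have "\<kappa> \<le> ((1 / norm x) *\<^sub>R x) \<bullet> (A *v ((1 / norm x) *\<^sub>R x))"
      unfolding \<kappa>_def by (intro min) simp
    also have "\<dots> = x \<bullet> (A *v x) / (norm x)\<^sup>2"
      by (simp add: matrix_vector_mult_scaleR power2_eq_square)
    finally show ?thesis using False by (simp add: field_simps power2_norm_eq_inner)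
  qed simp
  ultimately show thesis using that by blast
qed

lemma matrix_norm_bound:
  fixes A :: "real^'n^'n"
  obtains B where "0 < B" "\<And>x. norm (A *v x) \<le> B * norm x"
  using linear_bounded_pos[OF matrix_vector_mul_linear[of A]] by blast

lemma vector_4:
  "(vector [w, x, y, z] :: 'a::zero^4) $ 1 = w"
  "(vector [w, x, y, z] :: 'a::zero^4) $ 2 = x"
  "(vector [w, x, y, z] :: 'a::zero^4) $ 3 = y"
  "(vector [w, x, y, z] :: 'a::zero^4) $ 4 = z"
  unfolding vector_def by simp_all

lemma flatten_blocks_quadratic_form:
  fixes B :: "(real^'n^'n)^'b^'b" and x :: "real^'n^'b"
  defines "X \<equiv> \<chi> r. x $ fst r $ snd r"
  shows "X \<bullet> (flatten_blocks B *v X) = (\<Sum>b\<in>UNIV. \<Sum>c\<in>UNIV. x $ b \<bullet> (B $ b $ c *v x $ c))"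
    and "X \<bullet> X = (\<Sum>b\<in>UNIV. x $ b \<bullet> x $ b)"
proof -
  have pair: "sum f UNIV = (\<Sum>b\<in>UNIV. \<Sum>k\<in>UNIV. f (b, k))" for f :: "'b \<times> 'n \<Rightarrow> real"
    by (simp add: sum.cartesian_product flip: UNIV_Times_UNIV)
  show "X \<bullet> X = (\<Sum>b\<in>UNIV. x $ b \<bullet> x $ b)"
    by (simp add: X_def inner_vec_def pair)
  have "X \<bullet> (flatten_blocks B *v X)
      = (\<Sum>b\<in>UNIV. \<Sum>k\<in>UNIV. \<Sum>c\<in>UNIV. \<Sum>l\<in>UNIV. x $ b $ k * (B $ b $ c $ k $ l * x $ c $ l))"
    by (simp add: X_def inner_vec_def matrix_vector_mult_def flatten_blocks_def pair sum_distrib_left)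
  also have "\<dots> = (\<Sum>b\<in>UNIV. \<Sum>c\<in>UNIV. \<Sum>k\<in>UNIV. \<Sum>l\<in>UNIV. x $ b $ k * (B $ b $ c $ k $ l * x $ c $ l))"
    by (intro sum.cong refl sum.swap)
  also have "\<dots> = (\<Sum>b\<in>UNIV. \<Sum>c\<in>UNIV. x $ b \<bullet> (B $ b $ c *v x $ c))"
    by (simp add: inner_vec_def matrix_vector_mult_def sum_distrib_left)
  finally show "X \<bullet> (flatten_blocks B *v X) = (\<Sum>b\<in>UNIV. \<Sum>c\<in>UNIV. x $ b \<bullet> (B $ b $ c *v x $ c))" .
qed

text \<open>In the order of the block rows, the vectors stand for the velocities of master and slave
  and their displacements over the delay. Coercivity of the negated matrix turns strict negativity
  into a uniform margin \<open>\<epsilon>\<close>; symmetry of \<open>Kp\<close> merges the two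
  off-diagonal copies into the factor 2.\<close>

lemma lmi_quadratic_form:
  fixes Kp Kd Rm Rs :: "real^'n^'n"
  assumes lmi: "neg_def (lmi_matrix hM hS Kp Kd Rm Rs)" and Kp: "transpose Kp = Kp"
  obtains \<epsilon> where "0 < \<epsilon>"
    "\<And>v w x y. - 2 * (v \<bullet> (Kd *v v)) + hM * (v \<bullet> (Rm *v v)) - 2 * (w \<bullet> (Kd *v w)) + hS * (w \<bullet> (Rs *v w))
       - 2 * (v \<bullet> (Kp *v y)) - 2 * (w \<bullet> (Kp *v x))
       - (x \<bullet> (Rm *v x)) / hM - (y \<bullet> (Rs *v y)) / hS
     \<le> - \<epsilon> * (v \<bullet> v + w \<bullet> w + x \<bullet> x + y \<bullet> y)"
proof -
  define L where "L = lmi_matrix hM hS Kp Kd Rm Rs"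
  have neg: "(- L) *v z = - (L *v z)" for z
    using matrix_vector_mult_diff_rdistrib[of 0 L z] by simp
  have "pos_def (- L)"
    using lmi unfolding L_def[symmetric] neg_def_def pos_def_def
    by (auto simp: neg transpose_def vec_eq_iff)
  then obtain \<epsilon> where "0 < \<epsilon>" and \<epsilon>: "\<And>z. \<epsilon> * (z \<bullet> z) \<le> z \<bullet> ((- L) *v z)"
    using pos_def_coercive by blast
  have "- 2 * (v \<bullet> (Kd *v v)) + hM * (v \<bullet> (Rm *v v)) - 2 * (w \<bullet> (Kd *v w)) + hS * (w \<bullet> (Rs *v w))
       - 2 * (v \<bullet> (Kp *v y)) - 2 * (w \<bullet> (Kp *v x))
       - (x \<bullet> (Rm *v x)) / hM - (y \<bullet> (Rs *v y)) / hS
     \<le> - \<epsilon> * (v \<bullet> v + w \<bullet> w + x \<bullet> x + y \<bullet> y)" for v w x y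
  proof -
    define z where "z = (vector [v, w, x, y] :: real^'n^4)"
    define Z where "Z = (\<chi> r. z $ fst r $ snd r)"
    have neg': "(- A) *v u = - (A *v u)" for A :: "real^'n^'n" and u
      using matrix_vector_mult_diff_rdistrib[of 0 A u] by simp
    have scale: "(c *\<^sub>R A) *v u = c *\<^sub>R (A *v u)" for A :: "real^'n^'n" and u c
      by (simp add: scaleR_matrix_vector_assoc)
    have sym: "y \<bullet> (Kp *v v) = v \<bullet> (Kp *v y)" "x \<bullet> (Kp *v w) = w \<bullet> (Kp *v x)"
      using symmetric_inner_commute[OF Kp] by auto
    have "Z \<bullet> (L *v Z) = - 2 * (v \<bullet> (Kd *v v)) + hM * (v \<bullet> (Rm *v v)) - 2 * (w \<bullet> (Kd *v w))
       + hS * (w \<bullet> (Rs *v w)) - 2 * (v \<bullet> (Kp *v y)) - 2 * (w \<bullet> (Kp *v x))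
       - (x \<bullet> (Rm *v x)) / hM - (y \<bullet> (Rs *v y)) / hS"
      unfolding Z_def L_def lmi_matrix_def flatten_blocks_quadratic_form(1)
      by (simp add: sum_4 z_def vector_4 neg' scale matrix_vector_mult_add_rdistrib
          matrix_vector_mult_diff_rdistrib inner_add_right inner_diff_right Kp sym)
    moreover have "Z \<bullet> Z = v \<bullet> v + w \<bullet> w + x \<bullet> x + y \<bullet> y"
      unfolding Z_def flatten_blocks_quadratic_form(2) by (simp add: sum_4 z_def vector_4)
    ultimately show ?thesis using \<epsilon>[of Z] by (simp add: neg)
  qed
  with \<open>0 < \<epsilon>\<close> show thesis using that by blast
qed

text \<open>Young's inequality, by completing the square
  \<open>(2 * \<eta> * norm x - b * norm z)\<^sup>2\<close>.\<close>

lemma inner_le_weighted_squares: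
  fixes x y :: "'a::real_inner"
  assumes "0 < \<eta>" and "norm y \<le> b * norm z"
  shows "x \<bullet> y \<le> \<eta> * (x \<bullet> x) + b\<^sup>2 / (4 * \<eta>) * (z \<bullet> z)"
proof -
  have "x \<bullet> y \<le> norm x * (b * norm z)"
    using norm_cauchy_schwarz[of x y] mult_left_mono[OF assms(2) norm_ge_zero[of x]] by linarith
  moreover have "0 \<le> (2 * \<eta> * norm x - b * norm z)\<^sup>2 / (4 * \<eta>)" using assms by simp
  moreover have "(2 * \<eta> * norm x - b * norm z)\<^sup>2 / (4 * \<eta>)
      = \<eta> * (norm x)\<^sup>2 - norm x * (b * norm z) + b\<^sup>2 / (4 * \<eta>) * (norm z)\<^sup>2"
    using assms by (simp add: field_simps power2_eq_square)
  ultimately show ?thesis by (simp add: power2_norm_eq_inner)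
qed

text \<open>Nonnegativity of the form at \<open>x + y\<close> and \<open>x - y\<close> bounds the
  mixed term by the two diagonal ones.\<close>

lemma quadratic_form_inner_le:
  fixes M :: "real^'n^'n"
  assumes "transpose M = M" and "\<And>x. 0 \<le> x \<bullet> (M *v x) \<and> x \<bullet> (M *v x) \<le> u * (x \<bullet> x)"
  shows "\<bar>x \<bullet> (M *v y)\<bar> \<le> u / 2 * (x \<bullet> x + y \<bullet> y)"
proof -
  have "0 \<le> (x + y) \<bullet> (M *v (x + y))" "0 \<le> (x - y) \<bullet> (M *v (x - y))" using assms(2) by blast+
  moreover have "(x + y) \<bullet> (M *v (x + y)) = x \<bullet> (M *v x) + 2 * (x \<bullet> (M *v y)) + y \<bullet> (M *v y)"
    "(x - y) \<bullet> (M *v (x - y)) = x \<bullet> (M *v x) - 2 * (x \<bullet> (M *v y)) + y \<bullet> (M *v y)"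
    using symmetric_inner_commute[OF assms(1), of x y]
    by (auto simp: matrix_vector_right_distrib matrix_vector_mult_diff_distrib algebra_simps)
  ultimately have "2 * \<bar>x \<bullet> (M *v y)\<bar> \<le> x \<bullet> (M *v x) + y \<bullet> (M *v y)" by linarith
  also have "\<dots> \<le> u * (x \<bullet> x + y \<bullet> y)"
    using assms(2)[of x] assms(2)[of y] by (simp add: algebra_simps)
  finally show ?thesis by simp
qed

text \<open>\<open>I\<close> and \<open>J\<close> stand for the window integrals of the velocity
  forms, and the first two premises are Jensen's inequality. A plain use would spend all of
  \<open>I\<close> and \<open>J\<close> on the displacement terms; keeping a share of them is
  necessary because the storage function itself contains the delay functionals, which must decay
  too.\<close>

lemma krasovskii_dissipation:
  fixes Kp Kd Rm Rs :: "real^'n^'n"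
  assumes lmi: "neg_def (lmi_matrix hM hS Kp Kd Rm Rs)" and Kp: "transpose Kp = Kp"
    and h: "0 < hM" "0 < hS"
  obtains \<epsilon> where "0 < \<epsilon>"
    "\<And>v w x y I J. x \<bullet> (Rm *v x) \<le> hM * I \<Longrightarrow> y \<bullet> (Rs *v y) \<le> hS * J \<Longrightarrow> 0 \<le> I \<Longrightarrow> 0 \<le> J \<Longrightarrow>
      - 2 * (v \<bullet> (Kd *v v)) + hM * (v \<bullet> (Rm *v v)) - 2 * (w \<bullet> (Kd *v w)) + hS * (w \<bullet> (Rs *v w))
       - 2 * (v \<bullet> (Kp *v y)) - 2 * (w \<bullet> (Kp *v x)) - I - J
     \<le> - \<epsilon> * (v \<bullet> v + w \<bullet> w + x \<bullet> x + y \<bullet> y + I + J)"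
proof -
  obtain \<epsilon> where "0 < \<epsilon>" and \<epsilon>: "\<And>v w x y. - 2 * (v \<bullet> (Kd *v v)) + hM * (v \<bullet> (Rm *v v))
      - 2 * (w \<bullet> (Kd *v w)) + hS * (w \<bullet> (Rs *v w)) - 2 * (v \<bullet> (Kp *v y)) - 2 * (w \<bullet> (Kp *v x))
       - (x \<bullet> (Rm *v x)) / hM - (y \<bullet> (Rs *v y)) / hS
     \<le> - \<epsilon> * (v \<bullet> v + w \<bullet> w + x \<bullet> x + y \<bullet> y)"
    using lmi_quadratic_form[OF lmi Kp] by blast
  obtain B B' where B: "0 < B" "\<And>x. norm (Rm *v x) \<le> B * norm x"
    and B': "0 < B'" "\<And>x. norm (Rs *v x) \<le> B' * norm x"
    using matrix_norm_bound by metis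
  have R: "x \<bullet> (Rm *v x) \<le> B * (x \<bullet> x)" "x \<bullet> (Rs *v x) \<le> B' * (x \<bullet> x)" for x
  proof -
    have "x \<bullet> (A *v x) \<le> b * (x \<bullet> x)" if "norm (A *v x) \<le> b * norm x" for A :: "real^'n^'n" and b
      using norm_cauchy_schwarz[of x "A *v x"] mult_left_mono[OF that norm_ge_zero[of x]]
      by (simp add: power2_eq_square algebra_simps flip: power2_norm_eq_inner)
    then show "x \<bullet> (Rm *v x) \<le> B * (x \<bullet> x)" "x \<bullet> (Rs *v x) \<le> B' * (x \<bullet> x)" using B B' by auto
  qed
  \<comment> \<open>The share of \<open>I\<close> and \<open>J\<close> that is kept. It weakens the
    displacement terms by at most \<open>\<epsilon> / 2\<close> times the squared norm, which half
    of the margin covers.\<close>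
  define \<delta> where "\<delta> = min 1 (min (\<epsilon> / 2 * (hM / B)) (\<epsilon> / 2 * (hS / B')))"
  have \<delta>: "0 < \<delta>" "\<delta> \<le> 1" "\<delta> * (B / hM) \<le> \<epsilon> / 2" "\<delta> * (B' / hS) \<le> \<epsilon> / 2"
  proof -
    show "0 < \<delta>" "\<delta> \<le> 1" using \<open>0 < \<epsilon>\<close> B B' h by (auto simp: \<delta>_def)
    have "\<delta> \<le> \<epsilon> / 2 * (hM / B)" "\<delta> \<le> \<epsilon> / 2 * (hS / B')" by (auto simp: \<delta>_def)
    then show "\<delta> * (B / hM) \<le> \<epsilon> / 2" "\<delta> * (B' / hS) \<le> \<epsilon> / 2"
      using B B' h by (auto simp: field_simps)
  qed
  have slack: "- I \<le> - \<delta> * I - (x \<bullet> (R *v x)) / h + \<epsilon> / 2 * (x \<bullet> x)"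
    if "x \<bullet> (R *v x) \<le> h * I" "x \<bullet> (R *v x) \<le> b * (x \<bullet> x)" "0 < h" "\<delta> * (b / h) \<le> \<epsilon> / 2"
    for x :: "real^'n" and R h b I
  proof -
    define p where "p = x \<bullet> (R *v x) / h"
    have "p \<le> I" using that by (simp add: p_def field_simps)
    then have "(1 - \<delta>) * p \<le> (1 - \<delta>) * I"
      using \<delta> by (intro mult_left_mono) auto
    moreover have "\<delta> * p \<le> \<delta> * ((b * (x \<bullet> x)) / h)"
      unfolding p_def using that \<delta> by (intro mult_left_mono divide_right_mono) auto
    moreover have "\<delta> * ((b * (x \<bullet> x)) / h) \<le> \<epsilon> / 2 * (x \<bullet> x)"
      using mult_right_mono[OF that(4) inner_ge_zero[of x]] by (simp add: field_simps)
    ultimately show ?thesis unfolding p_def[symmetric] by (simp only: left_diff_distrib mult_1)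
  qed
  define \<eta> where "\<eta> = min \<delta> (\<epsilon> / 2)"
  have \<eta>: "0 < \<eta>" "\<eta> \<le> \<delta>" "\<eta> \<le> \<epsilon> / 2" using \<delta> \<open>0 < \<epsilon>\<close> by (auto simp: \<eta>_def)
  have "- 2 * (v \<bullet> (Kd *v v)) + hM * (v \<bullet> (Rm *v v)) - 2 * (w \<bullet> (Kd *v w)) + hS * (w \<bullet> (Rs *v w))
       - 2 * (v \<bullet> (Kp *v y)) - 2 * (w \<bullet> (Kp *v x)) - I - J
     \<le> - \<eta> * (v \<bullet> v + w \<bullet> w + x \<bullet> x + y \<bullet> y + I + J)"
    if IJ: "x \<bullet> (Rm *v x) \<le> hM * I" "y \<bullet> (Rs *v y) \<le> hS * J"
      and nn: "0 \<le> I" "0 \<le> J" for v w x y I J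
  proof -
    have "- I \<le> - \<delta> * I - (x \<bullet> (Rm *v x)) / hM + \<epsilon> / 2 * (x \<bullet> x)"
      "- J \<le> - \<delta> * J - (y \<bullet> (Rs *v y)) / hS + \<epsilon> / 2 * (y \<bullet> y)"
      using slack[OF IJ(1) R(1) h(1) \<delta>(3)] slack[OF IJ(2) R(2) h(2) \<delta>(4)] .
    moreover have "\<eta> * I \<le> \<delta> * I" "\<eta> * J \<le> \<delta> * J" using nn \<eta> by (auto intro: mult_right_mono)
    moreover have "\<eta> * (z \<bullet> z) \<le> \<epsilon> / 2 * (z \<bullet> z)" "0 \<le> \<epsilon> / 2 * (z \<bullet> z)" for z :: "real^'n"
      using mult_right_mono[OF \<eta>(3) inner_ge_zero[of z]] \<open>0 < \<epsilon>\<close> by auto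
    note this[of v] this[of w] this[of x] this[of y]
    \<comment> \<open>Positional instantiation follows the order of occurrence in the inequality,
      where \<open>y\<close> precedes \<open>x\<close>.\<close>
    ultimately show ?thesis using \<epsilon>[of v w y x] by (simp only: ring_distribs minus_mult_left[symmetric])
  qed
  then show thesis using that[of \<eta>] \<eta> by blast
qed

lemma primitive_cong:
  assumes "primitive a F f" "\<And>t. a \<le> t \<Longrightarrow> F t = G t" "\<And>t. a \<le> t \<Longrightarrow> f t = g t"
  shows "primitive a G g"
  unfolding primitive_def
proof (intro allI impI)
  fix b assume "a \<le> b"
  with assms(1) have "f absolutely_integrable_on {a..b}" "(f has_integral F b - F a) {a..b}"
    by (auto simp: primitive_def)
  moreover have "F b - F a = G b - G a" using assms(2) \<open>a \<le> b\<close> by simp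
  ultimately show "g absolutely_integrable_on {a..b} \<and> (g has_integral G b - G a) {a..b}"
    using assms(3) set_integrable_cong[of lebesgue lebesgue "{a..b}" "{a..b}" f g]
      has_integral_cong[of "{a..b}" f g] by auto
qed

section \<open>Robots and the saturated error\<close>

lemma skew_symmetric_inner:
  fixes S :: "real^'n^'n"
  assumes "skew_symmetric S"
  shows "x \<bullet> (S *v y) = - (y \<bullet> (S *v x))"
proof -
  have "x \<bullet> (S *v y) = (transpose S *v x) \<bullet> y"
    by (simp add: dot_lmul_matrix)
  also have "\<dots> = - (y \<bullet> (S *v x))"
    using assms matrix_vector_mult_diff_rdistrib[of 0 S x]
    by (simp add: skew_symmetric_def inner_commute)
  finally show ?thesis .
qed

lemma norm_matrix_le:
  fixes A :: "real^'n^'m"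
  assumes "\<And>i j. \<bar>A $ i $ j\<bar> \<le> b"
  shows "norm A \<le> real CARD('m) * (real CARD('n) * b)"
proof -
  have "norm (A $ i) \<le> real CARD('n) * b" for i
  proof -
    have "norm (A $ i) \<le> (\<Sum>j\<in>UNIV. \<bar>A $ i $ j\<bar>)" by (rule norm_le_l1_cart)
    also have "\<dots> \<le> real CARD('n) * b" using assms by (intro sum_bounded_above) auto
    finally show ?thesis .
  qed
  then have "(\<Sum>i\<in>UNIV. norm (A $ i)) \<le> real CARD('m) * (real CARD('n) * b)"
    by (intro sum_bounded_above) auto
  moreover have "norm A \<le> (\<Sum>i\<in>UNIV. norm (A $ i))"
    unfolding norm_vec_def by (rule L2_set_le_sum) auto
  ultimately show ?thesis by linarith
qed

lemma bilinear_matrix_vector_mult: "bilinear ((*v) :: real^'n^'m \<Rightarrow> real^'n \<Rightarrow> real^'m)"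
  unfolding bilinear_def
  by (auto intro!: linearI simp: matrix_vector_mult_add_rdistrib matrix_vector_right_distrib
      scaleR_matrix_vector_assoc matrix_vector_mult_scaleR)

lemma bilinear_inner: "bilinear ((\<bullet>) :: 'a::euclidean_space \<Rightarrow> 'a \<Rightarrow> real)"
  using bilinear_conv_bounded_bilinear bounded_bilinear_inner by blast

text \<open>As \<open>M\<close> is symmetric, skew symmetry of \<open>M' - 2 C\<close> says \<open>M' = C + C\<^sup>T\<close>.\<close>

lemma inertia_rate:
  fixes M :: "real^'n \<Rightarrow> real^'n^'n"
  assumes skew: "inertia_coriolis_skew M C" and sym: "\<And>q. transpose (M q) = M q"
    and q: "(q has_vector_derivative v) (at t)"
  obtains D where "((\<lambda>\<tau>. M (q \<tau>)) has_vector_derivative D) (at t)"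
    "\<And>x y. x \<bullet> (D *v y) = y \<bullet> (C (q t) v *v x) + x \<bullet> (C (q t) v *v y)"
proof -
  obtain D where D: "((\<lambda>\<tau>. M (q \<tau>)) has_vector_derivative D) (at t)"
    and S: "skew_symmetric (D - 2 *\<^sub>R C (q t) v)"
    using skew q unfolding inertia_coriolis_skew_def by blast
  have "((\<lambda>\<tau>. transpose (M (q \<tau>))) has_vector_derivative transpose D) (at t)"
  proof (rule bounded_linear.has_vector_derivative[OF _ D])
    show "bounded_linear (transpose :: real^'n^'n \<Rightarrow> _)"
      by (intro linear_conv_bounded_linear[THEN iffD1] linearI)
        (auto simp: transpose_def vec_eq_iff)
  qed
  then have symD: "transpose D = D"
    using D sym vector_derivative_unique_at by fastforce
  have "x \<bullet> (D *v y) = y \<bullet> (C (q t) v *v x) + x \<bullet> (C (q t) v *v y)" for x y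
    using skew_symmetric_inner[OF S, of x y] symmetric_inner_commute[OF symD, of x y]
    by (simp add: matrix_vector_mult_diff_rdistrib inner_diff_right
        flip: scaleR_matrix_vector_assoc)
  with D show thesis using that by blast
qed

text \<open>The product rule with the derivative of the inertia matrix eliminated: one half of it
  completes \<open>M w\<close> to the left side of the equation of motion, the other becomes
  \<open>v \<bullet> C p\<close>. The choice \<open>p = v\<close> gives the kinetic energy,
  \<open>p = saturate e\<close> the cross term.\<close>

lemma robot_momentum_primitive:
  fixes M :: "real^'n \<Rightarrow> real^'n^'n"
  assumes skew: "inertia_coriolis_skew M C" and sym: "\<And>q. transpose (M q) = M q"
    and cor: "coriolis_bounded C"
    and q: "\<And>t. a \<le> t \<Longrightarrow> (q has_vector_derivative v t) (at t)"
    and v: "primitive a v w" and p: "primitive a p p'"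
  shows "primitive a (\<lambda>t. p t \<bullet> (M (q t) *v v t))
    (\<lambda>t. p' t \<bullet> (M (q t) *v v t) + v t \<bullet> (C (q t) (v t) *v p t)
       + p t \<bullet> (M (q t) *v w t + C (q t) (v t) *v v t))"
proof -
  have "\<forall>t. \<exists>D. a \<le> t \<longrightarrow> ((\<lambda>\<tau>. M (q \<tau>)) has_vector_derivative D) (at t) \<and>
      (\<forall>x y. x \<bullet> (D *v y) = y \<bullet> (C (q t) (v t) *v x) + x \<bullet> (C (q t) (v t) *v y))"
    using inertia_rate[OF skew sym q] by metis
  then obtain D where D: "\<And>t. a \<le> t \<Longrightarrow> ((\<lambda>\<tau>. M (q \<tau>)) has_vector_derivative D t) (at t)"
    and DC: "\<And>t x y. a \<le> t \<Longrightarrow>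
        x \<bullet> (D t *v y) = y \<bullet> (C (q t) (v t) *v x) + x \<bullet> (C (q t) (v t) *v y)"
    by metis
  obtain c where c: "0 < c" "\<And>q x y. norm (C q x *v y) \<le> c * norm x * norm y"
    using cor by (auto simp: coriolis_bounded_def)
  have "primitive a (\<lambda>t. M (q t)) D"
  proof (rule primitive_of_derivative[OF D])
    fix b
    have "bounded (v ` {a..b})"
      by (intro compact_imp_bounded compact_continuous_image primitive_continuous_on[OF v]) auto
    then obtain B where B: "\<And>t. t \<in> {a..b} \<Longrightarrow> norm (v t) \<le> B"
      unfolding bounded_iff by blast
    \<comment> \<open>Each entry of \<open>D\<close> is the form at two unit vectors, hence a sum of
      two Coriolis terms, each bounded by \<open>c\<close> times the speed.\<close>
    have "\<bar>D t $ i $ j\<bar> \<le> 2 * (c * B)" if t: "t \<in> {a..b}" for t i j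
    proof -
      have ent: "x \<bullet> (C (q t) (v t) *v y) \<le> c * B" "- (x \<bullet> (C (q t) (v t) *v y)) \<le> c * B"
        if "norm x = 1" "norm y = 1" for x y :: "real^'n"
      proof -
        have "\<bar>x \<bullet> (C (q t) (v t) *v y)\<bar> \<le> norm (C (q t) (v t) *v y)"
          using Cauchy_Schwarz_ineq2[of x] that by simp
        also have "\<dots> \<le> c * norm (v t)" using c(2)[of "q t" "v t" y] that by simp
        also have "\<dots> \<le> c * B" using B[OF t] c by simp
        finally show "x \<bullet> (C (q t) (v t) *v y) \<le> c * B" "- (x \<bullet> (C (q t) (v t) *v y)) \<le> c * B"
          by auto
      qed
      have "D t $ i $ j = axis i 1 \<bullet> (D t *v axis j 1)"
        by (simp add: inner_axis' matrix_vector_mult_basis column_def)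
      then show ?thesis
        using DC[of t "axis i 1" "axis j 1"] ent[of "axis i 1" "axis j 1"]
          ent[of "axis j 1" "axis i 1"] t by (simp add: norm_axis_1 abs_le_iff)
    qed
    then show "\<exists>K. \<forall>t\<in>{a..b}. norm (D t) \<le> K" using norm_matrix_le by blast
  qed
  from primitive_bilinear[OF bilinear_inner p primitive_bilinear[OF bilinear_matrix_vector_mult this v]]
  show ?thesis
    by (rule primitive_cong) (auto simp: DC inner_add_right)
qed

section \<open>The saturated error\<close>

definition saturate :: "real^'n \<Rightarrow> real^'n" where
  "saturate e = (1 / sqrt (1 + e \<bullet> e)) *\<^sub>R e"

text \<open>This is \<open>e \<bullet> saturate e\<close>, the dissipation that the cross term can
  produce: quadratic near 0, of the order of \<open>norm e\<close> far out.\<close>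

definition saturated_square :: "real^'n \<Rightarrow> real" where
  "saturated_square e = (e \<bullet> e) / sqrt (1 + e \<bullet> e)"

lemma sqrt_one_plus_inner: "1 \<le> sqrt (1 + e \<bullet> e)" "norm e \<le> sqrt (1 + e \<bullet> e)"
  by (auto simp: norm_eq_sqrt_inner)

lemma saturated_square_nonneg: "0 \<le> saturated_square e"
  by (simp add: saturated_square_def)

text \<open>The first bound tames the Coriolis term, the second lets the dissipation absorb Young's
  inequality, and the third compares the cross term with the energies.\<close>

lemma saturate_bounds:
  "norm (saturate e) \<le> 1" "saturate e \<bullet> saturate e \<le> saturated_square e"
  "saturate e \<bullet> saturate e \<le> e \<bullet> e"
proof -
  define s where "s = sqrt (1 + e \<bullet> e)"
  have s: "1 \<le> s" "norm e \<le> s" using sqrt_one_plus_inner[of e] by (auto simp: s_def)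
  show "norm (saturate e) \<le> 1" using s by (simp add: saturate_def flip: s_def)
  have eq: "saturate e \<bullet> saturate e = (e \<bullet> e) / s\<^sup>2"
    by (simp add: saturate_def power2_eq_square flip: s_def)
  have "s \<le> s\<^sup>2" using s by (simp add: power2_eq_square mult_le_cancel_left1)
  then show "saturate e \<bullet> saturate e \<le> saturated_square e" "saturate e \<bullet> saturate e \<le> e \<bullet> e"
    unfolding eq using s divide_left_mono[of s "s\<^sup>2" "e \<bullet> e"] divide_left_mono[of 1 "s\<^sup>2" "e \<bullet> e"]
    by (auto simp: saturated_square_def simp flip: s_def)
qed

lemma saturate_derivative:
  assumes e: "(e has_vector_derivative d) (at t)"
  shows "((\<lambda>t. saturate (e t)) has_vector_derivative
     (1 / sqrt (1 + e t \<bullet> e t)) *\<^sub>R d - ((e t \<bullet> d) / sqrt (1 + e t \<bullet> e t) ^ 3) *\<^sub>R e t) (at t)"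
proof -
  have pos: "0 < 1 + e t \<bullet> e t" by (simp add: add_pos_nonneg)
  have "((\<lambda>t. 1 + e t \<bullet> e t) has_real_derivative 2 * (e t \<bullet> d)) (at t)"
    using e unfolding has_vector_derivative_def has_field_derivative_def
    by (auto intro!: derivative_eq_intros simp: inner_commute algebra_simps)
  moreover have "((\<lambda>t. 1 / sqrt (r t)) has_real_derivative - ((r' / 2) / sqrt (r t) ^ 3)) (at t)"
    if "(r has_real_derivative r') (at t)" "0 < r t" for r r'
    using that by (auto intro!: derivative_eq_intros simp: field_simps power3_eq_cube power2_eq_square)
  ultimately have "((\<lambda>t. 1 / sqrt (1 + e t \<bullet> e t)) has_real_derivative
      - ((e t \<bullet> d) / sqrt (1 + e t \<bullet> e t) ^ 3)) (at t)"
    using pos by fastforce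
  from has_vector_derivative_scaleR[OF this e] show ?thesis
    by (simp add: saturate_def algebra_simps)
qed

text \<open>Uniform in \<open>e\<close>: the rate of the saturated error is controlled by the
  velocities alone, however large the error is.\<close>

lemma saturate_derivative_norm:
  "norm ((1 / sqrt (1 + e \<bullet> e)) *\<^sub>R d - ((e \<bullet> d) / sqrt (1 + e \<bullet> e) ^ 3) *\<^sub>R e) \<le> 2 * norm d"
proof -
  define s where "s = sqrt (1 + e \<bullet> e)"
  have s: "1 \<le> s" "norm e \<le> s" using sqrt_one_plus_inner[of e] by (auto simp: s_def)
  have "norm ((1 / s) *\<^sub>R d) \<le> norm d"
    using s by (simp add: divide_le_eq mult_le_cancel_left1)
  moreover have "norm (((e \<bullet> d) / s ^ 3) *\<^sub>R e) \<le> norm d"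
  proof -
    have "\<bar>e \<bullet> d\<bar> * norm e \<le> (norm e * norm d) * norm e"
      by (intro mult_right_mono Cauchy_Schwarz_ineq2) auto
    also have "\<dots> = norm d * (norm e * norm e)" by simp
    also have "\<dots> \<le> norm d * (s * s)"
      using s by (intro mult_left_mono mult_mono) auto
    also have "\<dots> \<le> norm d * s ^ 3"
      using s by (intro mult_left_mono) (auto simp: power3_eq_cube mult_le_cancel_left1)
    finally show ?thesis using s by (simp add: divide_le_eq)
  qed
  ultimately show ?thesis
    using norm_triangle_ineq4[of "(1 / s) *\<^sub>R d" "((e \<bullet> d) / s ^ 3) *\<^sub>R e"]
    by (simp flip: s_def)
qed

section \<open>Krasovskii functionals\<close>

lemma nondecreasing_of_derivative:
  fixes F :: "real \<Rightarrow> real"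
  assumes "\<And>t. a \<le> t \<Longrightarrow> (F has_real_derivative f t) (at t within {a..})"
    and "\<And>t. a \<le> t \<Longrightarrow> 0 \<le> f t" and "a \<le> s" "s \<le> t"
  shows "F s \<le> F t"
proof -
  have "(F has_real_derivative f x) (at x within {s..t})" if "x \<in> {s..t}" for x
    by (rule DERIV_subset[OF assms(1)]) (use assms(3) that in auto)
  then have "(f has_integral F t - F s) {s..t}"
    using assms(4) by (intro fundamental_theorem_of_calculus)
      (simp_all flip: has_real_derivative_iff_has_vector_derivative)
  then have "0 \<le> F t - F s"
    by (rule has_integral_nonneg) (use assms in auto)
  then show ?thesis by simp
qed

lemma antiderivative_on_ray:
  fixes g :: "real \<Rightarrow> real"
  assumes "continuous_on {a..} g"
  obtains G where "\<And>t. a \<le> t \<Longrightarrow> (G has_real_derivative g t) (at t within {a..})"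
proof
  fix t assume t: "a \<le> t"
  have "((\<lambda>u. integral {a..u} g) has_real_derivative g t) (at t within {a..t + 1})"
    by (rule integral_has_real_derivative)
       (use t in \<open>auto intro: continuous_on_subset[OF assms]\<close>)
  moreover have "at t within {a..t + 1} = at t within {a..}"
    by (rule at_within_nhd[of t "{..<t + 1}"]) auto
  ultimately show "((\<lambda>u. integral {a..u} g) has_real_derivative g t) (at t within {a..})" by simp
qed

text \<open>\<open>L t\<close> is the integral of \<open>(\<tau> - t + h) * g \<tau>\<close> over \<open>\<tau> \<in> {t - h..t}\<close>, written with an
  antiderivative of \<open>G\<close> so that it is visibly differentiable.\<close>

lemma krasovskii_functional:
  fixes g :: "real \<Rightarrow> real"
  assumes G: "\<And>t. a \<le> t \<Longrightarrow> (G has_real_derivative g t) (at t within {a..})"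
    and g: "\<And>t. a \<le> t \<Longrightarrow> 0 \<le> g t" and h: "0 < h"
  obtains L where
    "\<And>t. a + h < t \<Longrightarrow> (L has_real_derivative h * g t - (G t - G (t - h))) (at t)"
    "\<And>t. a + h < t \<Longrightarrow> 0 \<le> L t \<and> L t \<le> h * (G t - G (t - h))"
proof -
  have contG: "continuous_on {a..} G"
    using G DERIV_continuous continuous_on_eq_continuous_within by (metis atLeast_iff)
  have mono: "G s \<le> G t" if "a \<le> s" "s \<le> t" for s t
    using nondecreasing_of_derivative[OF G g that] .
  obtain H where H: "\<And>t. a \<le> t \<Longrightarrow> (H has_real_derivative G t) (at t within {a..})"
    using antiderivative_on_ray[OF contG] by blast
  have at: "(F has_real_derivative f t) (at t)"
    if "\<And>t. a \<le> t \<Longrightarrow> (F has_real_derivative f t) (at t within {a..})" "a < t" for F f t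
    using that(1)[of t] that(2) at_within_interior[of t "{a..}"]
    by (simp add: interior_real_atLeast)
  define L where "L = (\<lambda>t. h * G t - (H t - H (t - h)))"
  show thesis
  proof
    fix t assume t: "a + h < t"
    have "((\<lambda>t. H (t - h)) has_real_derivative G (t - h) * 1) (at t)"
      using t by (intro DERIV_chain2[where f = H] at[OF H] derivative_eq_intros refl) auto
    then show "(L has_real_derivative h * g t - (G t - G (t - h))) (at t)"
      unfolding L_def using at[OF H, of t] at[OF G, of t] t h
      by (auto intro!: derivative_eq_intros)
    \<comment> \<open>By the mean value theorem \<open>L t\<close> equals
      \<open>h * (G t - G z)\<close> for some \<open>z\<close> in the window; monotonicity of
      \<open>G\<close> gives both bounds.\<close>
    obtain z where z: "t - h < z" "z < t" "H t - H (t - h) = h * G z"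
      using MVT2[of "t - h" t H G] at[OF H] t h by auto
    have "G (t - h) \<le> G z" "G z \<le> G t" using z t h by (auto intro: mono)
    then show "0 \<le> L t \<and> L t \<le> h * (G t - G (t - h))"
      unfolding L_def z(3) using h by (auto simp: algebra_simps)
  qed
qed

text \<open>Stated through the antiderivative \<open>G\<close>, so that the bound is exactly the
  loss term in the derivative of the Krasovskii functional. The delay enters at a single time and
  may jump.\<close>

lemma jensen_quadratic:
  fixes R :: "real^'n^'n"
  assumes R: "pos_def R"
    and q: "\<And>t. a \<le> t \<Longrightarrow> (q has_vector_derivative v t) (at t within {a..})"
    and G: "\<And>t. a \<le> t \<Longrightarrow> (G has_real_derivative v t \<bullet> (R *v v t)) (at t within {a..})"
    and d: "0 \<le> d" "d \<le> h" "a \<le> t - h"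
  shows "(q t - q (t - d)) \<bullet> (R *v (q t - q (t - d))) \<le> h * (G t - G (t - h))"
proof -
  have sym: "x \<bullet> (R *v y) = y \<bullet> (R *v x)" for x y
    using R symmetric_inner_commute pos_def_def by blast
  have nn: "0 \<le> x \<bullet> (R *v x)" for x
    using R unfolding pos_def_def by (cases "x = 0") (auto intro: less_imp_le)
  define x where "x = q t - q (t - d)"
  \<comment> \<open>Integrate \<open>0 \<le> (v - w) \<bullet> R (v - w)\<close>; the mean velocity \<open>w\<close> gives the claim.\<close>
  have psi: "2 * ((R *v w) \<bullet> (q r - q s)) - (r - s) * (w \<bullet> (R *v w)) \<le> G r - G s"
    if "a \<le> s" "s \<le> r" for s r w
  proof -
    define \<psi> where "\<psi> = (\<lambda>\<tau>. G \<tau> - 2 * ((R *v w) \<bullet> q \<tau>) + \<tau> * (w \<bullet> (R *v w)))"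
    have "\<psi> s \<le> \<psi> r"
    proof (rule nondecreasing_of_derivative[OF _ _ that])
      fix \<tau> assume \<tau>: "a \<le> \<tau>"
      have "(\<psi> has_vector_derivative v \<tau> \<bullet> (R *v v \<tau>) - 2 * ((R *v w) \<bullet> v \<tau>) + w \<bullet> (R *v w))
          (at \<tau> within {a..})"
        unfolding \<psi>_def
        using q[of \<tau>] G[of \<tau>] \<tau> unfolding has_vector_derivative_def has_field_derivative_def
        by (auto intro!: derivative_eq_intros simp: algebra_simps)
      moreover have "v \<tau> \<bullet> (R *v v \<tau>) - 2 * ((R *v w) \<bullet> v \<tau>) + w \<bullet> (R *v w)
          = (v \<tau> - w) \<bullet> (R *v (v \<tau> - w))"
        using sym[of w "v \<tau>"]
        by (simp add: matrix_vector_mult_diff_distrib inner_commute algebra_simps)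
      ultimately show "(\<psi> has_real_derivative (v \<tau> - w) \<bullet> (R *v (v \<tau> - w))) (at \<tau> within {a..})"
        by (simp add: has_real_derivative_iff_has_vector_derivative)
    qed (rule nn)
    then show ?thesis by (simp add: \<psi>_def algebra_simps)
  qed
  have "x \<bullet> (R *v x) \<le> d * (G t - G (t - d))"
  proof (cases "d = 0")
    case False
    have "2 * ((R *v ((1 / d) *\<^sub>R x)) \<bullet> x) - d * (((1 / d) *\<^sub>R x) \<bullet> (R *v ((1 / d) *\<^sub>R x))) \<le> G t - G (t - d)"
      using psi[of "t - d" t "(1 / d) *\<^sub>R x"] d by (simp add: x_def)
    then have "(x \<bullet> (R *v x)) / d \<le> G t - G (t - d)"
      using False by (simp add: matrix_vector_mult_scaleR inner_commute)
    then show ?thesis using d False by (simp add: field_simps)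
  qed (simp add: x_def)
  \<comment> \<open>For \<open>w = 0\<close> the estimate \<open>psi\<close> says that
    \<open>G\<close> is nondecreasing; this enlarges first the factor and then the window from
    \<open>d\<close> to \<open>h\<close>.\<close>
  also have "\<dots> \<le> h * (G t - G (t - d))"
    using d psi[of "t - d" t 0] by (intro mult_right_mono) auto
  also have "\<dots> \<le> h * (G t - G (t - h))"
    using d psi[of "t - h" "t - d" 0] by (intro mult_left_mono diff_left_mono) auto
  finally show ?thesis by (simp add: x_def)
qed

text \<open>The last bracket is the inertia plus Coriolis force of a slave with the feedback law
  inserted. Its part \<open>Kp *v e\<close> yields \<open>\<kappa> * saturated_square e\<close>;
  everything else costs squares of velocities and displacements, which the matrix inequality
  dominates once the cross term has a small weight.\<close>

lemma cross_term_rate: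
  fixes Kp Kd :: "real^'n^'n"
  assumes \<kappa>: "0 < \<kappa>" "\<And>x. \<kappa> * (x \<bullet> x) \<le> x \<bullet> (Kp *v x)" and u: "0 < u" and c: "0 < c"
  obtains K where "0 < K"
    "\<And>e f v w x p' M C.
       transpose M = M \<Longrightarrow> (\<And>x. 0 \<le> x \<bullet> (M *v x) \<and> x \<bullet> (M *v x) \<le> u * (x \<bullet> x)) \<Longrightarrow>
       (\<And>y. norm (C *v y) \<le> c * norm w * norm y) \<Longrightarrow> norm p' \<le> 2 * norm (v - w) \<Longrightarrow>
       - (p' \<bullet> (M *v w) + w \<bullet> (C *v saturate e)
          + saturate e \<bullet> (f - Kd *v w + Kp *v e - Kp *v x))
       \<le> - (\<kappa> / 4) * saturated_square e + K * (v \<bullet> v + w \<bullet> w + x \<bullet> x) + (f \<bullet> f) / \<kappa>"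
proof -
  obtain b b' where b: "0 < b" "\<And>x. norm (Kp *v x) \<le> b * norm x"
    and b': "0 < b'" "\<And>x. norm (Kd *v x) \<le> b' * norm x"
    using matrix_norm_bound by metis
  \<comment> \<open>\<open>5 * u\<close> covers the inertia term, whose coefficients are
    \<open>4 * u\<close> and \<open>9 / 2 * u\<close>; \<open>c\<close> covers the Coriolis term;
    the quotients come from Young's inequality with weight \<open>\<kappa> / 4\<close>.\<close>
  define K where "K = 5 * u + c + b\<^sup>2 / \<kappa> + b'\<^sup>2 / \<kappa>"
  have "- (p' \<bullet> (M *v w) + w \<bullet> (C *v saturate e)
          + saturate e \<bullet> (f - Kd *v w + Kp *v e - Kp *v x))
       \<le> - (\<kappa> / 4) * saturated_square e + K * (v \<bullet> v + w \<bullet> w + x \<bullet> x) + (f \<bullet> f) / \<kappa>"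
    if M: "transpose M = M" "\<And>x. 0 \<le> x \<bullet> (M *v x) \<and> x \<bullet> (M *v x) \<le> u * (x \<bullet> x)"
      and C: "\<And>y. norm (C *v y) \<le> c * norm w * norm y" and p': "norm p' \<le> 2 * norm (v - w)"
    for e f v w x p' :: "real^'n" and M C :: "real^'n^'n"
  proof -
    define p where "p = saturate e"
    define z where "z = saturated_square e"
    have p: "norm p \<le> 1" "p \<bullet> p \<le> z" using saturate_bounds[of e] by (auto simp: p_def z_def)
    have "p' \<bullet> p' \<le> (2 * norm (v - w))\<^sup>2"
      using power_mono[OF p' norm_ge_zero, of 2] by (simp add: power2_norm_eq_inner)
    also have "\<dots> = 4 * ((v - w) \<bullet> (v - w))" by (simp add: power_mult_distrib power2_norm_eq_inner)
    also have "\<dots> \<le> 8 * (v \<bullet> v + w \<bullet> w)"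
      using inner_ge_zero[of "v + w"] by (simp add: inner_diff_left inner_diff_right
          inner_add_left inner_add_right inner_commute)
    finally have "u / 2 * (p' \<bullet> p' + w \<bullet> w) \<le> u / 2 * (8 * (v \<bullet> v + w \<bullet> w) + w \<bullet> w)"
      using u by (intro mult_left_mono) auto
    then have 1: "- (p' \<bullet> (M *v w)) \<le> u / 2 * (8 * (v \<bullet> v + w \<bullet> w) + w \<bullet> w)"
      using quadratic_form_inner_le[OF M, of p' w] by linarith
    have "- (w \<bullet> (C *v p)) \<le> norm w * norm (C *v p)"
      using Cauchy_Schwarz_ineq2[of w "C *v p"] by linarith
    also have "\<dots> \<le> norm w * (c * norm w * 1)"
      using C[of p] p c by (intro mult_left_mono order_trans[OF C] mult_left_mono) auto
    also have "\<dots> = c * (w \<bullet> w)" by (simp add: power2_eq_square flip: power2_norm_eq_inner)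
    finally have 2: "- (w \<bullet> (C *v p)) \<le> c * (w \<bullet> w)" .
    \<comment> \<open>Three products at a price of \<open>\<kappa> / 4\<close> each leave a quarter
      of the dissipation.\<close>
    have 3: "p \<bullet> (- f) \<le> \<kappa> / 4 * (p \<bullet> p) + 1\<^sup>2 / (4 * (\<kappa> / 4)) * (f \<bullet> f)"
      "p \<bullet> (Kd *v w) \<le> \<kappa> / 4 * (p \<bullet> p) + b'\<^sup>2 / (4 * (\<kappa> / 4)) * (w \<bullet> w)"
      "p \<bullet> (Kp *v x) \<le> \<kappa> / 4 * (p \<bullet> p) + b\<^sup>2 / (4 * (\<kappa> / 4)) * (x \<bullet> x)"
      using \<kappa> b b' by (rule_tac inner_le_weighted_squares; simp)+
    have 4: "\<kappa> * z \<le> p \<bullet> (Kp *v e)"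
    proof -
      have "\<kappa> * (e \<bullet> e) / sqrt (1 + e \<bullet> e) \<le> (e \<bullet> (Kp *v e)) / sqrt (1 + e \<bullet> e)"
        by (intro divide_right_mono \<kappa>(2)) simp
      then show ?thesis by (simp add: p_def z_def saturate_def saturated_square_def)
    qed
    have 5: "\<kappa> / 4 * (p \<bullet> p) \<le> \<kappa> / 4 * z" using \<kappa> p by simp
    have "u / 2 * (8 * (v \<bullet> v + w \<bullet> w) + w \<bullet> w) + c * (w \<bullet> w) + b'\<^sup>2 / \<kappa> * (w \<bullet> w) + b\<^sup>2 / \<kappa> * (x \<bullet> x)
        \<le> K * (v \<bullet> v + w \<bullet> w + x \<bullet> x)"
    proof -
      have "0 \<le> y * (v \<bullet> v)" "0 \<le> y * (w \<bullet> w)" "0 \<le> y * (x \<bullet> x)" if "0 \<le> y" for y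
        using that by auto
      from this[of u] this[of c] this[of "b\<^sup>2 / \<kappa>"] this[of "b'\<^sup>2 / \<kappa>"]
      show ?thesis using u c \<kappa> unfolding K_def ring_distribs by simp
    qed
    moreover have "1\<^sup>2 / (4 * (\<kappa> / 4)) * (f \<bullet> f) = (f \<bullet> f) / \<kappa>"
      "b'\<^sup>2 / (4 * (\<kappa> / 4)) * (w \<bullet> w) = b'\<^sup>2 / \<kappa> * (w \<bullet> w)"
      "b\<^sup>2 / (4 * (\<kappa> / 4)) * (x \<bullet> x) = b\<^sup>2 / \<kappa> * (x \<bullet> x)"
      by simp_all
    moreover have "p \<bullet> (f - Kd *v w + Kp *v e - Kp *v x)
        = - (p \<bullet> (- f)) - p \<bullet> (Kd *v w) + p \<bullet> (Kp *v e) - p \<bullet> (Kp *v x)"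
      by (simp add: inner_add_right inner_diff_right)
    ultimately show ?thesis
      using 1 2 3 4 5 unfolding p_def[symmetric] z_def[symmetric] by linarith
  qed
  moreover have "0 < K" using u c \<kappa> b b' by (simp add: K_def add_pos_nonneg)
  ultimately show thesis using that by blast
qed

section \<open>Storage functions\<close>

text \<open>One slave together with its copy of the master's delay functional. The power
  \<open>2 * (vm t \<bullet> ...)\<close> is left open: it is the coupling that the equation of the
  master returns with the opposite sign, so it is not estimated here. Force and delays are bound at
  the single time \<open>t\<close>, hence no regularity in time is asked of them.\<close>

lemma slave_storage:
  fixes Kp Kd Rm R :: "real^'n^'n" and M :: "real^'n \<Rightarrow> real^'n^'n" and \<gamma> :: "real^'n"
  assumes lmi: "neg_def (lmi_matrix hM hS Kp Kd Rm R)"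
    and Kp: "pos_def Kp" and Rm: "pos_def Rm" and R: "pos_def R"
    and h: "0 < hM" "hM \<le> hS" and t0: "0 < t0"
    and robot: "robot M C"
    and qm: "\<And>t. - hS \<le> t \<Longrightarrow> (qm has_vector_derivative vm t) (at t within {- hS..})"
    and vm: "continuous_on {- hS..} vm"
    and q: "\<And>t. - hS \<le> t \<Longrightarrow> (q has_vector_derivative v t) (at t within {- hS..})"
    and v: "continuous_on {- hS..} v"
    and w: "primitive t0 v w"
  defines "e \<equiv> \<lambda>t. qm t - (q t - \<gamma>)"
  obtains S S' J k where "0 < k" "primitive t0 S S'"
    "\<And>t. t0 \<le> t \<Longrightarrow> 0 \<le> J t"
    "\<And>t. t0 \<le> t \<Longrightarrow> k * (v t \<bullet> v t + e t \<bullet> e t) \<le> S t"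
    "\<And>t. t0 \<le> t \<Longrightarrow> S t \<le> (v t \<bullet> v t + e t \<bullet> e t + J t) / k"
    "\<And>t f d d'. t0 \<le> t \<Longrightarrow> 0 \<le> d \<Longrightarrow> d \<le> hM \<Longrightarrow> 0 \<le> d' \<Longrightarrow> d' \<le> hS \<Longrightarrow>
       f = M (q t) *v w t + C (q t) (v t) *v v t + Kd *v v t + Kp *v ((q t - \<gamma>) - qm (t - d)) \<Longrightarrow>
       S' t \<le> 2 * (vm t \<bullet> (Kp *v (e t + (q t - q (t - d'))) + Kd *v vm t))
         - k * (vm t \<bullet> vm t + v t \<bullet> v t + saturated_square (e t) + J t) + (f \<bullet> f) / k"
proof -
  have symKp: "transpose Kp = Kp" using Kp by (simp add: pos_def_def)
  obtain l u where lu: "0 < l" "0 < u" and M: "\<And>q. pos_def (M q)"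
      "\<And>q x. l * (x \<bullet> x) \<le> x \<bullet> (M q *v x)" "\<And>q x. x \<bullet> (M q *v x) \<le> u * (x \<bullet> x)"
    using robot unfolding robot_def inertia_bounded_def by blast
  have symM: "transpose (M q) = M q" for q using M(1) by (simp add: pos_def_def)
  have nnM: "0 \<le> x \<bullet> (M q *v x) \<and> x \<bullet> (M q *v x) \<le> u * (x \<bullet> x)" for q x
    using M(2)[of x q] M(3)[of x q] lu(1) by (meson inner_ge_zero less_imp_le mult_nonneg_nonneg order_trans)
  obtain c where c: "0 < c" "\<And>q x y. norm (C q x *v y) \<le> c * norm x * norm y"
    using robot by (auto simp: robot_def coriolis_bounded_def)
  have skew: "inertia_coriolis_skew M C" and cor: "coriolis_bounded C"
    using robot by (auto simp: robot_def)
  obtain \<kappa> where \<kappa>: "0 < \<kappa>" "\<And>x. \<kappa> * (x \<bullet> x) \<le> x \<bullet> (Kp *v x)"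
    using pos_def_coercive[OF Kp] by blast
  obtain b where b: "0 < b" "\<And>x. norm (Kp *v x) \<le> b * norm x"
    using matrix_norm_bound by blast
  obtain \<epsilon> where "0 < \<epsilon>" and \<epsilon>: "\<And>v w x y I J. x \<bullet> (Rm *v x) \<le> hM * I \<Longrightarrow> y \<bullet> (R *v y) \<le> hS * J \<Longrightarrow>
      0 \<le> I \<Longrightarrow> 0 \<le> J \<Longrightarrow>
      - 2 * (v \<bullet> (Kd *v v)) + hM * (v \<bullet> (Rm *v v)) - 2 * (w \<bullet> (Kd *v w)) + hS * (w \<bullet> (R *v w))
       - 2 * (v \<bullet> (Kp *v y)) - 2 * (w \<bullet> (Kp *v x)) - I - J
     \<le> - \<epsilon> * (v \<bullet> v + w \<bullet> w + x \<bullet> x + y \<bullet> y + I + J)"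
    using krasovskii_dissipation[OF lmi symKp h(1) less_le_trans[OF h]] by blast
  obtain K where "0 < K" and K: "\<And>e f v w x p' M C.
       transpose M = M \<Longrightarrow> (\<And>x. 0 \<le> x \<bullet> (M *v x) \<and> x \<bullet> (M *v x) \<le> u * (x \<bullet> x)) \<Longrightarrow>
       (\<And>y. norm (C *v y) \<le> c * norm w * norm y) \<Longrightarrow> norm p' \<le> 2 * norm (v - w) \<Longrightarrow>
       - (p' \<bullet> (M *v w) + w \<bullet> (C *v saturate e)
          + saturate e \<bullet> (f - Kd *v w + Kp *v e - Kp *v x))
       \<le> - (\<kappa> / 4) * saturated_square e + K * (v \<bullet> v + w \<bullet> w + x \<bullet> x) + (f \<bullet> f) / \<kappa>"
    using cross_term_rate[OF \<kappa> lu(2) c(1)] by blast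
  \<comment> \<open>The weight of the cross term. The first entry limits its cost to a quarter of
    the margin; the other two keep it below half of the kinetic and spring energies, so that
    \<open>S\<close> stays positive definite in velocity and error.\<close>
  define \<mu> where "\<mu> = min (\<epsilon> / (4 * K)) (min (l / u) (\<kappa> / u))"
  have "0 < \<mu>" and \<mu>: "\<mu> * K \<le> \<epsilon> / 4" "\<mu> * u \<le> l" "\<mu> * u \<le> \<kappa>"
  proof -
    show "0 < \<mu>" using \<open>0 < \<epsilon>\<close> \<open>0 < K\<close> lu \<kappa> by (simp add: \<mu>_def)
    have "\<mu> \<le> \<epsilon> / (4 * K)" "\<mu> \<le> l / u" "\<mu> \<le> \<kappa> / u" by (auto simp: \<mu>_def)
    then show "\<mu> * K \<le> \<epsilon> / 4" "\<mu> * u \<le> l" "\<mu> * u \<le> \<kappa>"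
      using \<open>0 < K\<close> lu by (auto simp: field_simps)
  qed
  have quad_cont: "continuous_on {- hS..} (\<lambda>t. x t \<bullet> (A *v x t))"
    if "continuous_on {- hS..} x" for x and A :: "real^'n^'n"
    by (intro continuous_intros continuous_on_compose2[OF matrix_vector_mult_linear_continuous_on that]
        that) auto
  have nn: "0 \<le> x \<bullet> (A *v x)" if "pos_def A" for x and A :: "real^'n^'n"
    using that unfolding pos_def_def by (cases "x = 0") (auto intro: less_imp_le)
  obtain Gm where Gm: "\<And>t. - hS \<le> t \<Longrightarrow>
      (Gm has_real_derivative vm t \<bullet> (Rm *v vm t)) (at t within {- hS..})"
    using antiderivative_on_ray[OF quad_cont[OF vm]] by metis
  obtain G where G: "\<And>t. - hS \<le> t \<Longrightarrow>
      (G has_real_derivative v t \<bullet> (R *v v t)) (at t within {- hS..})"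
    using antiderivative_on_ray[OF quad_cont[OF v]] by metis
  define I where "I = (\<lambda>t. Gm t - Gm (t - hM))"
  define J where "J = (\<lambda>t. G t - G (t - hS))"
  obtain Lm where Lm: "\<And>t. - hS + hM < t \<Longrightarrow>
        (Lm has_real_derivative hM * (vm t \<bullet> (Rm *v vm t)) - I t) (at t)"
      "\<And>t. - hS + hM < t \<Longrightarrow> 0 \<le> Lm t \<and> Lm t \<le> hM * I t"
    using krasovskii_functional[OF Gm nn[OF Rm] h(1)] unfolding I_def by metis
  \<comment> \<open>At time 0 a window of length \<open>hS\<close> reaches the start of the recorded
    past; \<open>L\<close> is available for \<open>0 < t\<close>, in particular from
    \<open>t0\<close> on.\<close>
  obtain L where L: "\<And>t. - hS + hS < t \<Longrightarrow>
        (L has_real_derivative hS * (v t \<bullet> (R *v v t)) - J t) (at t)"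
      "\<And>t. - hS + hS < t \<Longrightarrow> 0 \<le> L t \<and> L t \<le> hS * J t"
    using krasovskii_functional[OF G nn[OF R], of hS] h unfolding J_def by (metis less_le_trans)
  have Jm: "(qm t - qm (t - d)) \<bullet> (Rm *v (qm t - qm (t - d))) \<le> hM * I t"
    if "t0 \<le> t" "0 \<le> d" "d \<le> hM" for t d
    unfolding I_def by (rule jensen_quadratic[OF Rm qm Gm that(2,3)]) (use that t0 h in auto)
  have Js: "(q t - q (t - d)) \<bullet> (R *v (q t - q (t - d))) \<le> hS * J t"
    if "t0 \<le> t" "0 \<le> d" "d \<le> hS" for t d
    unfolding J_def by (rule jensen_quadratic[OF R q G that(2,3)]) (use that t0 h in auto)
  \<comment> \<open>Jensen's bound with zero delay.\<close>
  have I0: "0 \<le> I t" and J0: "0 \<le> J t" if "t0 \<le> t" for t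
    using Jm[of t 0] Js[of t 0] that h by (auto simp: zero_le_mult_iff)
  have at: "(F has_vector_derivative F') (at t)"
    if "(F has_vector_derivative F') (at t within {- hS..})" "t0 \<le> t"
    for F :: "real \<Rightarrow> real^'n" and F' t
    using that t0 h at_within_interior[of t "{- hS..}"] by (simp add: interior_real_atLeast)
  have q': "(q has_vector_derivative v t) (at t)" and qm': "(qm has_vector_derivative vm t) (at t)"
    if "t0 \<le> t" for t
    using at[OF q that] at[OF qm that] that t0 h by auto
  have e': "(e has_vector_derivative vm t - v t) (at t)" if "t0 \<le> t" for t
    unfolding e_def by (rule derivative_eq_intros q'[OF that] qm'[OF that] refl)+ simp
  have sub: "{t0..} \<subseteq> {- hS..}" using t0 h by auto
  have cv: "continuous_on {t0..} v" and cvm: "continuous_on {t0..} vm"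
    using continuous_on_subset[OF v sub] continuous_on_subset[OF vm sub] .
  have ce: "continuous_on {t0..} e"
    by (intro continuous_at_imp_continuous_on ballI has_vector_derivative_continuous[OF e']) auto
  have cA: "continuous_on {t0..} (\<lambda>t. A *v x t)" if "continuous_on {t0..} x"
    for x and A :: "real^'n^'n"
    by (rule continuous_on_compose2[OF matrix_vector_mult_linear_continuous_on that]) auto
  define p' where "p' = (\<lambda>t. (1 / sqrt (1 + e t \<bullet> e t)) *\<^sub>R (vm t - v t)
      - ((e t \<bullet> (vm t - v t)) / sqrt (1 + e t \<bullet> e t) ^ 3) *\<^sub>R e t)"
  have P1: "primitive t0 (\<lambda>t. v t \<bullet> (M (q t) *v v t))
    (\<lambda>t. w t \<bullet> (M (q t) *v v t) + v t \<bullet> (C (q t) (v t) *v v t)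
       + v t \<bullet> (M (q t) *v w t + C (q t) (v t) *v v t))"
    by (rule robot_momentum_primitive[OF skew symM cor q' w w])
  have P0: "primitive t0 (\<lambda>t. saturate (e t)) p'"
  proof (rule primitive_of_continuous_derivative)
    show "((\<lambda>t. saturate (e t)) has_vector_derivative p' t) (at t)" if "t0 \<le> t" for t
      unfolding p'_def by (rule saturate_derivative[OF e'[OF that]])
    have "1 + e t \<bullet> e t \<noteq> 0" for t
      by (metis add_pos_nonneg inner_ge_zero less_irrefl zero_less_one)
    then show "continuous_on {t0..} p'"
      unfolding p'_def by (intro continuous_intros ce cv cvm) auto
  qed
  have P5: "primitive t0 (\<lambda>t. saturate (e t) \<bullet> (M (q t) *v v t))
    (\<lambda>t. p' t \<bullet> (M (q t) *v v t) + v t \<bullet> (C (q t) (v t) *v saturate (e t))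
       + saturate (e t) \<bullet> (M (q t) *v w t + C (q t) (v t) *v v t))"
    by (rule robot_momentum_primitive[OF skew symM cor q' w P0])
  have P2: "primitive t0 (\<lambda>t. e t \<bullet> (Kp *v e t)) (\<lambda>t. 2 * (e t \<bullet> (Kp *v (vm t - v t))))"
  proof (rule primitive_of_continuous_derivative)
    fix t assume "t0 \<le> t"
    have "((\<lambda>t. Kp *v e t) has_vector_derivative Kp *v (vm t - v t)) (at t)"
      by (rule bounded_linear.has_vector_derivative[OF matrix_vector_mul_bounded_linear e'[OF \<open>t0 \<le> t\<close>]])
    from bounded_bilinear.has_vector_derivative[OF bounded_bilinear_inner e'[OF \<open>t0 \<le> t\<close>] this]
    show "((\<lambda>t. e t \<bullet> (Kp *v e t)) has_vector_derivative 2 * (e t \<bullet> (Kp *v (vm t - v t)))) (at t)"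
      using symmetric_inner_commute[OF symKp, of "vm t - v t" "e t"] by simp
  qed (intro continuous_intros ce cv cvm cA)
  have cG: "continuous_on {- hS..} Gm" "continuous_on {- hS..} G"
    using Gm G DERIV_continuous continuous_on_eq_continuous_within by (metis atLeast_iff)+
  have cI: "continuous_on {t0..} I" "continuous_on {t0..} J"
    unfolding I_def J_def using t0 h
    by (auto intro!: continuous_intros continuous_on_compose2[OF cG(1)] continuous_on_compose2[OF cG(2)])
  have P3: "primitive t0 Lm (\<lambda>t. hM * (vm t \<bullet> (Rm *v vm t)) - I t)"
    by (rule primitive_of_continuous_derivative)
       (use Lm(1) t0 h in \<open>auto simp flip: has_real_derivative_iff_has_vector_derivative
          intro!: continuous_intros cvm cA cI\<close>)
  have P4: "primitive t0 L (\<lambda>t. hS * (v t \<bullet> (R *v v t)) - J t)"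
    by (rule primitive_of_continuous_derivative)
       (use L(1) t0 h in \<open>auto simp flip: has_real_derivative_iff_has_vector_derivative
          intro!: continuous_intros cv cA cI\<close>)
  \<comment> \<open>Energies are taken twice, in accordance with the factor 2 in front of
    \<open>Kd\<close> in the matrix inequality.\<close>
  define S where "S = (\<lambda>t. v t \<bullet> (M (q t) *v v t) + e t \<bullet> (Kp *v e t) + Lm t + L t
      + - \<mu> * (saturate (e t) \<bullet> (M (q t) *v v t)))"
  define S' where "S' = (\<lambda>t. w t \<bullet> (M (q t) *v v t) + v t \<bullet> (C (q t) (v t) *v v t)
       + v t \<bullet> (M (q t) *v w t + C (q t) (v t) *v v t)
       + 2 * (e t \<bullet> (Kp *v (vm t - v t)))
       + (hM * (vm t \<bullet> (Rm *v vm t)) - I t) + (hS * (v t \<bullet> (R *v v t)) - J t)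
       + - \<mu> * (p' t \<bullet> (M (q t) *v v t) + v t \<bullet> (C (q t) (v t) *v saturate (e t))
       + saturate (e t) \<bullet> (M (q t) *v w t + C (q t) (v t) *v v t)))"
  have P: "primitive t0 S S'"
    unfolding S_def S'_def by (intro primitive_add primitive_cmult P1 P2 P3 P4 P5)
  \<comment> \<open>Collects what \<open>1 / k\<close> has to dominate: the coefficient of
    \<open>f \<bullet> f\<close> in the rate, and the coefficient in the upper bound of
    \<open>S\<close>.\<close>
  define kk where "kk = 2 / \<epsilon> + \<mu> / \<kappa> + (u + b + hS + \<mu> * u)"
  define k where "k = min (min (\<epsilon> / 4) (\<mu> * \<kappa> / 4)) (min (min (l / 2) (\<kappa> / 2)) (1 / kk))"
  have parts: "0 < 2 / \<epsilon> + \<mu> / \<kappa>" "0 < u + b + hS + \<mu> * u"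
    using \<open>0 < \<epsilon>\<close> \<open>0 < \<mu>\<close> \<kappa> lu b h by (auto intro!: add_pos_pos)
  then have kk: "0 < kk" "2 / \<epsilon> + \<mu> / \<kappa> \<le> kk" "u + b + hS + \<mu> * u \<le> kk" by (auto simp: kk_def)
  have k0: "0 < k" and k: "k \<le> \<epsilon> / 4" "k \<le> \<mu> * \<kappa> / 4" "k \<le> l / 2" "k \<le> \<kappa> / 2"
    using \<open>0 < \<epsilon>\<close> \<open>0 < \<mu>\<close> \<kappa> lu kk(1) by (auto simp: k_def)
  have "k \<le> 1 / kk" by (simp add: k_def)
  then have kk1: "kk \<le> 1 / k" using k0 kk(1) by (simp add: field_simps)
  have cross: "\<bar>saturate (e t) \<bullet> (M (q t) *v v t)\<bar> \<le> u / 2 * (e t \<bullet> e t + v t \<bullet> v t)" for t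
  proof -
    have "\<bar>saturate (e t) \<bullet> (M (q t) *v v t)\<bar> \<le> u / 2 * (saturate (e t) \<bullet> saturate (e t) + v t \<bullet> v t)"
      by (rule quadratic_form_inner_le[OF symM nnM])
    also have "\<dots> \<le> u / 2 * (e t \<bullet> e t + v t \<bullet> v t)"
      using lu saturate_bounds(3)[of "e t"] by (intro mult_left_mono add_right_mono) auto
    finally show ?thesis .
  qed
  have mcross: "\<bar>\<mu> * (saturate (e t) \<bullet> (M (q t) *v v t))\<bar> \<le> \<mu> * u / 2 * (e t \<bullet> e t + v t \<bullet> v t)" for t
    using mult_left_mono[OF cross[of t], of \<mu>] \<open>0 < \<mu>\<close> by (simp add: abs_mult)
  show thesis
  proof
    show "0 < k" "primitive t0 S S'" by fact+
    fix t assume t: "t0 \<le> t"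
    \<comment> \<open>The witness for the \<open>J\<close> of the statement is the sum of both
      window integrals.\<close>
    show "0 \<le> I t + J t" using I0[OF t] J0[OF t] by simp
    have LL: "0 \<le> Lm t" "0 \<le> L t" "Lm t \<le> hM * I t" "L t \<le> hS * J t"
      using Lm(2)[of t] L(2)[of t] t t0 h by auto
    have ve: "\<mu> * u / 2 * (v t \<bullet> v t) \<le> l / 2 * (v t \<bullet> v t)" "\<mu> * u / 2 * (e t \<bullet> e t) \<le> \<kappa> / 2 * (e t \<bullet> e t)"
      "k * (v t \<bullet> v t) \<le> l / 2 * (v t \<bullet> v t)" "k * (e t \<bullet> e t) \<le> \<kappa> / 2 * (e t \<bullet> e t)"
      using mult_right_mono[OF \<mu>(2) inner_ge_zero[of "v t"]] mult_right_mono[OF \<mu>(3) inner_ge_zero[of "e t"]]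
        mult_right_mono[OF k(3) inner_ge_zero[of "v t"]] mult_right_mono[OF k(4) inner_ge_zero[of "e t"]]
      by simp_all
    show "k * (v t \<bullet> v t + e t \<bullet> e t) \<le> S t"
      using mcross[of t] ve LL M(2)[of "v t" "q t"] \<kappa>(2)[of "e t"]
      unfolding S_def ring_distribs by (simp add: abs_le_iff) 
    have be: "e t \<bullet> (Kp *v e t) \<le> b * (e t \<bullet> e t)"
      using norm_cauchy_schwarz[of "e t" "Kp *v e t"] mult_left_mono[OF b(2)[of "e t"] norm_ge_zero[of "e t"]]
      by (simp add: power2_eq_square algebra_simps flip: power2_norm_eq_inner)
    have hI: "hM * I t \<le> hS * I t" using h I0[OF t] by (intro mult_right_mono) auto
    have nz: "0 \<le> \<mu> * u" "0 \<le> hS" using \<open>0 < \<mu>\<close> lu h by auto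
    have "S t \<le> (u + b + hS + \<mu> * u) * (v t \<bullet> v t + e t \<bullet> e t + (I t + J t))"
    proof -
      define m where "m = \<mu> * u"
      have "0 \<le> y * (v t \<bullet> v t)" "0 \<le> y * (e t \<bullet> e t)" "0 \<le> y * I t" "0 \<le> y * J t" if "0 \<le> y" for y
        using that I0[OF t] J0[OF t] by auto
      note this[OF less_imp_le[OF lu(2)]] this[OF less_imp_le[OF b(1)]] this[OF nz(2)] this[OF nz(1)]
      moreover have "- \<mu> * (saturate (e t) \<bullet> (M (q t) *v v t)) \<le> \<mu> * u / 2 * (e t \<bullet> e t + v t \<bullet> v t)"
        using mcross[of t] by linarith
      ultimately show ?thesis
        using LL M(3)[of "v t" "q t"] be hI
        unfolding S_def m_def[symmetric] ring_distribs by linarith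
    qed
    also have "\<dots> \<le> (1 / k) * (v t \<bullet> v t + e t \<bullet> e t + (I t + J t))"
      using kk(3) kk1 I0[OF t] J0[OF t] by (intro mult_right_mono) auto
    finally show "S t \<le> (v t \<bullet> v t + e t \<bullet> e t + (I t + J t)) / k" by simp
  next
    fix t f d d' assume t: "t0 \<le> t" and d: "0 \<le> d" "d \<le> hM" and d': "0 \<le> d'" "d' \<le> hS"
      and f: "f = M (q t) *v w t + C (q t) (v t) *v v t + Kd *v v t + Kp *v ((q t - \<gamma>) - qm (t - d))"
    define x where "x = qm t - qm (t - d)"
    define y where "y = q t - q (t - d')"
    define r where "r = M (q t) *v w t + C (q t) (v t) *v v t"
    have r: "r = f - Kd *v v t + Kp *v e t - Kp *v x"
    proof -
      have "(q t - \<gamma>) - qm (t - d) = x - e t" by (simp add: x_def e_def)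
      then show ?thesis by (simp add: f r_def matrix_vector_mult_diff_distrib)
    qed
    have A: "- 2 * (vm t \<bullet> (Kd *v vm t)) + hM * (vm t \<bullet> (Rm *v vm t)) - 2 * (v t \<bullet> (Kd *v v t)) + hS * (v t \<bullet> (R *v v t))
       - 2 * (vm t \<bullet> (Kp *v y)) - 2 * (v t \<bullet> (Kp *v x)) - I t - J t
     \<le> - \<epsilon> * (vm t \<bullet> vm t + v t \<bullet> v t + x \<bullet> x + y \<bullet> y + I t + J t)"
      using Jm[OF t d] Js[OF t d'] I0[OF t] J0[OF t] unfolding x_def y_def by (intro \<epsilon>) auto
    have B: "- (p' t \<bullet> (M (q t) *v v t) + v t \<bullet> (C (q t) (v t) *v saturate (e t)) + saturate (e t) \<bullet> r)
       \<le> - (\<kappa> / 4) * saturated_square (e t) + K * (vm t \<bullet> vm t + v t \<bullet> v t + x \<bullet> x) + (f \<bullet> f) / \<kappa>"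
      unfolding r by (rule K[OF symM nnM c(2)]) (simp add: p'_def saturate_derivative_norm)
    define X where "X = p' t \<bullet> (M (q t) *v v t) + v t \<bullet> (C (q t) (v t) *v saturate (e t)) + saturate (e t) \<bullet> r"
    have B': "- \<mu> * X \<le> - (\<mu> * \<kappa> / 4) * saturated_square (e t)
        + \<epsilon> / 4 * (vm t \<bullet> vm t + v t \<bullet> v t + x \<bullet> x) + \<mu> / \<kappa> * (f \<bullet> f)"
    proof -
      have "\<mu> * - X \<le> \<mu> * (- (\<kappa> / 4) * saturated_square (e t)
          + K * (vm t \<bullet> vm t + v t \<bullet> v t + x \<bullet> x) + (f \<bullet> f) / \<kappa>)"
        using B \<open>0 < \<mu>\<close> unfolding X_def by (intro mult_left_mono) auto
      moreover have "\<mu> * K * (vm t \<bullet> vm t + v t \<bullet> v t + x \<bullet> x)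
          \<le> \<epsilon> / 4 * (vm t \<bullet> vm t + v t \<bullet> v t + x \<bullet> x)"
        using \<mu>(1) by (intro mult_right_mono) auto
      ultimately show ?thesis by (simp add: algebra_simps)
    qed
    \<comment> \<open>The budget of \<open>v t \<bullet> v t\<close>: of the margin
      \<open>\<epsilon>\<close>, a quarter went to the cross term and, as this power counts twice,
      half goes here. A quarter remains, hence \<open>k \<le> \<epsilon> / 4\<close>.\<close>
    have F: "v t \<bullet> f \<le> \<epsilon> / 4 * (v t \<bullet> v t) + 1\<^sup>2 / (4 * (\<epsilon> / 4)) * (f \<bullet> f)"
      using \<open>0 < \<epsilon>\<close> by (intro inner_le_weighted_squares) auto
    have S'1: "S' t = 2 * (v t \<bullet> r) + 2 * (e t \<bullet> (Kp *v (vm t - v t)))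
       + (hM * (vm t \<bullet> (Rm *v vm t)) - I t) + (hS * (v t \<bullet> (R *v v t)) - J t) + - \<mu> * X"
      using symmetric_inner_commute[OF symM, of "w t" "q t" "v t"]
      by (simp add: S'_def X_def r_def inner_add_right)
    have vr: "2 * (v t \<bullet> r) + 2 * (e t \<bullet> (Kp *v (vm t - v t)))
        = 2 * (v t \<bullet> f) - 2 * (v t \<bullet> (Kd *v v t)) - 2 * (v t \<bullet> (Kp *v x)) + 2 * (vm t \<bullet> (Kp *v e t))"
      using symmetric_inner_commute[OF symKp, of "e t"]
      by (simp add: r inner_add_right inner_diff_right matrix_vector_mult_diff_distrib)
    have sq: "0 \<le> saturated_square (e t)" by (rule saturated_square_nonneg)
    have ks: "k * (vm t \<bullet> vm t) \<le> \<epsilon> / 4 * (vm t \<bullet> vm t)" "k * (v t \<bullet> v t) \<le> \<epsilon> / 4 * (v t \<bullet> v t)"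
      "k * saturated_square (e t) \<le> \<mu> * \<kappa> / 4 * saturated_square (e t)"
      "k * (I t + J t) \<le> \<epsilon> / 4 * (I t + J t)"
      using mult_right_mono[OF k(1) inner_ge_zero[of "vm t"]] mult_right_mono[OF k(1) inner_ge_zero[of "v t"]]
        mult_right_mono[OF k(2) sq] mult_right_mono[OF k(1) add_nonneg_nonneg[OF I0[OF t] J0[OF t]]] .
    have kf: "(2 / \<epsilon> + \<mu> / \<kappa>) * (f \<bullet> f) \<le> 1 / k * (f \<bullet> f)"
      using kk(2) kk1 by (intro mult_right_mono) auto
    \<comment> \<open>Products of constants become single symbols, so that the final estimate is
      linear in the products with the squares.\<close>
    define \<eta> where "\<eta> = \<epsilon> / 4"
    define \<alpha> where "\<alpha> = 2 / \<epsilon>"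
    define \<beta> where "\<beta> = \<mu> / \<kappa>"
    define \<theta> where "\<theta> = \<mu> * \<kappa> / 4"
    define \<iota> where "\<iota> = 1 / k"
    have eps: "\<epsilon> = 4 * \<eta>" by (simp add: \<eta>_def)
    have ee: "0 \<le> \<eta> * (vm t \<bullet> vm t)" "0 \<le> \<eta> * (v t \<bullet> v t)" "0 \<le> \<eta> * (x \<bullet> x)" "0 \<le> \<eta> * (y \<bullet> y)"
      "0 \<le> \<eta> * (I t + J t)"
      using \<open>0 < \<epsilon>\<close> I0[OF t] J0[OF t] unfolding \<eta>_def by auto
    have F': "2 * (v t \<bullet> f) \<le> 2 * \<eta> * (v t \<bullet> v t) + \<alpha> * (f \<bullet> f)"
      using F \<open>0 < \<epsilon>\<close> by (simp add: \<eta>_def \<alpha>_def)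
    have fk: "(f \<bullet> f) / k = \<iota> * (f \<bullet> f)" by (simp add: \<iota>_def)
    have goal: "2 * (vm t \<bullet> (Kp *v (e t + y) + Kd *v vm t))
        = 2 * (vm t \<bullet> (Kp *v e t)) + 2 * (vm t \<bullet> (Kp *v y)) + 2 * (vm t \<bullet> (Kd *v vm t))"
      by (simp add: matrix_vector_right_distrib inner_add_right)
    show "S' t \<le> 2 * (vm t \<bullet> (Kp *v (e t + (q t - q (t - d'))) + Kd *v vm t))
         - k * (vm t \<bullet> vm t + v t \<bullet> v t + saturated_square (e t) + (I t + J t)) + (f \<bullet> f) / k"
      unfolding y_def[symmetric] goal S'1 vr fk
      using A[unfolded eps] B'[folded \<eta>_def \<beta>_def \<theta>_def] F' ks[folded \<eta>_def \<theta>_def]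
        kf[folded \<alpha>_def \<beta>_def \<iota>_def] ee
      unfolding ring_distribs by linarith
  qed
qed

section \<open>Accelerations from the equations of motion\<close>

lemma inertia_norm_bound:
  assumes "inertia_bounded M"
  obtains l where "0 < l" "\<And>q x. norm x \<le> norm (M q *v x) / l"
proof -
  obtain l where l: "0 < l" "\<And>q x. l * (x \<bullet> x) \<le> x \<bullet> (M q *v x)"
    using assms unfolding inertia_bounded_def by blast
  have "norm x \<le> norm (M q *v x) / l" for q x
  proof (cases "x = 0")
    case False
    have "norm x * (l * norm x) \<le> norm x * norm (M q *v x)"
      using l(2)[of x q] norm_cauchy_schwarz[of x "M q *v x"]
      by (simp add: dot_square_norm power2_eq_square algebra_simps)
    then show ?thesis using False l(1) by (simp add: field_simps)
  qed simp
  with l(1) show thesis using that by blast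
qed

lemma acceleration_bound:
  assumes "robot M C"
  obtains K where "0 < K" "\<And>q v a. norm a \<le> K * (norm (M q *v a + C q v *v v) + (norm v)\<^sup>2)"
proof -
  obtain l where l: "0 < l" "\<And>q x. norm x \<le> norm (M q *v x) / l"
    using assms inertia_norm_bound by (metis robot_def)
  obtain c where c: "0 < c" "\<And>q x y. norm (C q x *v y) \<le> c * norm x * norm y"
    using assms by (auto simp: robot_def coriolis_bounded_def)
  define K where "K = (1 + c) / l"
  have "norm a \<le> K * (norm (M q *v a + C q v *v v) + (norm v)\<^sup>2)" for q v a
  proof -
    define r where "r = M q *v a + C q v *v v"
    have "norm (M q *v a) \<le> norm r + norm (C q v *v v)"
      using norm_triangle_ineq4[of r "C q v *v v"] by (simp add: r_def)
    also have "\<dots> \<le> norm r + c * (norm v)\<^sup>2" using c(2)[of q v v] by (simp add: power2_eq_square)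
    also have "\<dots> \<le> (1 + c) * (norm r + (norm v)\<^sup>2)" using c(1) by (simp add: algebra_simps)
    finally have "norm (M q *v a) / l \<le> (1 + c) * (norm r + (norm v)\<^sup>2) / l"
      using l(1) by (intro divide_right_mono) auto
    then show ?thesis using l(2)[of a q] by (simp add: K_def r_def)
  qed
  moreover have "0 < K" using l c by (simp add: K_def)
  ultimately show thesis using that by blast
qed

lemma matrix_norm_le:
  fixes A :: "real^'n^'n"
  obtains B where "\<And>x r. norm x \<le> r \<Longrightarrow> norm (A *v x) \<le> B * r"
proof -
  obtain B where "0 < B" "\<And>x. norm (A *v x) \<le> B * norm x" using matrix_norm_bound by blast
  then show thesis using that by (meson mult_left_mono less_imp_le order_trans)
qed

text \<open>Lets a bound on squares, such as the load, dominate the forces themselves on bounded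
  time intervals.\<close>

lemma norm_le_one_plus_square: "norm x \<le> 1 + (norm x)\<^sup>2"
  using zero_le_power2[of "norm x - 1 / 2"] by (simp add: power2_eq_square algebra_simps)

text \<open>A gauge integral alone would not make the acceleration absolutely integrable. Solving
  the equation of motion for \<open>a t\<close> supplies an integrable majorant.\<close>

lemma acceleration_primitive:
  fixes v :: "real \<Rightarrow> real^'n"
  assumes robot: "robot M C" and a: "\<And>t. t0 \<le> t \<Longrightarrow> (a has_integral v t - v t0) {t0..t}"
    and v: "continuous_on {t0..} v"
    and B: "\<And>b. t0 \<le> b \<Longrightarrow> \<exists>B. B integrable_on {t0..b} \<and>
        (\<forall>t\<in>{t0..b}. norm (M (q t) *v a t + C (q t) (v t) *v v t) \<le> B t)"
  shows "primitive t0 v a"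
  unfolding primitive_def
proof (intro allI impI conjI)
  fix b assume b: "t0 \<le> b"
  obtain K where K: "0 < K" "\<And>q v a. norm a \<le> K * (norm (M q *v a + C q v *v v) + (norm v)\<^sup>2)"
    using acceleration_bound[OF robot] by blast
  obtain B where B: "B integrable_on {t0..b}"
    "\<And>t. t \<in> {t0..b} \<Longrightarrow> norm (M (q t) *v a t + C (q t) (v t) *v v t) \<le> B t"
    using B[OF b] by blast
  show "a absolutely_integrable_on {t0..b}"
  proof (rule measurable_bounded_by_integrable_imp_absolutely_integrable)
    show "a \<in> borel_measurable (lebesgue_on {t0..b})"
      using a[OF b] by (intro integrable_imp_measurable) blast
    have "(\<lambda>t. (norm (v t))\<^sup>2) integrable_on {t0..b}"
      by (intro integrable_continuous_real continuous_intros continuous_on_subset[OF v]) auto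
    then have "(\<lambda>t. B t + (norm (v t))\<^sup>2) integrable_on {t0..b}" using B(1) by (intro integrable_add)
    from integrable_cmul[OF this, of K]
    show "(\<lambda>t. K * (B t + (norm (v t))\<^sup>2)) integrable_on {t0..b}" by simp
    show "norm (a t) \<le> K * (B t + (norm (v t))\<^sup>2)" if "t \<in> {t0..b}" for t
      by (rule order_trans[OF K(2)[of "a t" "q t" "v t"]]) (use B(2)[OF that] K(1) in auto)
  qed simp
qed (use a in auto)

text \<open>The network is abstracted to the ranges of the delays from \<open>t0\<close> on. The
  order \<open>hM \<le> hS\<close> makes \<open>hS\<close> the length of past that serves both
  delays.\<close>

locale closed_loop =
  fixes N :: nat
    and Mm :: "real^'n \<Rightarrow> real^'n^'n" and Cm :: "real^'n \<Rightarrow> real^'n \<Rightarrow> real^'n^'n"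
    and Ms :: "nat \<Rightarrow> real^'n \<Rightarrow> real^'n^'n" and Cs :: "nat \<Rightarrow> real^'n \<Rightarrow> real^'n \<Rightarrow> real^'n^'n"
    and Kp Kd :: "nat \<Rightarrow> real^'n^'n" and \<gamma> :: "nat \<Rightarrow> real^'n" and hM hS t0 :: real
    and dm :: "real \<Rightarrow> real" and ds :: "nat \<Rightarrow> real \<Rightarrow> real"
    and qm vm am fm :: "real \<Rightarrow> real^'n" and qs vs as fs :: "nat \<Rightarrow> real \<Rightarrow> real^'n"
    and Rm :: "real^'n^'n" and Rs :: "nat \<Rightarrow> real^'n^'n"
  assumes N: "1 \<le> N"
    and robot_m: "robot Mm Cm" and robot_s: "\<And>i. i \<in> {1..N} \<Longrightarrow> robot (Ms i) (Cs i)"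
    and Kp: "\<And>i. i \<in> {1..N} \<Longrightarrow> pos_def (Kp i)"
    and h: "0 < hM" "hM \<le> hS" and t0: "0 < t0"
    and dm: "\<And>t. t0 \<le> t \<Longrightarrow> 0 \<le> dm t \<and> dm t \<le> hM"
    and ds: "\<And>i t. i \<in> {1..N} \<Longrightarrow> t0 \<le> t \<Longrightarrow> 0 \<le> ds i t \<and> ds i t \<le> hS"
    and motion_m: "motion hS t0 qm vm am"
    and motion_s: "\<And>i. i \<in> {1..N} \<Longrightarrow> motion hS t0 (qs i) (vs i) (as i)"
    and master: "\<And>t. t0 \<le> t \<Longrightarrow> fm t = Mm (qm t) *v am t + Cm (qm t) (vm t) *v vm t
           + (1 / real N) *\<^sub>R (\<Sum>i=1..N. Kp i *v (qm t - qs i (t - ds i t)) + Kd i *v vm t)"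
    and slaves: "\<And>i t. i \<in> {1..N} \<Longrightarrow> t0 \<le> t \<Longrightarrow>
           fs i t = Ms i (qs i t) *v as i t + Cs i (qs i t) (vs i t) *v vs i t
           + Kd i *v vs i t + Kp i *v ((qs i t - \<gamma> i) - qm (t - dm t))"
    and Rm: "pos_def Rm" and Rs: "\<And>i. i \<in> {1..N} \<Longrightarrow> pos_def (Rs i)"
    and lmi: "\<And>i. i \<in> {1..N} \<Longrightarrow> neg_def (lmi_matrix hM hS (Kp i) (Kd i) Rm (Rs i))"
begin

definition err :: "nat \<Rightarrow> real \<Rightarrow> real^'n" where
  "err i t = qm t - (qs i t - \<gamma> i)"

text \<open>The offset \<open>\<Sum>i=1..N. Kp i *v \<gamma> i\<close> vanishes for balanced gains.\<close>

definition master_load :: "real \<Rightarrow> real^'n" where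
  "master_load t = real N *\<^sub>R fm t + (\<Sum>i=1..N. Kp i *v \<gamma> i)"

text \<open>The squared external forces as they enter the rate of the Lyapunov function.\<close>

definition load :: "real \<Rightarrow> real" where
  "load t = master_load t \<bullet> master_load t + (\<Sum>i=1..N. fs i t \<bullet> fs i t)"

lemma continuous_signals:
  "continuous_on {- hS..} qm" "continuous_on {- hS..} vm"
  "i \<in> {1..N} \<Longrightarrow> continuous_on {- hS..} (qs i)" "i \<in> {1..N} \<Longrightarrow> continuous_on {- hS..} (vs i)"
  using motion_m motion_s[of i] unfolding motion_def
  by (auto simp: continuous_on_eq_continuous_within intro: has_vector_derivative_continuous)

lemma bounded_on_past:
  fixes x :: "real \<Rightarrow> real^'n"
  assumes "continuous_on {- hS..} x"
  obtains K where "\<And>t. t \<in> {- hS..b} \<Longrightarrow> norm (x t) \<le> K"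
proof -
  have "bounded (x ` {- hS..b})"
    by (intro compact_imp_bounded compact_continuous_image continuous_on_subset[OF assms]) auto
  then show thesis using that unfolding bounded_iff by blast
qed

text \<open>Multiplying by \<open>N\<close> removes the mean. Writing the delayed feedback as error
  plus displacement leaves the vectors \<open>Kp i *v \<gamma> i\<close>, which are moved into the
  load.\<close>

lemma master_balance:
  assumes "t0 \<le> t"
  shows "real N *\<^sub>R (Mm (qm t) *v am t + Cm (qm t) (vm t) *v vm t)
    = master_load t - (\<Sum>i=1..N. Kp i *v (err i t + (qs i t - qs i (t - ds i t))) + Kd i *v vm t)"
proof -
  have "Kp i *v (qm t - qs i (t - ds i t)) + Kd i *v vm t =
     (Kp i *v (err i t + (qs i t - qs i (t - ds i t))) + Kd i *v vm t) - Kp i *v \<gamma> i" for i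
    by (simp add: err_def matrix_vector_mult_diff_distrib matrix_vector_right_distrib)
  then have eq: "(\<Sum>i=1..N. Kp i *v (qm t - qs i (t - ds i t)) + Kd i *v vm t)
     = (\<Sum>i=1..N. Kp i *v (err i t + (qs i t - qs i (t - ds i t))) + Kd i *v vm t) - (\<Sum>i=1..N. Kp i *v \<gamma> i)"
    by (simp only: sum_subtractf)
  show ?thesis
    unfolding master_load_def master[OF assms] eq scaleR_add_right using N by simp
qed

lemma slave_balance:
  assumes "i \<in> {1..N}" "t0 \<le> t"
  shows "Ms i (qs i t) *v as i t + Cs i (qs i t) (vs i t) *v vs i t
    = fs i t - Kd i *v vs i t + Kp i *v (err i t - (qm t - qm (t - dm t)))"
  using slaves[OF assms]
  by (simp add: err_def matrix_vector_mult_diff_distrib algebra_simps)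

lemma load_bounds:
  "master_load t \<bullet> master_load t \<le> load t" "i \<in> {1..N} \<Longrightarrow> fs i t \<bullet> fs i t \<le> load t"
proof -
  have "0 \<le> (\<Sum>i=1..N. fs i t \<bullet> fs i t)" by (intro sum_nonneg) auto
  then show "master_load t \<bullet> master_load t \<le> load t" by (simp add: load_def)
  assume "i \<in> {1..N}"
  then have "fs i t \<bullet> fs i t \<le> (\<Sum>i=1..N. fs i t \<bullet> fs i t)" by (intro member_le_sum) auto
  then show "fs i t \<bullet> fs i t \<le> load t"
    unfolding load_def using inner_ge_zero[of "master_load t"] by linarith
qed

lemma load_nonneg: "0 \<le> load t"
  using load_bounds(1)[of t] inner_ge_zero[of "master_load t"] by linarith

text \<open>The majorant \<open>B\<close> serves both force classes: a constant for bounded forces,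
  the load itself when it is integrable. The feedback is bounded on \<open>{t0..b}\<close> by
  compactness, since delayed times stay in \<open>{- hS..b}\<close>.\<close>

lemma master_velocity_primitive:
  assumes B: "\<And>b. B integrable_on {t0..b}" "\<And>t. t0 \<le> t \<Longrightarrow> load t \<le> B t"
  shows "primitive t0 vm am"
proof (rule acceleration_primitive[OF robot_m])
  show "(am has_integral vm t - vm t0) {t0..t}" if "t0 \<le> t" for t
    using motion_m that by (simp add: motion_def)
  show "continuous_on {t0..} vm" using continuous_signals(2) t0 h by (auto intro: continuous_on_subset)
  fix b assume b: "t0 \<le> b"
  define r where "r = (\<lambda>i t. Kp i *v (err i t + (qs i t - qs i (t - ds i t))) + Kd i *v vm t)"
  have "\<exists>K. \<forall>t\<in>{t0..b}. norm (r i t) \<le> K" if i: "i \<in> {1..N}" for i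
  proof -
    obtain k1 k2 k3 where k: "\<And>t. t \<in> {- hS..b} \<Longrightarrow> norm (qm t) \<le> k1"
      "\<And>t. t \<in> {- hS..b} \<Longrightarrow> norm (qs i t) \<le> k2" "\<And>t. t \<in> {- hS..b} \<Longrightarrow> norm (vm t) \<le> k3"
      using bounded_on_past[of _ b] continuous_signals i by metis
    obtain p d where p: "\<And>x r. norm x \<le> r \<Longrightarrow> norm (Kp i *v x) \<le> p * r"
      and d: "\<And>x r. norm x \<le> r \<Longrightarrow> norm (Kd i *v x) \<le> d * r"
      using matrix_norm_le by metis
    have "norm (r i t) \<le> p * (k1 + k2 + norm (\<gamma> i)) + d * k3" if t: "t \<in> {t0..b}" for t
    proof -
      have mem: "t \<in> {- hS..b}" "t - ds i t \<in> {- hS..b}" using t ds[OF i, of t] t0 h by auto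
      have eq: "err i t + (qs i t - qs i (t - ds i t)) = qm t - qs i (t - ds i t) + \<gamma> i"
        by (simp add: err_def)
      have "norm (err i t + (qs i t - qs i (t - ds i t))) \<le> k1 + k2 + norm (\<gamma> i)"
        unfolding eq using k(1)[OF mem(1)] k(2)[OF mem(2)] norm_triangle_ineq4[of "qm t" "qs i (t - ds i t)"]
          norm_triangle_ineq[of "qm t - qs i (t - ds i t)" "\<gamma> i"] by linarith
      then have "norm (Kp i *v (err i t + (qs i t - qs i (t - ds i t)))) \<le> p * (k1 + k2 + norm (\<gamma> i))"
        by (rule p)
      moreover have "norm (Kd i *v vm t) \<le> d * k3"
        using k(3)[OF mem(1)] by (rule d)
      ultimately show ?thesis unfolding r_def by (rule norm_triangle_mono)
    qed
    then show ?thesis by blast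
  qed
  then have "\<forall>i\<in>{1..N}. \<exists>K. \<forall>t\<in>{t0..b}. norm (r i t) \<le> K" by blast
  then obtain K where K: "\<And>i t. i \<in> {1..N} \<Longrightarrow> t \<in> {t0..b} \<Longrightarrow> norm (r i t) \<le> K i"
    by (metis (no_types, lifting) bchoice)
  have bound: "norm (Mm (qm t) *v am t + Cm (qm t) (vm t) *v vm t) \<le> (1 + B t) + (\<Sum>i=1..N. K i)"
    if t: "t \<in> {t0..b}" for t
  proof -
    define x where "x = Mm (qm t) *v am t + Cm (qm t) (vm t) *v vm t"
    have "real N *\<^sub>R x = master_load t - (\<Sum>i=1..N. r i t)"
      using master_balance[of t] t by (simp add: x_def r_def)
    then have "real N * norm x = norm (master_load t - (\<Sum>i=1..N. r i t))"
      by (metis norm_scaleR abs_of_nat)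
    moreover have "norm x \<le> real N * norm x" using N by (simp add: mult_le_cancel_right1)
    moreover have "norm (master_load t) \<le> 1 + B t"
      using norm_le_one_plus_square[of "master_load t"] load_bounds(1)[of t] B(2)[of t] t
      by (simp add: power2_norm_eq_inner)
    moreover have "norm (\<Sum>i=1..N. r i t) \<le> (\<Sum>i=1..N. K i)"
      using K t by (intro sum_norm_le) auto
    ultimately show ?thesis
      unfolding x_def using norm_triangle_ineq4[of "master_load t" "\<Sum>i=1..N. r i t"] by linarith
  qed
  have "(\<lambda>t. (1 + B t) + (\<Sum>i=1..N. K i)) integrable_on {t0..b}"
    by (intro integrable_add B(1)) auto
  with bound show "\<exists>B. B integrable_on {t0..b} \<and>
        (\<forall>t\<in>{t0..b}. norm (Mm (qm t) *v am t + Cm (qm t) (vm t) *v vm t) \<le> B t)" by blast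
qed

lemma slave_velocity_primitive:
  assumes B: "\<And>b. B integrable_on {t0..b}" "\<And>t. t0 \<le> t \<Longrightarrow> load t \<le> B t" and i: "i \<in> {1..N}"
  shows "primitive t0 (vs i) (as i)"
proof (rule acceleration_primitive[OF robot_s[OF i]])
  show "(as i has_integral vs i t - vs i t0) {t0..t}" if "t0 \<le> t" for t
    using motion_s[OF i] that by (simp add: motion_def)
  show "continuous_on {t0..} (vs i)"
    using continuous_signals(4)[OF i] t0 h by (auto intro: continuous_on_subset)
  fix b assume b: "t0 \<le> b"
  obtain k1 k2 k3 where k: "\<And>t. t \<in> {- hS..b} \<Longrightarrow> norm (qm t) \<le> k1"
    "\<And>t. t \<in> {- hS..b} \<Longrightarrow> norm (qs i t) \<le> k2" "\<And>t. t \<in> {- hS..b} \<Longrightarrow> norm (vs i t) \<le> k3"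
    using bounded_on_past[of _ b] continuous_signals i by metis
  obtain p d where p: "\<And>x r. norm x \<le> r \<Longrightarrow> norm (Kp i *v x) \<le> p * r"
    and d: "\<And>x r. norm x \<le> r \<Longrightarrow> norm (Kd i *v x) \<le> d * r"
    using matrix_norm_le by metis
  have bound: "norm (Ms i (qs i t) *v as i t + Cs i (qs i t) (vs i t) *v vs i t)
      \<le> (1 + B t) + (d * k3 + p * (k1 + k2 + norm (\<gamma> i)))" if t: "t \<in> {t0..b}" for t
  proof -
    have mem: "t \<in> {- hS..b}" "t - dm t \<in> {- hS..b}" using t dm[of t] t0 h by auto
    have eq: "err i t - (qm t - qm (t - dm t)) = qm (t - dm t) - qs i t + \<gamma> i"
      by (simp add: err_def)
    have "norm (err i t - (qm t - qm (t - dm t))) \<le> k1 + k2 + norm (\<gamma> i)"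
      unfolding eq using k(1)[OF mem(2)] k(2)[OF mem(1)] norm_triangle_ineq4[of "qm (t - dm t)" "qs i t"]
        norm_triangle_ineq[of "qm (t - dm t) - qs i t" "\<gamma> i"] by linarith
    then have 1: "norm (Kp i *v (err i t - (qm t - qm (t - dm t)))) \<le> p * (k1 + k2 + norm (\<gamma> i))"
      by (rule p)
    have 2: "norm (Kd i *v vs i t) \<le> d * k3"
      using k(3)[OF mem(1)] by (rule d)
    have 3: "norm (fs i t) \<le> 1 + B t"
      using norm_le_one_plus_square[of "fs i t"] load_bounds(2)[OF i, of t] B(2)[of t] t
      by (simp add: power2_norm_eq_inner)
    have eq: "Ms i (qs i t) *v as i t + Cs i (qs i t) (vs i t) *v vs i t
      = fs i t - Kd i *v vs i t + Kp i *v (err i t - (qm t - qm (t - dm t)))"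
      using slave_balance[OF i] t by simp
    show ?thesis
      unfolding eq using 1 2 3 norm_triangle_ineq4[of "fs i t" "Kd i *v vs i t"]
        norm_triangle_ineq[of "fs i t - Kd i *v vs i t" "Kp i *v (err i t - (qm t - qm (t - dm t)))"]
      by linarith
  qed
  have "(\<lambda>t. (1 + B t) + (d * k3 + p * (k1 + k2 + norm (\<gamma> i)))) integrable_on {t0..b}"
    by (intro integrable_add B(1)) auto
  with bound show "\<exists>B. B integrable_on {t0..b} \<and>
     (\<forall>t\<in>{t0..b}. norm (Ms i (qs i t) *v as i t + Cs i (qs i t) (vs i t) *v vs i t) \<le> B t)" by blast
qed


text \<open>The sum of the slave storages and of \<open>N\<close> times the quadratic form of the
  master's velocity. Lower bound and rate see different measures of the error,
  \<open>err i t \<bullet> err i t\<close> and its saturated square; closing this gap is left to the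
  two kinds of forces.\<close>

lemma lyapunov:
  assumes B: "\<And>b. B integrable_on {t0..b}" "\<And>t. t0 \<le> t \<Longrightarrow> load t \<le> B t"
  obtains W W' J k where "0 < k" "primitive t0 W W'"
    "\<And>i t. i \<in> {1..N} \<Longrightarrow> t0 \<le> t \<Longrightarrow> 0 \<le> J i t"
    "\<And>t. t0 \<le> t \<Longrightarrow> k * (vm t \<bullet> vm t + (\<Sum>i=1..N. vs i t \<bullet> vs i t + err i t \<bullet> err i t)) \<le> W t"
    "\<And>t. t0 \<le> t \<Longrightarrow>
       W t \<le> (vm t \<bullet> vm t + (\<Sum>i=1..N. vs i t \<bullet> vs i t + err i t \<bullet> err i t + J i t)) / k"
    "\<And>t. t0 \<le> t \<Longrightarrow> W' t \<le>
       - k * (vm t \<bullet> vm t + (\<Sum>i=1..N. vs i t \<bullet> vs i t + saturated_square (err i t) + J i t)) + load t / k"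
proof -
  have mv: "primitive t0 vm am" by (rule master_velocity_primitive[OF B])
  have qm': "(qm has_vector_derivative vm t) (at t within {- hS..})" if "- hS \<le> t" for t
    using motion_m that by (simp add: motion_def)
  define P where "P = (\<lambda>i S S' J k. 0 < k \<and> primitive t0 S S' \<and> (\<forall>t\<ge>t0. 0 \<le> J t \<and>
        k * (vs i t \<bullet> vs i t + err i t \<bullet> err i t) \<le> S t \<and>
        S t \<le> (vs i t \<bullet> vs i t + err i t \<bullet> err i t + J t) / k \<and>
        S' t \<le> 2 * (vm t \<bullet> (Kp i *v (err i t + (qs i t - qs i (t - ds i t))) + Kd i *v vm t))
         - k * (vm t \<bullet> vm t + vs i t \<bullet> vs i t + saturated_square (err i t) + J t) + (fs i t \<bullet> fs i t) / k))"
  have "\<exists>S S' J k. P i S S' J k"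
    if i: "i \<in> {1..N}" for i
  proof -
    have qs': "(qs i has_vector_derivative vs i t) (at t within {- hS..})" if "- hS \<le> t" for t
      using motion_s[OF i] that by (simp add: motion_def)
    show ?thesis
    proof (rule slave_storage[OF lmi[OF i] Kp[OF i] Rm Rs[OF i] h t0 robot_s[OF i] qm' continuous_signals(2)
          qs' continuous_signals(4)[OF i] slave_velocity_primitive[OF B i],
          where \<gamma> = "\<gamma> i", folded err_def])
      fix S S' J k
      assume k: "0 < k" and S: "primitive t0 S S'"
        and bounds: "\<And>t. t0 \<le> t \<Longrightarrow> 0 \<le> J t"
          "\<And>t. t0 \<le> t \<Longrightarrow> k * (vs i t \<bullet> vs i t + err i t \<bullet> err i t) \<le> S t"
          "\<And>t. t0 \<le> t \<Longrightarrow> S t \<le> (vs i t \<bullet> vs i t + err i t \<bullet> err i t + J t) / k"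
        and S': "\<And>t f d d'. t0 \<le> t \<Longrightarrow> 0 \<le> d \<Longrightarrow> d \<le> hM \<Longrightarrow> 0 \<le> d' \<Longrightarrow> d' \<le> hS \<Longrightarrow>
           f = Ms i (qs i t) *v as i t + Cs i (qs i t) (vs i t) *v vs i t + Kd i *v vs i t
             + Kp i *v ((qs i t - \<gamma> i) - qm (t - d)) \<Longrightarrow>
           S' t \<le> 2 * (vm t \<bullet> (Kp i *v (err i t + (qs i t - qs i (t - d'))) + Kd i *v vm t))
             - k * (vm t \<bullet> vm t + vs i t \<bullet> vs i t + saturated_square (err i t) + J t) + (f \<bullet> f) / k"
      have "S' t \<le> 2 * (vm t \<bullet> (Kp i *v (err i t + (qs i t - qs i (t - ds i t))) + Kd i *v vm t))
           - k * (vm t \<bullet> vm t + vs i t \<bullet> vs i t + saturated_square (err i t) + J t) + (fs i t \<bullet> fs i t) / k"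
        if "t0 \<le> t" for t
        using that dm[OF that] ds[OF i that] slaves[OF i that] by (intro S'[where d = "dm t"]) auto
      with k S bounds show ?thesis
        by (intro exI[of _ S] exI[of _ S'] exI[of _ J] exI[of _ k]) (simp add: P_def)
    qed
  qed
  then obtain S S' J \<kappa> where P: "\<And>i. i \<in> {1..N} \<Longrightarrow> P i (S i) (S' i) (J i) (\<kappa> i)"
    by metis
  then have \<kappa>: "\<And>i. i \<in> {1..N} \<Longrightarrow> 0 < \<kappa> i"
    and PS: "\<And>i. i \<in> {1..N} \<Longrightarrow> primitive t0 (S i) (S' i)"
    and J: "\<And>i t. i \<in> {1..N} \<Longrightarrow> t0 \<le> t \<Longrightarrow> 0 \<le> J i t"
    and lower: "\<And>i t. i \<in> {1..N} \<Longrightarrow> t0 \<le> t \<Longrightarrow> \<kappa> i * (vs i t \<bullet> vs i t + err i t \<bullet> err i t) \<le> S i t"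
    and upper: "\<And>i t. i \<in> {1..N} \<Longrightarrow> t0 \<le> t \<Longrightarrow>
        S i t \<le> (vs i t \<bullet> vs i t + err i t \<bullet> err i t + J i t) / \<kappa> i"
    and S': "\<And>i t. i \<in> {1..N} \<Longrightarrow> t0 \<le> t \<Longrightarrow>
        S' i t \<le> 2 * (vm t \<bullet> (Kp i *v (err i t + (qs i t - qs i (t - ds i t))) + Kd i *v vm t))
         - \<kappa> i * (vm t \<bullet> vm t + vs i t \<bullet> vs i t + saturated_square (err i t) + J i t)
         + (fs i t \<bullet> fs i t) / \<kappa> i"
    by (simp_all add: P_def)
  obtain l u where lu: "0 < l" "0 < u" and Mm: "\<And>q. pos_def (Mm q)"
      "\<And>q x. l * (x \<bullet> x) \<le> x \<bullet> (Mm q *v x)" "\<And>q x. x \<bullet> (Mm q *v x) \<le> u * (x \<bullet> x)"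
    using robot_m unfolding robot_def inertia_bounded_def by blast
  have symM: "transpose (Mm q) = Mm q" for q using Mm(1) by (simp add: pos_def_def)
  define \<nu> where "\<nu> = real N"
  have \<nu>: "1 \<le> \<nu>" using N by (simp add: \<nu>_def)
  define K where "K = Min (\<kappa> ` {1..N})"
  have ne: "{1..N} \<noteq> {}" using N by simp
  have K: "0 < K" "\<And>i. i \<in> {1..N} \<Longrightarrow> K \<le> \<kappa> i"
    using \<kappa> ne unfolding K_def by auto
  \<comment> \<open>Half of \<open>K\<close> pays for the load of the master; \<open>l\<close> and
    \<open>1 / (\<nu> * u)\<close> fit the lower and upper bounds of its weighted energy.\<close>
  define k where "k = min (K / 2) (min l (1 / (\<nu> * u)))"
  have k: "0 < k" "k \<le> K / 2" "k \<le> l" "k \<le> 1 / (\<nu> * u)"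
    using K lu \<nu> by (auto simp: k_def)
  have kK: "k \<le> K" "2 / K \<le> 1 / k" "1 / K \<le> 1 / k" "\<nu> * u \<le> 1 / k"
    using k K lu \<nu> by (auto simp: field_simps)
  have qm_at: "(qm has_vector_derivative vm t) (at t)" if "t0 \<le> t" for t
    using qm'[of t] that t0 h at_within_interior[of t "{- hS..}"] by (simp add: interior_real_atLeast)
  have PM: "primitive t0 (\<lambda>t. vm t \<bullet> (Mm (qm t) *v vm t))
    (\<lambda>t. am t \<bullet> (Mm (qm t) *v vm t) + vm t \<bullet> (Cm (qm t) (vm t) *v vm t)
       + vm t \<bullet> (Mm (qm t) *v am t + Cm (qm t) (vm t) *v vm t))"
    by (rule robot_momentum_primitive[OF _ symM _ qm_at mv mv]) (use robot_m in \<open>auto simp: robot_def\<close>)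
  define W where "W = (\<lambda>t. \<nu> * (vm t \<bullet> (Mm (qm t) *v vm t)) + (\<Sum>i=1..N. S i t))"
  define W' where "W' = (\<lambda>t. \<nu> * (am t \<bullet> (Mm (qm t) *v vm t) + vm t \<bullet> (Cm (qm t) (vm t) *v vm t)
       + vm t \<bullet> (Mm (qm t) *v am t + Cm (qm t) (vm t) *v vm t)) + (\<Sum>i=1..N. S' i t))"
  show thesis
  proof (rule that)
    show "0 < k" by fact
    show "primitive t0 W W'"
      unfolding W_def W'_def by (intro primitive_add primitive_cmult primitive_sum PM PS)
    show "0 \<le> J i t" if "i \<in> {1..N}" "t0 \<le> t" for i t using J that .
    fix t assume t: "t0 \<le> t"
    have "k * (vm t \<bullet> vm t) \<le> \<nu> * (vm t \<bullet> (Mm (qm t) *v vm t))"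
    proof -
      have "k * (vm t \<bullet> vm t) \<le> l * (vm t \<bullet> vm t)" using k(3) by (intro mult_right_mono) auto
      also have "\<dots> \<le> vm t \<bullet> (Mm (qm t) *v vm t)" by (rule Mm)
      finally have 1: "k * (vm t \<bullet> vm t) \<le> vm t \<bullet> (Mm (qm t) *v vm t)" .
      moreover have "0 \<le> k * (vm t \<bullet> vm t)" using k by simp
      ultimately have "1 * (vm t \<bullet> (Mm (qm t) *v vm t)) \<le> \<nu> * (vm t \<bullet> (Mm (qm t) *v vm t))"
        using \<nu> by (intro mult_right_mono) auto
      with 1 show ?thesis by simp
    qed
    moreover have "(\<Sum>i=1..N. k * (vs i t \<bullet> vs i t + err i t \<bullet> err i t)) \<le> (\<Sum>i=1..N. S i t)"
    proof (rule sum_mono)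
      fix i assume i: "i \<in> {1..N}"
      have "k * (vs i t \<bullet> vs i t + err i t \<bullet> err i t) \<le> \<kappa> i * (vs i t \<bullet> vs i t + err i t \<bullet> err i t)"
        using K(2)[OF i] kK(1) by (intro mult_right_mono) auto
      with lower[OF i t] show "k * (vs i t \<bullet> vs i t + err i t \<bullet> err i t) \<le> S i t" by linarith
    qed
    ultimately show "k * (vm t \<bullet> vm t + (\<Sum>i=1..N. vs i t \<bullet> vs i t + err i t \<bullet> err i t)) \<le> W t"
      by (simp only: W_def distrib_left[of k] sum_distrib_left)
    have "\<nu> * (vm t \<bullet> (Mm (qm t) *v vm t)) \<le> 1 / k * (vm t \<bullet> vm t)"
    proof -
      have "\<nu> * (vm t \<bullet> (Mm (qm t) *v vm t)) \<le> \<nu> * (u * (vm t \<bullet> vm t))"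
        using \<nu> Mm(3) by (intro mult_left_mono) auto
      also have "\<dots> = \<nu> * u * (vm t \<bullet> vm t)" by simp
      also have "\<dots> \<le> 1 / k * (vm t \<bullet> vm t)" using kK(4) by (intro mult_right_mono) auto
      finally show ?thesis .
    qed
    moreover have "(\<Sum>i=1..N. S i t) \<le> (\<Sum>i=1..N. 1 / k * (vs i t \<bullet> vs i t + err i t \<bullet> err i t + J i t))"
    proof (rule sum_mono)
      fix i assume i: "i \<in> {1..N}"
      have "S i t \<le> 1 / \<kappa> i * (vs i t \<bullet> vs i t + err i t \<bullet> err i t + J i t)" using upper[OF i t] by simp
      also have "\<dots> \<le> 1 / k * (vs i t \<bullet> vs i t + err i t \<bullet> err i t + J i t)"
        using K(2)[OF i] kK(1) k(1) J[OF i t] by (intro mult_right_mono divide_left_mono) auto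
      finally show "S i t \<le> 1 / k * (vs i t \<bullet> vs i t + err i t \<bullet> err i t + J i t)" .
    qed
    ultimately have "W t \<le> 1 / k * (vm t \<bullet> vm t + (\<Sum>i=1..N. vs i t \<bullet> vs i t + err i t \<bullet> err i t + J i t))"
      by (simp only: W_def distrib_left[of "1 / k"] sum_distrib_left)
    then show "W t \<le> (vm t \<bullet> vm t + (\<Sum>i=1..N. vs i t \<bullet> vs i t + err i t \<bullet> err i t + J i t)) / k" by simp
    define z where "z = (\<lambda>i. vs i t \<bullet> vs i t + saturated_square (err i t) + J i t)"
    define \<rho> where "\<rho> = (\<lambda>i. Kp i *v (err i t + (qs i t - qs i (t - ds i t))) + Kd i *v vm t)"
    define fsq where "fsq = (\<Sum>i=1..N. fs i t \<bullet> fs i t)"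
    have z: "0 \<le> z i" if "i \<in> {1..N}" for i
      using J[OF that t] saturated_square_nonneg[of "err i t"] by (simp add: z_def)
    have fsq: "0 \<le> fsq" by (auto simp: fsq_def intro: sum_nonneg)
    have "S' i t \<le> 2 * (vm t \<bullet> \<rho> i) - K * (vm t \<bullet> vm t + z i) + 1 / K * (fs i t \<bullet> fs i t)"
      if i: "i \<in> {1..N}" for i
    proof -
      have "S' i t \<le> 2 * (vm t \<bullet> \<rho> i) - \<kappa> i * (vm t \<bullet> vm t + z i) + 1 / \<kappa> i * (fs i t \<bullet> fs i t)"
        using S'[OF i t] by (simp add: \<rho>_def z_def add.assoc)
      moreover have "K * (vm t \<bullet> vm t + z i) \<le> \<kappa> i * (vm t \<bullet> vm t + z i)"
        using K(2)[OF i] z[OF i] by (intro mult_right_mono) auto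
      moreover have "1 / \<kappa> i * (fs i t \<bullet> fs i t) \<le> 1 / K * (fs i t \<bullet> fs i t)"
        using K(2)[OF i] K(1) by (intro mult_right_mono divide_left_mono) auto
      ultimately show ?thesis by linarith
    qed
    then have "(\<Sum>i=1..N. S' i t) \<le> (\<Sum>i=1..N. 2 * (vm t \<bullet> \<rho> i) - K * (vm t \<bullet> vm t + z i) + 1 / K * (fs i t \<bullet> fs i t))"
      by (intro sum_mono) auto
    also have "\<dots> = 2 * (vm t \<bullet> (\<Sum>i=1..N. \<rho> i)) - K * (\<nu> * (vm t \<bullet> vm t) + (\<Sum>i=1..N. z i)) + 1 / K * fsq"
      by (simp add: sum.distrib sum_subtractf sum_distrib_left inner_sum_right \<nu>_def fsq_def sum_divide_distrib
          distrib_left)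
    finally have sumS: "(\<Sum>i=1..N. S' i t) \<le> \<dots>" .
    \<comment> \<open>The sum over \<open>\<rho>\<close> is the coupling left open in the slave
      rates, here with the opposite sign.\<close>
    have m: "\<nu> * (am t \<bullet> (Mm (qm t) *v vm t) + vm t \<bullet> (Cm (qm t) (vm t) *v vm t)
       + vm t \<bullet> (Mm (qm t) *v am t + Cm (qm t) (vm t) *v vm t))
       = 2 * (vm t \<bullet> (master_load t - (\<Sum>i=1..N. \<rho> i)))"
    proof -
      have "2 * (vm t \<bullet> (master_load t - (\<Sum>i=1..N. \<rho> i)))
          = 2 * (\<nu> * (vm t \<bullet> (Mm (qm t) *v am t + Cm (qm t) (vm t) *v vm t)))"
        using master_balance[OF t] by (simp add: \<rho>_def \<nu>_def flip: inner_scaleR_right)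
      then show ?thesis
        using symmetric_inner_commute[OF symM, of "am t" "qm t" "vm t"]
        by (simp add: inner_add_right algebra_simps)
    qed
    have ml: "vm t \<bullet> master_load t \<le> K / 4 * (vm t \<bullet> vm t) + 1\<^sup>2 / (4 * (K / 4)) * (master_load t \<bullet> master_load t)"
      using K(1) by (intro inner_le_weighted_squares) auto
    have ml': "2 * (vm t \<bullet> master_load t) \<le> K / 2 * (vm t \<bullet> vm t) + 2 / K * (master_load t \<bullet> master_load t)"
      using ml by simp
    have "W' t \<le> K / 2 * (vm t \<bullet> vm t) + 2 / K * (master_load t \<bullet> master_load t)
        - K * (\<nu> * (vm t \<bullet> vm t) + (\<Sum>i=1..N. z i)) + 1 / K * fsq"
    proof -
      \<comment> \<open>The cancellation of the coupling, with \<open>r\<close> in its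
        place.\<close>
      have *: "2 * (p - r) + x \<le> a - b + c" if "x \<le> 2 * r - b + c" "2 * p \<le> a" for p r x a b c :: real
        using that by simp
      show ?thesis unfolding W'_def m inner_diff_right by (rule *[OF sumS ml'])
    qed
    moreover have "K * (vm t \<bullet> vm t + (\<Sum>i=1..N. z i)) \<le> K * (\<nu> * (vm t \<bullet> vm t) + (\<Sum>i=1..N. z i))"
    proof -
      have "1 * (vm t \<bullet> vm t) \<le> \<nu> * (vm t \<bullet> vm t)" using \<nu> by (intro mult_right_mono) auto
      then show ?thesis using K by (intro mult_left_mono) auto
    qed
    moreover have "K / 2 * (vm t \<bullet> vm t) \<le> K / 2 * (vm t \<bullet> vm t + (\<Sum>i=1..N. z i))"
      using K z by (intro mult_left_mono) (auto intro: sum_nonneg)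
    moreover have "k * (vm t \<bullet> vm t + (\<Sum>i=1..N. z i)) \<le> K / 2 * (vm t \<bullet> vm t + (\<Sum>i=1..N. z i))"
      using k z by (intro mult_right_mono) (auto intro!: add_nonneg_nonneg sum_nonneg)
    moreover have "2 / K * (master_load t \<bullet> master_load t) \<le> 1 / k * (master_load t \<bullet> master_load t)"
      using kK by (intro mult_right_mono) auto
    moreover have "1 / K * fsq \<le> 1 / k * fsq" using kK fsq by (intro mult_right_mono) auto
    moreover have "load t / k = 1 / k * (master_load t \<bullet> master_load t) + 1 / k * fsq"
      by (simp add: load_def fsq_def add_divide_distrib)
    ultimately have "W' t \<le> - k * (vm t \<bullet> vm t + (\<Sum>i=1..N. z i)) + load t / k" by linarith
    then show "W' t \<le> - k * (vm t \<bullet> vm t + (\<Sum>i=1..N. vs i t \<bullet> vs i t + saturated_square (err i t) + J i t)) + load t / k"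
      by (simp add: z_def)
  qed
qed

end

section \<open>Comparison arguments\<close>

text \<open>The densities are compared inside the interval only, since nothing need be known at the
  instant where a threshold is crossed.\<close>

lemma primitive_le:
  fixes F G :: "real \<Rightarrow> real"
  assumes "primitive a F f" "primitive a G g" "\<And>x. s < x \<Longrightarrow> x < t \<Longrightarrow> f x \<le> g x" "a \<le> s" "s \<le> t"
  shows "F t - F s \<le> G t - G s"
proof (rule has_integral_le)
  show "(f has_integral F t - F s) {s<..<t}" "(g has_integral G t - G s) {s<..<t}"
    using primitive_has_integral[OF assms(1) assms(4,5)] primitive_has_integral[OF assms(2) assms(4,5)]
    by (simp_all add: has_integral_Icc_iff_Ioo)
qed (use assms in auto)

lemma primitive_const: "primitive a (\<lambda>_. c) (\<lambda>_. 0)"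
  by (auto simp: primitive_def)

lemma primitive_ident: "primitive a (\<lambda>t. c * t) (\<lambda>_. c)" for c :: real
  by (rule primitive_of_continuous_derivative)
    (auto intro!: derivative_eq_intros simp flip: has_real_derivative_iff_has_vector_derivative)

text \<open>After the last time at or below the level \<open>m\<close>, the function lies above
  \<open>K\<close>, hence cannot grow.\<close>

lemma ultimately_bounded:
  fixes W :: "real \<Rightarrow> real"
  assumes W: "primitive a W W'" and dec: "\<And>t. a \<le> t \<Longrightarrow> K < W t \<Longrightarrow> W' t \<le> 0" and t: "a \<le> t"
  shows "W t \<le> max K (W a)"
proof (rule ccontr)
  define m where "m = max K (W a)"
  assume "\<not> W t \<le> max K (W a)"
  then have above: "m < W t" unfolding m_def by linarith
  define X where "X = {x \<in> {a..t}. W x \<le> m}"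
  have "closed X"
    unfolding X_def
    by (intro continuous_closed_preimage[of _ _ "{..m}", unfolded vimage_def, simplified Int_def, simplified]
        primitive_continuous_on[OF W]) auto
  moreover have "bounded X" by (rule bounded_subset[of "{a..t}"]) (auto simp: X_def)
  moreover have "a \<in> X" using t by (simp add: X_def m_def)
  ultimately obtain s where s: "s \<in> X" "\<And>x. x \<in> X \<Longrightarrow> x \<le> s"
    using compact_attains_sup[of X] compact_eq_bounded_closed by blast
  have "W' x \<le> 0" if "s < x" "x < t" for x
  proof -
    have "x \<notin> X" using s(2) that by force
    then have "m < W x" using that s(1) by (auto simp: X_def)
    then show ?thesis using dec that s(1) by (auto simp: X_def m_def)
  qed
  then have "W t - W s \<le> 0 - 0"
    using s(1) by (intro primitive_le[OF W primitive_const[of a 0]]) (auto simp: X_def)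
  then show False using above s(1) by (simp add: X_def)
qed

text \<open>With the integrating factor \<open>exp (c * (t - a))\<close> the product has a
  nonpositive density.\<close>

lemma exponential_decay:
  fixes W :: "real \<Rightarrow> real"
  assumes W: "primitive a W W'" and dec: "\<And>t. a \<le> t \<Longrightarrow> W' t \<le> - c * W t" and t: "a \<le> t"
  shows "W t \<le> W a * exp (- c * (t - a))"
proof -
  have "primitive a (\<lambda>t. exp (c * (t - a))) (\<lambda>t. c * exp (c * (t - a)))"
    by (rule primitive_of_continuous_derivative)
      (auto intro!: derivative_eq_intros continuous_intros simp flip: has_real_derivative_iff_has_vector_derivative)
  from primitive_bilinear[OF bilinear_times this W]
  have P: "primitive a (\<lambda>t. exp (c * (t - a)) * W t)
      (\<lambda>t. c * exp (c * (t - a)) * W t + exp (c * (t - a)) * W' t)" by simp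
  have "c * exp (c * (t - a)) * W t + exp (c * (t - a)) * W' t \<le> 0" if "a < t" for t
    using mult_left_mono[OF dec[of t], of "exp (c * (t - a))"] that by (simp add: algebra_simps)
  then have "exp (c * (t - a)) * W t - exp (c * (a - a)) * W a \<le> 0 - 0"
    using t by (intro primitive_le[OF P primitive_const[of a 0]]) auto
  then show ?thesis by (simp add: exp_minus field_simps exp_diff)
qed

text \<open>The inflow \<open>G\<close> is nondecreasing and bounded, so from some time
  \<open>s\<close> on it adds at most \<open>\<epsilon>\<close>. Staying above
  \<open>\<epsilon>\<close> for long would drain more than \<open>W\<close> has; once below,
  \<open>W\<close> rises by at most \<open>\<epsilon>\<close>.\<close>

lemma tendsto_zero_of_dissipation:
  fixes W :: "real \<Rightarrow> real"
  assumes W: "primitive a W W'" and dec: "\<And>t. a \<le> t \<Longrightarrow> W' t \<le> - c * W t + g t"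
    and c: "0 < c" and nonneg: "\<And>t. a \<le> t \<Longrightarrow> 0 \<le> W t"
    and G: "primitive a G g" and g: "\<And>t. a \<le> t \<Longrightarrow> 0 \<le> g t" and bdd: "\<And>t. a \<le> t \<Longrightarrow> G t \<le> B"
  shows "(W \<longlongrightarrow> 0) at_top"
proof (rule tendstoI)
  fix \<epsilon>' :: real assume "0 < \<epsilon>'"
  \<comment> \<open>One part for the level reached and one for the later rise; the third makes the
    inequality strict.\<close>
  define \<epsilon> where "\<epsilon> = \<epsilon>' / 3"
  have \<epsilon>: "0 < \<epsilon>" using \<open>0 < \<epsilon>'\<close> by (simp add: \<epsilon>_def)
  have monoG: "G s \<le> G t" if "a \<le> s" "s \<le> t" for s t
    using primitive_le[OF primitive_const[of a 0] G g that] that by auto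
  define S where "S = (SUP t\<in>{a..}. G t)"
  have bddG: "bdd_above (G ` {a..})" using bdd by (auto intro!: bdd_aboveI)
  have GS: "G t \<le> S" if "a \<le> t" for t
    unfolding S_def using bddG that by (intro cSUP_upper) auto
  have "\<exists>s\<in>{a..}. S - \<epsilon> < G s"
    using less_cSUP_iff[of "{a..}" G "S - \<epsilon>"] bddG \<epsilon> by (auto simp: S_def)
  then obtain s where s: "a \<le> s" "S - \<epsilon> < G s" by auto
  have tail: "G y - G x \<le> \<epsilon>" if "s \<le> x" "x \<le> y" for x y
    using GS[of y] monoG[of s x] s that by linarith
  have step: "W y - W x \<le> \<epsilon>" if "s \<le> x" "x \<le> y" for x y
  proof -
    have "W' z \<le> g z" if "x < z" "z < y" for z
    proof -
      have "a \<le> z" using that \<open>s \<le> x\<close> s by simp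
      then have "0 \<le> c * W z" using nonneg c by simp
      then show ?thesis using dec[OF \<open>a \<le> z\<close>] by simp
    qed
    then have "W y - W x \<le> G y - G x" using that s by (intro primitive_le[OF W G]) auto
    then show ?thesis using tail[OF that] by linarith
  qed
  \<comment> \<open>Over this time the loss at rate \<open>c * \<epsilon>\<close> exceeds the stock
    \<open>W s\<close> plus the remaining inflow.\<close>
  define L where "L = (W s + \<epsilon>) / (c * \<epsilon>) + 1"
  have L: "0 < L" "W s + \<epsilon> < c * \<epsilon> * L"
    using nonneg[OF s(1)] c \<epsilon> by (auto simp: L_def field_simps intro!: add_nonneg_pos)
  have "\<exists>x\<in>{s..s + L}. W x \<le> \<epsilon>"
  proof (rule ccontr)
    assume "\<not> (\<exists>x\<in>{s..s + L}. W x \<le> \<epsilon>)"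
    then have big: "\<epsilon> < W x" if "x \<in> {s..s + L}" for x using that by force
    have "W' z \<le> - (c * \<epsilon>) + g z" if "s < z" "z < s + L" for z
    proof -
      have "a \<le> z" "c * \<epsilon> \<le> c * W z" using big[of z] that s c by auto
      then show ?thesis using dec[OF \<open>a \<le> z\<close>] by simp
    qed
    then have "W (s + L) - W s \<le> (- (c * \<epsilon>) * (s + L) + G (s + L)) - (- (c * \<epsilon>) * s + G s)"
      using L s by (intro primitive_le[OF W primitive_add[OF primitive_ident G]]) auto
    then show False
      using nonneg[of "s + L"] tail[of s "s + L"] L s by (simp add: algebra_simps)
  qed
  then obtain x where x: "s \<le> x" "W x \<le> \<epsilon>" by auto
  have "dist (W y) 0 < \<epsilon>'" if "x \<le> y" for y
    using step[OF x(1) that] x nonneg[of y] that s \<epsilon> by (simp add: \<epsilon>_def)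
  then show "\<forall>\<^sub>F y in at_top. dist (W y) 0 < \<epsilon>'"
    unfolding eventually_at_top_linorder by blast
qed

section \<open>Stability of the closed loop\<close>

text \<open>Outside the unit ball the square root is at most \<open>2 * norm e\<close>, so the
  saturated square is at least half the norm.\<close>

lemma norm_le_of_saturated_square:
  assumes "saturated_square e \<le> y" "0 \<le> y"
  shows "norm e \<le> 1 + 2 * y"
proof (cases "norm e \<le> 1")
  case False
  define s where "s = sqrt (1 + e \<bullet> e)"
  have s: "1 \<le> s" using sqrt_one_plus_inner(1)[of e] by (simp add: s_def)
  have n: "1 < norm e" using False by simp
  have "1 \<le> (norm e)\<^sup>2" using n by (simp add: one_le_power)
  then have "s \<le> sqrt ((2 * norm e)\<^sup>2)"
    unfolding s_def by (intro real_sqrt_le_mono) (simp add: power_mult_distrib flip: power2_norm_eq_inner)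
  then have "s \<le> 2 * norm e" by (simp only: real_sqrt_abs) simp
  then have "(norm e)\<^sup>2 \<le> y * (2 * norm e)"
    using assms s mult_left_mono[of s "2 * norm e" y]
    by (simp add: saturated_square_def divide_le_eq power2_norm_eq_inner flip: s_def)
  then have "norm e * norm e \<le> norm e * (2 * y)" by (simp add: power2_eq_square algebra_simps)
  then have "norm e \<le> 2 * y" using n by (subst (asm) mult_le_cancel_left_pos) auto
  then show ?thesis by simp
qed (use assms in simp)

text \<open>Undoes the saturation on a bounded set of errors.\<close>

lemma saturated_square_ge:
  assumes "e \<bullet> e \<le> b"
  shows "(e \<bullet> e) / sqrt (1 + b) \<le> saturated_square e"
proof -
  have "0 < 1 + e \<bullet> e" "0 < 1 + b" using assms inner_ge_zero[of e] by linarith+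
  then show ?thesis
    unfolding saturated_square_def using assms
    by (intro divide_left_mono real_sqrt_le_mono mult_pos_pos) auto
qed

lemma norm_increment_le:
  fixes q :: "real \<Rightarrow> real^'n"
  assumes q: "\<And>t. a \<le> t \<Longrightarrow> (q has_vector_derivative v t) (at t within {a..})"
    and st: "a \<le> s" "s \<le> t" and V: "(V has_integral I) {s..t}" "\<And>x. x \<in> {s..t} \<Longrightarrow> norm (v x) \<le> V x"
  shows "norm (q t - q s) \<le> I"
proof -
  have "(v has_integral q t - q s) {s..t}"
  proof (rule fundamental_theorem_of_calculus[OF st(2)])
    show "(q has_vector_derivative v x) (at x within {s..t})" if "x \<in> {s..t}" for x
      by (rule has_vector_derivative_within_subset[OF q]) (use that st in auto)
  qed
  then show ?thesis
    using integral_norm_bound_integral[of v "{s..t}" V] V by (metis has_integral_integrable integral_unique)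
qed

lemma bounded_sum_comp:
  fixes f :: "'i \<Rightarrow> 'a \<Rightarrow> 'b::real_normed_vector"
  assumes "\<And>i. i \<in> I \<Longrightarrow> bounded (f i ` S)"
  shows "bounded ((\<lambda>x. \<Sum>i\<in>I. f i x) ` S)"
  using assms
proof (induction I rule: infinite_finite_induct)
  case (insert i I)
  then show ?case using bounded_plus_comp[of "f i" S "\<lambda>x. \<Sum>i\<in>I. f i x"] by simp
qed (auto simp: image_constant_conv)

lemma bounded_matrix_vector_comp:
  fixes A :: "real^'n^'m"
  assumes "bounded (f ` S)"
  shows "bounded ((\<lambda>x. A *v f x) ` S)"
  using bounded_linear_image[OF assms matrix_vector_mul_bounded_linear[of A]] by (simp add: image_image)

lemma acceleration_bounded:
  assumes "robot M C" and v: "bounded (v ` S)"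
    and r: "bounded ((\<lambda>t. M (q t) *v a t + C (q t) (v t) *v v t) ` S)"
  shows "bounded (a ` S)"
proof -
  obtain K where K: "0 < K" "\<And>q v a. norm a \<le> K * (norm (M q *v a + C q v *v v) + (norm v)\<^sup>2)"
    using acceleration_bound[OF assms(1)] by blast
  obtain R where R: "\<And>t. t \<in> S \<Longrightarrow> norm (M (q t) *v a t + C (q t) (v t) *v v t) \<le> R"
    using r unfolding bounded_iff by blast
  obtain V where V: "\<And>t. t \<in> S \<Longrightarrow> norm (v t) \<le> V"
    using v unfolding bounded_iff by blast
  have "norm (a t) \<le> K * (R + V\<^sup>2)" if t: "t \<in> S" for t
  proof -
    have "(norm (v t))\<^sup>2 \<le> V\<^sup>2" using V[OF t] by (intro power_mono) auto
    with R[OF t] have "K * (norm (M (q t) *v a t + C (q t) (v t) *v v t) + (norm (v t))\<^sup>2) \<le> K * (R + V\<^sup>2)"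
      using K(1) by (intro mult_left_mono add_mono) auto
    then show ?thesis using K(2)[of "a t" "q t" "v t"] by linarith
  qed
  then show ?thesis unfolding bounded_iff by blast
qed

lemma bounded_of_inner_le:
  assumes "\<And>t. t \<in> S \<Longrightarrow> f t \<bullet> f t \<le> b"
  shows "bounded (f ` S)"
proof -
  have "norm (f t) \<le> 1 + b" if "t \<in> S" for t
    using norm_le_one_plus_square[of "f t"] assms[OF that] by (simp add: power2_norm_eq_inner)
  then show ?thesis unfolding bounded_iff by blast
qed

lemma tendsto_zero_of_inner_le:
  fixes W :: "real \<Rightarrow> real"
  assumes "(W \<longlongrightarrow> 0) at_top" "\<And>t. a \<le> t \<Longrightarrow> f t \<bullet> f t \<le> W t / k"
  shows "(f \<longlongrightarrow> 0) at_top"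
proof -
  have Wk: "((\<lambda>t. sqrt (W t / k)) \<longlongrightarrow> 0) at_top"
    using tendsto_real_sqrt[OF tendsto_divide_zero[OF assms(1), of k]] by simp
  have "norm (f t) \<le> sqrt (W t / k)" if "a \<le> t" for t
    using assms(2)[OF that] by (intro real_le_rsqrt) (simp only: power2_norm_eq_inner)
  then have "\<forall>\<^sub>F t in at_top. norm (f t) \<le> sqrt (W t / k)"
    by (intro eventually_at_top_linorderI[of a])
  then show ?thesis using Wk by (rule Lim_null_comparison)
qed

section \<open>Bounded and integrable loads\<close>

context closed_loop
begin

lemma past_interval: "t0 \<le> t \<Longrightarrow> - hS \<le> t" "0 < hS"
  using t0 h by auto

lemma slave_le_sum:
  assumes "i \<in> {1..N}"
  shows "vs i t \<bullet> vs i t \<le> vm t \<bullet> vm t + (\<Sum>i=1..N. vs i t \<bullet> vs i t + err i t \<bullet> err i t)"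
    and "err i t \<bullet> err i t \<le> vm t \<bullet> vm t + (\<Sum>i=1..N. vs i t \<bullet> vs i t + err i t \<bullet> err i t)"
    and "vm t \<bullet> vm t \<le> vm t \<bullet> vm t + (\<Sum>i=1..N. vs i t \<bullet> vs i t + err i t \<bullet> err i t)"
proof -
  have "vs i t \<bullet> vs i t + err i t \<bullet> err i t \<le> (\<Sum>i=1..N. vs i t \<bullet> vs i t + err i t \<bullet> err i t)"
    using assms by (intro member_le_sum[of i _ "\<lambda>i. vs i t \<bullet> vs i t + err i t \<bullet> err i t"]) auto
  moreover have "0 \<le> vs i t \<bullet> vs i t" "0 \<le> err i t \<bullet> err i t" "0 \<le> vm t \<bullet> vm t" by auto
  ultimately show "vs i t \<bullet> vs i t \<le> vm t \<bullet> vm t + (\<Sum>i=1..N. vs i t \<bullet> vs i t + err i t \<bullet> err i t)"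
    "err i t \<bullet> err i t \<le> vm t \<bullet> vm t + (\<Sum>i=1..N. vs i t \<bullet> vs i t + err i t \<bullet> err i t)"
    "vm t \<bullet> vm t \<le> vm t \<bullet> vm t + (\<Sum>i=1..N. vs i t \<bullet> vs i t + err i t \<bullet> err i t)"
    by linarith+
qed

text \<open>If the dissipation is too small to beat the load, then all terms in it are small,
  including the saturated squares; these still bound the errors, and so \<open>W\<close>. Hence
  \<open>W\<close> cannot grow above a fixed level.\<close>

lemma velocities_bounded:
  assumes B: "\<And>t. t0 \<le> t \<Longrightarrow> load t \<le> B"
  shows "bounded (vm ` {t0..})" and "i \<in> {1..N} \<Longrightarrow> bounded (vs i ` {t0..})"
proof -
  have iB: "(\<lambda>_. B) integrable_on {t0..b}" for b by auto
  obtain W W' J k where k: "0 < k" and W: "primitive t0 W W'"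
    and J: "\<And>i t. i \<in> {1..N} \<Longrightarrow> t0 \<le> t \<Longrightarrow> 0 \<le> J i t"
    and lower: "\<And>t. t0 \<le> t \<Longrightarrow>
      k * (vm t \<bullet> vm t + (\<Sum>i=1..N. vs i t \<bullet> vs i t + err i t \<bullet> err i t)) \<le> W t"
    and upper: "\<And>t. t0 \<le> t \<Longrightarrow>
       W t \<le> (vm t \<bullet> vm t + (\<Sum>i=1..N. vs i t \<bullet> vs i t + err i t \<bullet> err i t + J i t)) / k"
    and W': "\<And>t. t0 \<le> t \<Longrightarrow> W' t \<le> - k * (vm t \<bullet> vm t
         + (\<Sum>i=1..N. vs i t \<bullet> vs i t + saturated_square (err i t) + J i t)) + load t / k"
    by (rule lyapunov[where B = "\<lambda>_. B", OF iB B]) (assumption, rule that)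
  \<comment> \<open>The dissipation level at which \<open>k * y\<close> equals \<open>B / k\<close>,
    the largest possible supply.\<close>
  define y where "y = B / k\<^sup>2"
  have "0 \<le> B" using B[OF order_refl] load_nonneg[of t0] by linarith
  then have y: "0 \<le> y" by (simp add: y_def)
  \<comment> \<open>The largest \<open>W\<close> compatible with dissipation at most
    \<open>y\<close>; \<open>1 + 2 * y\<close> bounds the errors.\<close>
  define K where "K = (y + real N * (y + (1 + 2 * y)\<^sup>2)) / k"
  have "W' t \<le> 0" if t: "t0 \<le> t" and big: "K < W t" for t
  proof -
    define Y where "Y = vm t \<bullet> vm t + (\<Sum>i=1..N. vs i t \<bullet> vs i t + saturated_square (err i t) + J i t)"
    have nn: "0 \<le> vs i t \<bullet> vs i t + saturated_square (err i t) + J i t" if "i \<in> {1..N}" for i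
      using J[OF that t] saturated_square_nonneg[of "err i t"] by (simp add: add_nonneg_nonneg)
    have "y < Y"
    proof (rule ccontr)
      assume "\<not> y < Y"
      then have Y: "Y \<le> y" by simp
      have "0 \<le> (\<Sum>i=1..N. vs i t \<bullet> vs i t + saturated_square (err i t) + J i t)"
        by (rule sum_nonneg[OF nn])
      then have vm: "vm t \<bullet> vm t \<le> y" using Y unfolding Y_def by linarith
      have "vs i t \<bullet> vs i t + err i t \<bullet> err i t + J i t \<le> y + (1 + 2 * y)\<^sup>2" if i: "i \<in> {1..N}" for i
      proof -
        have "vs i t \<bullet> vs i t + saturated_square (err i t) + J i t
            \<le> (\<Sum>i=1..N. vs i t \<bullet> vs i t + saturated_square (err i t) + J i t)"
          by (rule member_le_sum[OF i nn]) auto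
        then have 1: "vs i t \<bullet> vs i t + saturated_square (err i t) + J i t \<le> y"
          using Y inner_ge_zero[of "vm t"] unfolding Y_def by linarith
        then have "saturated_square (err i t) \<le> y" using J[OF i t] inner_ge_zero[of "vs i t"] by linarith
        then have "norm (err i t) \<le> 1 + 2 * y" using y by (rule norm_le_of_saturated_square)
        then have "(norm (err i t))\<^sup>2 \<le> (1 + 2 * y)\<^sup>2" by (intro power_mono) auto
        then show ?thesis
          using 1 saturated_square_nonneg[of "err i t"] by (simp add: power2_norm_eq_inner)
      qed
      then have "(\<Sum>i=1..N. vs i t \<bullet> vs i t + err i t \<bullet> err i t + J i t) \<le> real N * (y + (1 + 2 * y)\<^sup>2)"
        using sum_bounded_above[of "{1..N}" "\<lambda>i. vs i t \<bullet> vs i t + err i t \<bullet> err i t + J i t"] by simp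
      then have "W t \<le> K"
        unfolding K_def using k vm
        by (intro order_trans[OF upper[OF t]] divide_right_mono add_mono) auto
      with big show False by simp
    qed
    then have "k * y \<le> k * Y" using k by simp
    moreover have "load t / k \<le> k * y"
      using B[OF t] k by (simp add: y_def power2_eq_square divide_right_mono)
    ultimately show ?thesis using W'[OF t] unfolding Y_def by linarith
  qed
  then have WK: "W t \<le> max K (W t0)" if "t0 \<le> t" for t
    using ultimately_bounded[OF W _ that] by blast
  have b: "vm t \<bullet> vm t + (\<Sum>i=1..N. vs i t \<bullet> vs i t + err i t \<bullet> err i t) \<le> max K (W t0) / k"
    if "t0 \<le> t" for t
    using order_trans[OF lower[OF that] WK[OF that]] k by (simp add: pos_le_divide_eq mult.commute)
  have N1: "1 \<in> {1..N}" using N by simp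
  show "bounded (vm ` {t0..})"
    using order_trans[OF slave_le_sum(3)[OF N1] b] by (intro bounded_of_inner_le) auto
  show "bounded (vs i ` {t0..})" if "i \<in> {1..N}"
    using order_trans[OF slave_le_sum(1)[OF that] b] by (intro bounded_of_inner_le) auto
qed

text \<open>Two passes over the same rate. Dropping the dissipation bounds \<open>W\<close> by its
  initial value plus the total supply, hence the errors. On this bounded set the saturated square
  dominates a multiple of the square, and the rate becomes proportional to \<open>W\<close>.\<close>

lemma dissipation:
  assumes G: "primitive t0 G load" and I: "\<And>t. t0 \<le> t \<Longrightarrow> G t \<le> I"
  obtains W W' c k where "0 < c" "0 < k" "primitive t0 W W'"
    "\<And>t. t0 \<le> t \<Longrightarrow> W' t \<le> - c * W t + load t / k"
    "\<And>t. t0 \<le> t \<Longrightarrow> 0 \<le> W t" "\<And>t. t0 \<le> t \<Longrightarrow> vm t \<bullet> vm t \<le> W t / k"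
    "\<And>i t. i \<in> {1..N} \<Longrightarrow> t0 \<le> t \<Longrightarrow> vs i t \<bullet> vs i t \<le> W t / k"
    "\<And>i t. i \<in> {1..N} \<Longrightarrow> t0 \<le> t \<Longrightarrow> err i t \<bullet> err i t \<le> W t / k"
    "\<And>t. t0 \<le> t \<Longrightarrow> W t \<le> W t0 + (I - G t0) / k"
proof -
  have iB: "load integrable_on {t0..b}" for b
    using primitive_absolutely_integrable[OF G order_refl] set_lebesgue_integral_eq_integral(1) by blast
  obtain W W' J k where k: "0 < k" and W: "primitive t0 W W'"
    and J: "\<And>i t. i \<in> {1..N} \<Longrightarrow> t0 \<le> t \<Longrightarrow> 0 \<le> J i t"
    and lower: "\<And>t. t0 \<le> t \<Longrightarrow>
      k * (vm t \<bullet> vm t + (\<Sum>i=1..N. vs i t \<bullet> vs i t + err i t \<bullet> err i t)) \<le> W t"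
    and upper: "\<And>t. t0 \<le> t \<Longrightarrow>
       W t \<le> (vm t \<bullet> vm t + (\<Sum>i=1..N. vs i t \<bullet> vs i t + err i t \<bullet> err i t + J i t)) / k"
    and W': "\<And>t. t0 \<le> t \<Longrightarrow> W' t \<le> - k * (vm t \<bullet> vm t
         + (\<Sum>i=1..N. vs i t \<bullet> vs i t + saturated_square (err i t) + J i t)) + load t / k"
    by (rule lyapunov[where B = load, OF iB order_refl]) (rule that)
  have lower': "vm t \<bullet> vm t + (\<Sum>i=1..N. vs i t \<bullet> vs i t + err i t \<bullet> err i t) \<le> W t / k" if "t0 \<le> t" for t
    using lower[OF that] k by (simp add: pos_le_divide_eq mult.commute)
  have N1: "1 \<in> {1..N}" using N by simp
  have Wk: "0 \<le> W t" if "t0 \<le> t" for t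
  proof -
    have "0 \<le> vm t \<bullet> vm t + (\<Sum>i=1..N. vs i t \<bullet> vs i t + err i t \<bullet> err i t)"
      by (intro add_nonneg_nonneg sum_nonneg) auto
    then show ?thesis using k by (intro order_trans[OF _ lower[OF that]] mult_nonneg_nonneg) auto
  qed
  have err: "err i t \<bullet> err i t \<le> W t / k" if "i \<in> {1..N}" "t0 \<le> t" for i t
    using slave_le_sum(2)[OF that(1), of t] lower'[OF that(2)] by linarith
  define E where "E = W t0 + (I - G t0) / k"
  have WE: "W t \<le> E" if t: "t0 \<le> t" for t
  proof -
    have "W' x \<le> 1 / k * load x" if "t0 < x" for x
    proof -
      have "0 \<le> k * (vm x \<bullet> vm x + (\<Sum>i=1..N. vs i x \<bullet> vs i x + saturated_square (err i x) + J i x))"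
        using k J that saturated_square_nonneg
        by (intro mult_nonneg_nonneg add_nonneg_nonneg sum_nonneg) auto
      then show ?thesis using W'[of x] that by simp
    qed
    then have "W t - W t0 \<le> 1 / k * G t - 1 / k * G t0"
      using t by (intro primitive_le[OF W primitive_cmult[OF G]]) auto
    also have "\<dots> \<le> (I - G t0) / k"
      using I[OF t] k by (simp add: divide_right_mono flip: diff_divide_distrib)
    finally show ?thesis by (simp add: E_def)
  qed
  \<comment> \<open>\<open>E / k\<close> bounds the squared errors. As
    \<open>\<sigma> \<le> 1\<close>, the same factor can be applied to the other terms.\<close>
  define \<sigma> where "\<sigma> = 1 / sqrt (1 + E / k)"
  have "0 \<le> E / k" using Wk[of t0] WE[of t0] k by simp
  then have \<sigma>: "0 < \<sigma>" "\<sigma> \<le> 1" by (auto simp: \<sigma>_def divide_le_eq_1 intro!: add_pos_nonneg)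
  have "W' t \<le> - (k * \<sigma> * k) * W t + load t / k" if t: "t0 \<le> t" for t
  proof -
    have slave: "\<sigma> * (vs i t \<bullet> vs i t + err i t \<bullet> err i t + J i t)
        \<le> vs i t \<bullet> vs i t + saturated_square (err i t) + J i t" if i: "i \<in> {1..N}" for i
    proof -
      have "err i t \<bullet> err i t \<le> E / k"
        using WE[OF t] k by (intro order_trans[OF err[OF i t]] divide_right_mono) auto
      from saturated_square_ge[OF this]
      have "\<sigma> * (err i t \<bullet> err i t) \<le> saturated_square (err i t)" by (simp add: \<sigma>_def)
      moreover have "\<sigma> * (vs i t \<bullet> vs i t) \<le> 1 * (vs i t \<bullet> vs i t)" "\<sigma> * J i t \<le> 1 * J i t"
        using mult_right_mono[OF \<sigma>(2) inner_ge_zero[of "vs i t"]] mult_right_mono[OF \<sigma>(2) J[OF i t]] .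
      ultimately show ?thesis by (simp only: distrib_left)
    qed
    have vm: "\<sigma> * (vm t \<bullet> vm t) \<le> 1 * (vm t \<bullet> vm t)"
      using \<sigma> by (intro mult_right_mono) auto
    have "\<sigma> * (k * W t) \<le> \<sigma> * (vm t \<bullet> vm t + (\<Sum>i=1..N. vs i t \<bullet> vs i t + err i t \<bullet> err i t + J i t))"
      using upper[OF t] \<sigma> k by (intro mult_left_mono) (auto simp: field_simps)
    also have "\<dots> = \<sigma> * (vm t \<bullet> vm t) + (\<Sum>i=1..N. \<sigma> * (vs i t \<bullet> vs i t + err i t \<bullet> err i t + J i t))"
      by (simp only: distrib_left sum_distrib_left)
    also have "\<dots> \<le> 1 * (vm t \<bullet> vm t) + (\<Sum>i=1..N. vs i t \<bullet> vs i t + saturated_square (err i t) + J i t)"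
      by (intro add_mono sum_mono vm slave) auto
    finally have "k * (\<sigma> * (k * W t))
        \<le> k * (1 * (vm t \<bullet> vm t) + (\<Sum>i=1..N. vs i t \<bullet> vs i t + saturated_square (err i t) + J i t))"
      using k by (intro mult_left_mono) auto
    then show ?thesis using W'[OF t] by (simp add: mult.assoc)
  qed
  note diss = this
  show thesis
  \<comment> \<open>One factor \<open>k\<close> stems from the rate, the other from the upper bound
    of \<open>W\<close>.\<close>
  proof (rule that[of "k * \<sigma> * k" k W W'])
    show "0 < k * \<sigma> * k" "0 < k" "primitive t0 W W'" using k \<sigma> W by auto
    show "W' t \<le> - (k * \<sigma> * k) * W t + load t / k" if "t0 \<le> t" for t by (rule diss[OF that])
    show "vm t \<bullet> vm t \<le> W t / k" if "t0 \<le> t" for t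
      using slave_le_sum(3)[OF N1, of t] lower'[OF that] by linarith
    show "vs i t \<bullet> vs i t \<le> W t / k" if "i \<in> {1..N}" "t0 \<le> t" for i t
      using slave_le_sum(1)[OF that(1), of t] lower'[OF that(2)] by linarith
    show "W t \<le> W t0 + (I - G t0) / k" if "t0 \<le> t" for t using WE[OF that] by (simp add: E_def)
  qed (rule Wk err; assumption)+
qed

lemma bounded_past:
  fixes x :: "real \<Rightarrow> real^'n"
  assumes "continuous_on {- hS..} x" "bounded (x ` {t0..})"
  shows "bounded (x ` {- hS..})"
proof -
  obtain K where "\<And>t. t \<in> {- hS..t0} \<Longrightarrow> norm (x t) \<le> K" using bounded_on_past[OF assms(1)] by blast
  then have "bounded (x ` {- hS..t0})" unfolding bounded_iff by blast
  moreover have "{- hS..} = {- hS..t0} \<union> {t0..}"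
    using past_interval(1)[OF order_refl] by auto
  ultimately show ?thesis using assms(2) by (simp add: image_Un)
qed

text \<open>Windows starting before \<open>t0\<close> see the initial past as well; there the
  velocity is bounded by compactness.\<close>

lemma delayed_difference_bounded:
  fixes q :: "real \<Rightarrow> real^'n"
  assumes q: "\<And>t. - hS \<le> t \<Longrightarrow> (q has_vector_derivative v t) (at t within {- hS..})"
    and v: "continuous_on {- hS..} v" "bounded (v ` {t0..})"
    and d: "\<And>t. t0 \<le> t \<Longrightarrow> 0 \<le> d t \<and> d t \<le> hS"
  shows "bounded ((\<lambda>t. q t - q (t - d t)) ` {t0..})"
proof -
  obtain V where V: "\<And>t. - hS \<le> t \<Longrightarrow> norm (v t) \<le> V"
    using bounded_past[OF v] unfolding bounded_iff by (auto simp: image_iff)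
  have "0 \<le> V" by (rule order_trans[OF norm_ge_zero V[of t0]]) (rule past_interval(1)[OF order_refl])
  have "norm (q t - q (t - d t)) \<le> hS * V" if t: "t0 \<le> t" for t
  proof -
    have "norm (q t - q (t - d t)) \<le> d t * V"
    proof (rule norm_increment_le[OF q])
      show "((\<lambda>_. V) has_integral d t * V) {t - d t..t}"
        using has_integral_const_real[of V "t - d t" t] d[OF t] by simp
    qed (use d[OF t] t t0 V in auto)
    also have "\<dots> \<le> hS * V" using d[OF t] \<open>0 \<le> V\<close> by (intro mult_right_mono) auto
    finally show ?thesis .
  qed
  then show ?thesis unfolding bounded_iff by auto
qed

end

lemma primitive_integral:
  fixes f :: "real \<Rightarrow> real"
  assumes "\<And>b. f integrable_on {a..b}" "\<And>t. a \<le> t \<Longrightarrow> 0 \<le> f t"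
  shows "primitive a (\<lambda>t. integral {a..t} f) f"
  unfolding primitive_def
  using assms by (auto intro!: nonnegative_absolutely_integrable_1 integrable_integral)

lemma bounded_of_exponential_rate:
  fixes q :: "real \<Rightarrow> real^'n"
  assumes q: "\<And>t. b \<le> t \<Longrightarrow> (q has_vector_derivative v t) (at t within {b..})" and ba: "b \<le> a"
    and c: "0 < c" and v: "\<And>t. a \<le> t \<Longrightarrow> v t \<bullet> v t \<le> A * exp (- c * (t - a))"
  shows "bounded (q ` {a..})"
proof -
  \<comment> \<open>The squared speed decays at rate \<open>c\<close>, the speed itself at half that
    rate; its integral is at most \<open>D / d\<close>.\<close>
  define d where "d = c / 2"
  define D where "D = sqrt A"
  have "0 \<le> A" using order_trans[OF inner_ge_zero v[OF order_refl]] by simp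
  then have D: "0 \<le> D" "D\<^sup>2 = A" by (auto simp: D_def)
  have d: "0 < d" using c by (simp add: d_def)
  have nv: "norm (v t) \<le> D * exp (- d * (t - a))" if "a \<le> t" for t
  proof (rule power2_le_imp_le)
    have "(exp (- d * (t - a)))\<^sup>2 = exp (- c * (t - a))"
      by (simp add: d_def power2_eq_square flip: exp_add)
    then show "(norm (v t))\<^sup>2 \<le> (D * exp (- d * (t - a)))\<^sup>2"
      using v[OF that] by (simp only: power_mult_distrib D power2_norm_eq_inner)
  qed (use D in auto)
  have "norm (q t) \<le> norm (q a) + D / d" if t: "a \<le> t" for t
  proof -
    have I: "((\<lambda>x. D * exp (- d * (x - a))) has_integral - (D / d) * exp (- d * (t - a)) - - (D / d) * exp (- d * (a - a))) {a..t}"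
      using d by (intro fundamental_theorem_of_calculus[OF t])
        (auto intro!: derivative_eq_intros simp flip: has_real_derivative_iff_has_vector_derivative)
    have "norm (q t - q a) \<le> - (D / d) * exp (- d * (t - a)) - - (D / d) * exp (- d * (a - a))"
      by (rule norm_increment_le[OF q ba t I]) (use nv in auto)
    also have "\<dots> \<le> D / d" using D d by simp
    finally show ?thesis using norm_triangle_sub[of "q t" "q a"] by linarith
  qed
  then show ?thesis unfolding bounded_iff by blast
qed

lemma bounded_image_cong:
  assumes "bounded (f ` S)" "\<And>t. t \<in> S \<Longrightarrow> f t = g t"
  shows "bounded (g ` S)"
  using assms image_cong[OF refl, of S f g] by simp

lemma coordination_of_limits:
  assumes "1 \<le> N" and form: "formation N \<gamma>" and vm: "(vm \<longlongrightarrow> 0) at_top"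
    and vs: "\<And>i. i \<in> {1..N} \<Longrightarrow> (vs i \<longlongrightarrow> 0) at_top"
    and e: "\<And>i. i \<in> {1..N} \<Longrightarrow> ((\<lambda>t. qm t - (qs i t - \<gamma> i)) \<longlongrightarrow> 0) at_top"
  shows "coordination N \<gamma> qm vm qs vs"
proof -
  have "((\<lambda>t. (1 / real N) *\<^sub>R (\<Sum>i=1..N. qm t - (qs i t - \<gamma> i))) \<longlongrightarrow> (1 / real N) *\<^sub>R (\<Sum>i=1..N. 0)) at_top"
    by (intro tendsto_intros e)
  moreover have "(1 / real N) *\<^sub>R (\<Sum>i=1..N. qm t - (qs i t - \<gamma> i)) = qm t - (1 / real N) *\<^sub>R (\<Sum>i=1..N. qs i t)" for t
  proof -
    \<comment> \<open>The offsets sum to zero, so the mean error is the distance to the mean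
      position of the slaves.\<close>
    have "(\<Sum>i=1..N. qm t - (qs i t - \<gamma> i)) = real N *\<^sub>R qm t - (\<Sum>i=1..N. qs i t)"
      using form by (simp add: sum_subtractf formation_def sum_constant_scaleR del: sum_constant)
    then show ?thesis using assms(1) by (simp add: scaleR_diff_right)
  qed
  moreover have "((\<lambda>t. qs i t - (qm t + \<gamma> i)) \<longlongrightarrow> 0) at_top" if "i \<in> {1..N}" for i
    using tendsto_minus[OF e[OF that]] by (simp add: algebra_simps)
  ultimately show ?thesis unfolding coordination_def using vm vs e by auto
qed

section \<open>Boundedness of the signals, convergence and force tracking\<close>

context closed_loop
begin

lemma motion_derivatives:
  "- hS \<le> t \<Longrightarrow> (qm has_vector_derivative vm t) (at t within {- hS..})"
  "i \<in> {1..N} \<Longrightarrow> - hS \<le> t \<Longrightarrow> (qs i has_vector_derivative vs i t) (at t within {- hS..})"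
  using motion_m motion_s[of i] by (auto simp: motion_def)

lemma delayed_differences_bounded:
  assumes "bounded (vm ` {t0..})" "\<And>i. i \<in> {1..N} \<Longrightarrow> bounded (vs i ` {t0..})"
  shows "bounded ((\<lambda>t. qm t - qm (t - dm t)) ` {t0..})"
    and "i \<in> {1..N} \<Longrightarrow> bounded ((\<lambda>t. qs i t - qs i (t - ds i t)) ` {t0..})"
proof -
  have "0 \<le> dm t \<and> dm t \<le> hS" if "t0 \<le> t" for t using dm[OF that] h by simp
  with assms show "bounded ((\<lambda>t. qm t - qm (t - dm t)) ` {t0..})"
    by (intro delayed_difference_bounded[OF motion_derivatives(1) continuous_signals(2)])
  show "bounded ((\<lambda>t. qs i t - qs i (t - ds i t)) ` {t0..})" if i: "i \<in> {1..N}"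
    by (rule delayed_difference_bounded[OF motion_derivatives(2)[OF i] continuous_signals(4)[OF i] assms(2)[OF i] ds[OF i]])
qed

lemma loop_signals_bounded:
  assumes vm: "bounded (vm ` {t0..})" and vs: "\<And>i. i \<in> {1..N} \<Longrightarrow> bounded (vs i ` {t0..})"
    and e: "\<And>i. i \<in> {1..N} \<Longrightarrow> bounded (err i ` {t0..})"
  shows "loop_signals_bounded N t0 \<gamma> dm ds qm vm qs vs"
proof -
  note diff = delayed_differences_bounded[OF vm vs]
  have const: "bounded ((\<lambda>t. \<gamma> i) ` {t0..})" for i by (simp add: image_constant_conv)
  have "bounded ((\<lambda>t. qm t - qs i (t - ds i t)) ` {t0..})"
    "bounded ((\<lambda>t. (qs i t - \<gamma> i) - qm (t - dm t)) ` {t0..})" if i: "i \<in> {1..N}" for i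
  proof -
    have "bounded ((\<lambda>t. err i t + (qs i t - qs i (t - ds i t)) - \<gamma> i) ` {t0..})"
      by (intro bounded_minus_comp bounded_plus_comp e diff const i)
    then show "bounded ((\<lambda>t. qm t - qs i (t - ds i t)) ` {t0..})" by (simp add: err_def)
    have "bounded ((\<lambda>t. (qm t - qm (t - dm t)) - err i t) ` {t0..})"
      by (intro bounded_minus_comp e diff i)
    then show "bounded ((\<lambda>t. (qs i t - \<gamma> i) - qm (t - dm t)) ` {t0..})"
      by (simp add: err_def algebra_simps)
  qed
  then show ?thesis
    unfolding loop_signals_bounded_def using vm vs e unfolding err_def by blast
qed

text \<open>Free motion is the case of a constant \<open>G\<close>; square integrable forces give a
  bounded \<open>G\<close>.\<close>

lemma integrable_load_stability:
  assumes form: "formation N \<gamma>" and G: "primitive t0 G load" and I: "\<And>t. t0 \<le> t \<Longrightarrow> G t \<le> I"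
  shows "loop_signals_bounded N t0 \<gamma> dm ds qm vm qs vs" and "coordination N \<gamma> qm vm qs vs"
proof -
  obtain W W' c k where c: "0 < c" and k: "0 < k" and W: "primitive t0 W W'"
    and W': "\<And>t. t0 \<le> t \<Longrightarrow> W' t \<le> - c * W t + load t / k"
    and W0: "\<And>t. t0 \<le> t \<Longrightarrow> 0 \<le> W t" and vm: "\<And>t. t0 \<le> t \<Longrightarrow> vm t \<bullet> vm t \<le> W t / k"
    and vs: "\<And>i t. i \<in> {1..N} \<Longrightarrow> t0 \<le> t \<Longrightarrow> vs i t \<bullet> vs i t \<le> W t / k"
    and err: "\<And>i t. i \<in> {1..N} \<Longrightarrow> t0 \<le> t \<Longrightarrow> err i t \<bullet> err i t \<le> W t / k"
    and Wb: "\<And>t. t0 \<le> t \<Longrightarrow> W t \<le> W t0 + (I - G t0) / k"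
    by (rule dissipation[OF G I]) (assumption, rule that)
  define b where "b = (W t0 + (I - G t0) / k) / k"
  have Wk: "W t / k \<le> b" if "t0 \<le> t" for t
    unfolding b_def using Wb[OF that] k by (intro divide_right_mono) auto
  show "loop_signals_bounded N t0 \<gamma> dm ds qm vm qs vs"
  proof (rule loop_signals_bounded)
    show "bounded (vm ` {t0..})"
      using order_trans[OF vm Wk] by (intro bounded_of_inner_le) auto
    show "bounded (vs i ` {t0..})" if "i \<in> {1..N}" for i
      using order_trans[OF vs[OF that] Wk] by (intro bounded_of_inner_le) auto
    show "bounded (err i ` {t0..})" if "i \<in> {1..N}" for i
      using order_trans[OF err[OF that] Wk] by (intro bounded_of_inner_le) auto
  qed
  have Wlim: "(W \<longlongrightarrow> 0) at_top"
  proof (rule tendsto_zero_of_dissipation[OF W _ c W0])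
    show "W' t \<le> - c * W t + 1 / k * load t" if "t0 \<le> t" for t using W'[OF that] by simp
    show "primitive t0 (\<lambda>t. 1 / k * G t) (\<lambda>t. 1 / k * load t)" by (rule primitive_cmult[OF G])
    show "0 \<le> 1 / k * load t" for t using k load_nonneg[of t] by simp
    show "1 / k * G t \<le> 1 / k * I" if "t0 \<le> t" for t
      using I[OF that] k by (intro mult_left_mono) auto
  qed
  show "coordination N \<gamma> qm vm qs vs"
    using form N tendsto_zero_of_inner_le[OF Wlim vm] tendsto_zero_of_inner_le[OF Wlim vs]
      tendsto_zero_of_inner_le[OF Wlim err]
    by (intro coordination_of_limits) (auto simp: err_def)
qed

text \<open>Exponential decay makes the speed of the master integrable, which bounds its position;
  the slaves follow through the bounded errors. The equations of motion then bound the
  accelerations.\<close>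

lemma free_motion:
  assumes form: "formation N \<gamma>" and free: "\<And>t. t0 \<le> t \<Longrightarrow> load t = 0"
  shows "loop_signals_bounded N t0 \<gamma> dm ds qm vm qs vs" "coordination N \<gamma> qm vm qs vs"
    "bounded (qm ` {t0..})" "bounded (am ` {t0..})"
    "i \<in> {1..N} \<Longrightarrow> bounded (qs i ` {t0..})" "i \<in> {1..N} \<Longrightarrow> bounded (as i ` {t0..})"
proof -
  have G: "primitive t0 (\<lambda>_. 0) load"
    by (rule primitive_cong[OF primitive_const[of t0 0]]) (simp_all add: free)
  show loop: "loop_signals_bounded N t0 \<gamma> dm ds qm vm qs vs" and "coordination N \<gamma> qm vm qs vs"
    using integrable_load_stability[OF form G order_refl] by auto
  obtain W W' c k where c: "0 < c" and k: "0 < k" and W: "primitive t0 W W'"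
    and W': "\<And>t. t0 \<le> t \<Longrightarrow> W' t \<le> - c * W t + load t / k"
    and "\<And>t. t0 \<le> t \<Longrightarrow> 0 \<le> W t" and vm: "\<And>t. t0 \<le> t \<Longrightarrow> vm t \<bullet> vm t \<le> W t / k"
    and "\<And>i t. i \<in> {1..N} \<Longrightarrow> t0 \<le> t \<Longrightarrow> vs i t \<bullet> vs i t \<le> W t / k"
    and "\<And>i t. i \<in> {1..N} \<Longrightarrow> t0 \<le> t \<Longrightarrow> err i t \<bullet> err i t \<le> W t / k"
    and "\<And>t. t0 \<le> t \<Longrightarrow> W t \<le> W t0 + (0 - 0) / k"
    by (rule dissipation[OF G order_refl]) (rule that)
  have decay: "W t \<le> W t0 * exp (- c * (t - t0))" if "t0 \<le> t" for t
    by (rule exponential_decay[OF W _ that]) (use W' free in force)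
  have rate: "vm t \<bullet> vm t \<le> W t0 / k * exp (- c * (t - t0))" if "t0 \<le> t" for t
    using order_trans[OF vm[OF that] divide_right_mono[OF decay[OF that]]] k by simp
  show qmb: "bounded (qm ` {t0..})"
    by (rule bounded_of_exponential_rate[OF motion_derivatives(1) past_interval(1)[OF order_refl] c rate])
  have vmb: "bounded (vm ` {t0..})" and vsb: "\<And>i. i \<in> {1..N} \<Longrightarrow> bounded (vs i ` {t0..})"
    and eb: "\<And>i. i \<in> {1..N} \<Longrightarrow> bounded (err i ` {t0..})"
    using loop by (auto simp: loop_signals_bounded_def err_def)
  note diff = delayed_differences_bounded[OF vmb vsb]
  have const: "bounded ((\<lambda>t. \<gamma> i) ` {t0..})" for i by (simp add: image_constant_conv)
  have loads: "master_load t = 0" "i \<in> {1..N} \<Longrightarrow> fs i t = 0" if "t0 \<le> t" for t i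
    using load_bounds(1)[of t] load_bounds(2)[of i t] free[OF that] by (metis inner_ge_zero inner_eq_zero_iff order_antisym)+
  show "bounded (am ` {t0..})"
  proof (rule acceleration_bounded[OF robot_m vmb])
    have "bounded ((\<lambda>t. (1 / real N) *\<^sub>R (0 - (\<Sum>i=1..N. Kp i *v (err i t + (qs i t - qs i (t - ds i t)))
        + Kd i *v vm t))) ` {t0..})"
      by (intro bounded_scaleR_comp bounded_minus_comp bounded_sum_comp bounded_plus_comp
          bounded_matrix_vector_comp eb diff vmb) (simp_all add: image_constant_conv)
    moreover have "(1 / real N) *\<^sub>R (0 - (\<Sum>i=1..N. Kp i *v (err i t + (qs i t - qs i (t - ds i t)))
        + Kd i *v vm t)) = Mm (qm t) *v am t + Cm (qm t) (vm t) *v vm t" if "t0 \<le> t" for t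
      using arg_cong[OF master_balance[OF that], of "\<lambda>x. (1 / real N) *\<^sub>R x"] N loads(1)[OF that] by simp
    ultimately show "bounded ((\<lambda>t. Mm (qm t) *v am t + Cm (qm t) (vm t) *v vm t) ` {t0..})"
      by (rule bounded_image_cong) simp
  qed
  assume i: "i \<in> {1..N}"
  have "bounded ((\<lambda>t. qm t - err i t + \<gamma> i) ` {t0..})"
    by (intro bounded_plus_comp bounded_minus_comp qmb eb const i)
  then show "bounded (qs i ` {t0..})" by (simp add: err_def)
  show "bounded (as i ` {t0..})"
  proof (rule acceleration_bounded[OF robot_s[OF i] vsb[OF i]])
    have "bounded ((\<lambda>t. Kp i *v (err i t - (qm t - qm (t - dm t))) - Kd i *v vs i t) ` {t0..})"
      by (intro bounded_minus_comp bounded_matrix_vector_comp eb diff vsb i)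
    moreover have "Kp i *v (err i t - (qm t - qm (t - dm t))) - Kd i *v vs i t
        = Ms i (qs i t) *v as i t + Cs i (qs i t) (vs i t) *v vs i t" if "t0 \<le> t" for t
      using slave_balance[OF i that] loads(2)[OF that i] by simp
    ultimately show "bounded ((\<lambda>t. Ms i (qs i t) *v as i t + Cs i (qs i t) (vs i t) *v vs i t) ` {t0..})"
      by (rule bounded_image_cong) simp
  qed
qed

text \<open>Rest throughout a window of length \<open>hS\<close> makes every delayed position equal
  to the current one. All forces are then spring forces, and those of master and slaves differ in
  sign up to the sum of \<open>Kp i *v \<gamma> i\<close>.\<close>

lemma force_tracking:
  assumes balanced: "(\<Sum>i=1..N. Kp i *v \<gamma> i) = 0" and t: "t0 \<le> t"
    and vm: "\<And>\<tau>. \<tau> \<in> {t - hS..t} \<Longrightarrow> vm \<tau> = 0"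
    and vs: "\<And>i \<tau>. i \<in> {1..N} \<Longrightarrow> \<tau> \<in> {t - hS..t} \<Longrightarrow> vs i \<tau> = 0"
    and am: "am t = 0" and as: "\<And>i. i \<in> {1..N} \<Longrightarrow> as i t = 0"
  shows "fm t = - ((1 / real N) *\<^sub>R (\<Sum>i=1..N. fs i t))"
proof -
  have same: "q (t - d) = q t"
    if "\<And>t. - hS \<le> t \<Longrightarrow> (q has_vector_derivative v t) (at t within {- hS..})"
      "\<And>\<tau>. \<tau> \<in> {t - hS..t} \<Longrightarrow> v \<tau> = 0" "0 \<le> d" "d \<le> hS" for q v :: "real \<Rightarrow> real^'n" and d
  proof -
    have "norm (q t - q (t - d)) \<le> 0"
    proof (rule norm_increment_le[OF that(1)])
      show "((\<lambda>_. 0) has_integral (0::real)) {t - d..t}" by simp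
    qed (use that t t0 in auto)
    then show ?thesis by simp
  qed
  have here: "vm t = 0" "i \<in> {1..N} \<Longrightarrow> vs i t = 0" for i using vm vs past_interval(2) by auto
  have qm: "qm (t - dm t) = qm t"
    by (rule same[OF motion_derivatives(1) vm]) (use dm[OF t] h in auto)
  have qs: "qs i (t - ds i t) = qs i t" if "i \<in> {1..N}" for i
    by (rule same[OF motion_derivatives(2)[OF that] vs[OF that]]) (use ds[OF that t] in auto)
  have "fs i t = Kp i *v (- err i t)" if "i \<in> {1..N}" for i
    unfolding slaves[OF that t] by (simp add: here(2)[OF that] as[OF that] qm err_def)
  then have "(\<Sum>i=1..N. fs i t) = (\<Sum>i=1..N. Kp i *v (- err i t))" by simp
  also have "\<dots> = - (\<Sum>i=1..N. Kp i *v (qm t - qs i t)) - (\<Sum>i=1..N. Kp i *v \<gamma> i)"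
    by (simp add: err_def matrix_vector_mult_diff_distrib algebra_simps
        flip: sum_negf sum_subtractf)
  finally have "(\<Sum>i=1..N. fs i t) = - (\<Sum>i=1..N. Kp i *v (qm t - qs i t))" unfolding balanced by simp
  moreover have "fm t = (1 / real N) *\<^sub>R (\<Sum>i=1..N. Kp i *v (qm t - qs i t))"
    unfolding master[OF t] by (simp add: here am qs)
  ultimately show ?thesis by simp
qed

end

section \<open>From forces and sampling to the closed loop\<close>

lemma signal_L2_integrable:
  assumes "signal_L2 f" "0 \<le> a"
  shows "(\<lambda>t. f t \<bullet> f t) absolutely_integrable_on {a..}"
proof -
  have "set_integrable lebesgue {0..} (\<lambda>t. (norm (f t))\<^sup>2)"
    using assms by (simp add: signal_L2_def integrable_restrict_space set_integrable_def)
  then have "set_integrable lebesgue {a..} (\<lambda>t. (norm (f t))\<^sup>2)"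
    by (rule set_integrable_subset) (use assms(2) in auto)
  then show ?thesis by (simp only: power2_norm_eq_inner)
qed

text \<open>Take the least update instant beyond \<open>t\<close>; it exists because the sampling
  instants diverge and transmission times are nonnegative. Its predecessor opens the
  interval.\<close>

lemma update_interval_exists:
  assumes S: "sampling MATI MAD s T" and t: "s n + T n \<le> t"
  obtains k where "n \<le> k" "t \<in> {s k + T k..<s (Suc k) + T (Suc k)}"
proof -
  have "\<forall>\<^sub>F m in sequentially. t + 1 \<le> s m"
    using S by (auto simp: sampling_def filterlim_at_top)
  then obtain m where m: "t < s m" by (auto simp: eventually_sequentially intro: less_le_trans[OF less_add_one])
  define P where "P = (\<lambda>m. t < s m + T m)"
  have "0 \<le> T m" using S by (simp add: sampling_def)
  then have "P m" using m by (simp add: P_def)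
  define l where "l = (LEAST m. P m)"
  have l: "P l" "\<And>j. j < l \<Longrightarrow> \<not> P j" unfolding l_def using \<open>P m\<close> by (auto intro: LeastI dest: not_less_Least)
  have sm: "strict_mono (\<lambda>k. s k + T k)" using S by (auto simp: sampling_def strict_mono_Suc_iff)
  have "n < l"
  proof (rule ccontr)
    assume "\<not> n < l"
    then have "s l + T l \<le> s n + T n" using strict_mono_less_eq[OF sm, of l n] by simp
    then show False using l(1) t by (simp add: P_def)
  qed
  then have "n \<le> l - 1" "Suc (l - 1) = l" by auto
  moreover have "\<not> P (l - 1)" using l(2)[of "l - 1"] \<open>n < l\<close> by simp
  ultimately show thesis using that[of "l - 1"] l(1) by (simp add: P_def)
qed

theorem theorem5:
  fixes N :: nat
    and Mm :: "real^'n \<Rightarrow> real^'n^'n" and Cm :: "real^'n \<Rightarrow> real^'n \<Rightarrow> real^'n^'n"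
    and Ms :: "nat \<Rightarrow> real^'n \<Rightarrow> real^'n^'n" and Cs :: "nat \<Rightarrow> real^'n \<Rightarrow> real^'n \<Rightarrow> real^'n^'n"
    and Kp Kd :: "nat \<Rightarrow> real^'n^'n" and \<gamma> :: "nat \<Rightarrow> real^'n"
    and MATI MAD hM hS t0 :: real and s T :: "nat \<Rightarrow> real"
    and istar :: "nat \<Rightarrow> nat" and qhat :: "nat \<Rightarrow> nat \<Rightarrow> real^'n"
    and dm :: "real \<Rightarrow> real" and ds :: "nat \<Rightarrow> real \<Rightarrow> real"
    and \<phi> :: "nat \<Rightarrow> real \<Rightarrow> (real^'n) \<times> (real^'n)"
    and qm vm am fm :: "real \<Rightarrow> real^'n" and qs vs as fs :: "nat \<Rightarrow> real \<Rightarrow> real^'n"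
    and Rm :: "real^'n^'n" and Rs :: "nat \<Rightarrow> real^'n^'n"
  assumes "N \<ge> 2"
    and "robot Mm Cm" and "\<forall>i\<in>{1..N}. robot (Ms i) (Cs i)"
    and "formation N \<gamma>"
    and "\<forall>i\<in>{1..N}. pos_def (Kp i) \<and> pos_def (Kd i)"
    and "sampling MATI MAD s T"
    and "hM = MATI + MAD" and "hS = real N * MATI + MAD"
    and "t0 = s (N - 1) + T (N - 1)"
    and "rr_protocol N istar"
    and "received_positions N s istar qs qhat"
    and "network_delays N s T qs qhat dm ds"
    and "motion hS t0 qm vm am" and "\<forall>i\<in>{1..N}. motion hS t0 (qs i) (vs i) (as i)"
    and "initial_condition N hS \<gamma> \<phi> qm vm qs vs"
    and master: "\<forall>t\<ge>t0. fm t = Mm (qm t) *v am t + Cm (qm t) (vm t) *v vm t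
           + (1 / real N) *\<^sub>R (\<Sum>i=1..N. Kp i *v (qm t - qs i (t - ds i t)) + Kd i *v vm t)"
    and slaves: "\<forall>i\<in>{1..N}. \<forall>t\<ge>t0. fs i t = Ms i (qs i t) *v as i t + Cs i (qs i t) (vs i t) *v vs i t
           + Kd i *v vs i t + Kp i *v ((qs i t - \<gamma> i) - qm (t - dm t))"
    and "pos_def Rm" and "\<forall>i\<in>{1..N}. pos_def (Rs i)"
    and lmi: "\<forall>i\<in>{1..N}. neg_def (lmi_matrix hM hS (Kp i) (Kd i) Rm (Rs i))"
  shows
    "(balanced_gains N Kp \<gamma> \<and> (\<forall>t\<ge>0. fm t = 0 \<and> (\<forall>i\<in>{1..N}. fs i t = 0)) \<longrightarrow>
        loop_signals_bounded N t0 \<gamma> dm ds qm vm qs vs \<and>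
        bounded (qm ` {t0..}) \<and> bounded (am ` {t0..}) \<and>
        (\<forall>i\<in>{1..N}. bounded (qs i ` {t0..}) \<and> bounded (as i ` {t0..})) \<and>
        coordination N \<gamma> qm vm qs vs) \<and>
     (signal_Linf fm \<and> (\<forall>i\<in>{1..N}. signal_Linf (fs i)) \<longrightarrow>
        bounded (vm ` {t0..}) \<and> (\<forall>i\<in>{1..N}. bounded (vs i ` {t0..}))) \<and>
     (balanced_gains N Kp \<gamma> \<and> signal_L2 fm \<and> (\<forall>i\<in>{1..N}. signal_L2 (fs i)) \<longrightarrow>
        loop_signals_bounded N t0 \<gamma> dm ds qm vm qs vs \<and>
        coordination N \<gamma> qm vm qs vs) \<and>
     (balanced_gains N Kp \<gamma> \<longrightarrow>
        (\<forall>t\<ge>t0. (\<forall>\<tau>\<in>{t - hS..t}. vm \<tau> = 0 \<and> (\<forall>i\<in>{1..N}. vs i \<tau> = 0)) \<and>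
                am t = 0 \<and> (\<forall>i\<in>{1..N}. as i t = 0) \<longrightarrow>
                fm t = - ((1 / real N) *\<^sub>R (\<Sum>i=1..N. fs i t))))"
proof -
  note S = \<open>sampling MATI MAD s T\<close> and D = \<open>network_delays N s T qs qhat dm ds\<close>
  have N1: "1 \<le> N" using \<open>N \<ge> 2\<close> by simp
  have pos: "0 < MATI" "0 < MAD" "s 0 = 0" "strict_mono s" "\<And>k. 0 \<le> T k"
    using S by (auto simp: sampling_def)
  \<comment> \<open>At least two slaves are needed for \<open>N - 1\<close> to be positive; this
    makes \<open>t0\<close> strictly positive.\<close>
  have "s 0 < s (N - 1)" using strict_monoD[OF pos(4), of 0 "N - 1"] \<open>N \<ge> 2\<close> by simp
  then have t0: "0 < t0" using pos(3) pos(5)[of "N - 1"] \<open>t0 = _\<close> by simp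
  have delays: "0 \<le> dm t \<and> dm t \<le> hM" "i \<in> {1..N} \<Longrightarrow> 0 \<le> ds i t \<and> ds i t \<le> hS" if t: "t0 \<le> t" for t i
  proof -
    obtain k where k: "N - 1 \<le> k" "t \<in> {s k + T k..<s (Suc k) + T (Suc k)}"
      by (rule update_interval_exists[OF S, of "N - 1" t]) (use t \<open>t0 = _\<close> in simp, rule that)
    show "0 \<le> dm t \<and> dm t \<le> hM"
      using network_delays_bounds(1)[OF S D N1 k] \<open>hM = _\<close> by simp
    show "0 \<le> ds i t \<and> ds i t \<le> hS" if "i \<in> {1..N}"
      using network_delays_bounds(2)[OF S D N1 k that] \<open>hS = _\<close> by simp
  qed
  have h: "0 < hM" "hM \<le> hS"
    using pos N1 \<open>hM = _\<close> \<open>hS = _\<close> by (auto simp: mult_le_cancel_right1)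
  interpret closed_loop N Mm Cm Ms Cs Kp Kd \<gamma> hM hS t0 dm ds qm vm am fm qs vs as fs Rm Rs
  proof (rule closed_loop.intro)
    show "1 \<le> N" "robot Mm Cm" "0 < hM" "hM \<le> hS" "0 < t0" "motion hS t0 qm vm am" "pos_def Rm"
      by fact+
    show "fm t = Mm (qm t) *v am t + Cm (qm t) (vm t) *v vm t
           + (1 / real N) *\<^sub>R (\<Sum>i=1..N. Kp i *v (qm t - qs i (t - ds i t)) + Kd i *v vm t)" if "t0 \<le> t" for t
      using master[rule_format, OF that] .
    fix i assume i: "i \<in> {1..N}"
    show "robot (Ms i) (Cs i)" "pos_def (Kp i)" "motion hS t0 (qs i) (vs i) (as i)" "pos_def (Rs i)"
      using assms(3,5,14,19) i by blast+
    show "neg_def (lmi_matrix hM hS (Kp i) (Kd i) Rm (Rs i))" by (rule lmi[rule_format, OF i])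
    show "fs i t = Ms i (qs i t) *v as i t + Cs i (qs i t) (vs i t) *v vs i t
           + Kd i *v vs i t + Kp i *v ((qs i t - \<gamma> i) - qm (t - dm t))" if "t0 \<le> t" for t
      using slaves[rule_format, OF i that] .
  qed (rule delays; assumption)+
  have claim1: "loop_signals_bounded N t0 \<gamma> dm ds qm vm qs vs \<and>
        bounded (qm ` {t0..}) \<and> bounded (am ` {t0..}) \<and>
        (\<forall>i\<in>{1..N}. bounded (qs i ` {t0..}) \<and> bounded (as i ` {t0..})) \<and>
        coordination N \<gamma> qm vm qs vs"
    if "balanced_gains N Kp \<gamma>" "\<forall>t\<ge>0. fm t = 0 \<and> (\<forall>i\<in>{1..N}. fs i t = 0)"
  proof -
    have "load t = 0" if "t0 \<le> t" for t
      using that t0 \<open>balanced_gains N Kp \<gamma>\<close> \<open>\<forall>t\<ge>0. _ t\<close>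
      by (simp add: load_def master_load_def balanced_gains_def)
    from free_motion[OF \<open>formation N \<gamma>\<close> this] show ?thesis by blast
  qed
  have claim2: "bounded (vm ` {t0..}) \<and> (\<forall>i\<in>{1..N}. bounded (vs i ` {t0..}))"
    if f: "signal_Linf fm" "\<forall>i\<in>{1..N}. signal_Linf (fs i)"
  proof -
    have bdd: "\<exists>b. \<forall>t\<ge>t0. norm (f t) \<le> b" if "signal_Linf f" for f :: "real \<Rightarrow> real^'n"
      using that t0 unfolding signal_Linf_def bounded_iff by force
    obtain bm where bm: "\<And>t. t0 \<le> t \<Longrightarrow> norm (fm t) \<le> bm" using bdd f(1) by blast
    have "\<forall>i\<in>{1..N}. \<exists>b. \<forall>t\<ge>t0. norm (fs i t) \<le> b" using bdd f(2) by blast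
    then obtain bs where bs: "\<And>i t. i \<in> {1..N} \<Longrightarrow> t0 \<le> t \<Longrightarrow> norm (fs i t) \<le> bs i" by metis
    \<comment> \<open>The offset of the gains only adds a constant to the bound.\<close>
    have "load t \<le> (real N * bm + norm (\<Sum>i=1..N. Kp i *v \<gamma> i))\<^sup>2 + (\<Sum>i=1..N. (bs i)\<^sup>2)" if t: "t0 \<le> t" for t
    proof -
      have "norm (real N *\<^sub>R fm t) \<le> real N * bm" using bm[OF t] by (simp add: mult_left_mono)
      then have "norm (master_load t) \<le> real N * bm + norm (\<Sum>i=1..N. Kp i *v \<gamma> i)"
        unfolding master_load_def by (rule norm_triangle_mono) simp
      then have "(norm (master_load t))\<^sup>2 \<le> (real N * bm + norm (\<Sum>i=1..N. Kp i *v \<gamma> i))\<^sup>2"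
        by (intro power_mono) auto
      moreover have "(\<Sum>i=1..N. (norm (fs i t))\<^sup>2) \<le> (\<Sum>i=1..N. (bs i)\<^sup>2)"
        using bs t by (intro sum_mono power_mono) auto
      ultimately show ?thesis by (simp add: load_def power2_norm_eq_inner)
    qed
    from velocities_bounded[OF this] show ?thesis by blast
  qed
  have claim3: "loop_signals_bounded N t0 \<gamma> dm ds qm vm qs vs \<and> coordination N \<gamma> qm vm qs vs"
    if b: "balanced_gains N Kp \<gamma>" and f: "signal_L2 fm" "\<forall>i\<in>{1..N}. signal_L2 (fs i)"
  proof -
    have "(\<lambda>t. (real N)\<^sup>2 *\<^sub>R (fm t \<bullet> fm t) + (\<Sum>i=1..N. fs i t \<bullet> fs i t)) absolutely_integrable_on {t0..}"
      using f t0 by (intro set_integral_add absolutely_integrable_sum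
          absolutely_integrable_scaleR_left signal_L2_integrable) auto
    \<comment> \<open>Here balance is essential: a nonzero constant offset would not be square
      integrable on the ray.\<close>
    moreover have "load = (\<lambda>t. (real N)\<^sup>2 *\<^sub>R (fm t \<bullet> fm t) + (\<Sum>i=1..N. fs i t \<bullet> fs i t))"
      using b by (simp add: fun_eq_iff load_def master_load_def balanced_gains_def power2_eq_square)
    ultimately have L: "load absolutely_integrable_on {t0..}" by simp
    have Lb: "load integrable_on {t0..b}" for b
      using absolutely_integrable_on_subinterval[OF L, of t0 b] set_lebesgue_integral_eq_integral(1) by auto
    \<comment> \<open>The total supply over the ray is the uniform bound on
      \<open>G\<close>.\<close>
    have "integral {t0..t} load \<le> integral {t0..} load" for t
      using Lb L set_lebesgue_integral_eq_integral(1)[OF L] load_nonneg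
      by (intro integral_subset_le) auto
    from integrable_load_stability[OF \<open>formation N \<gamma>\<close> primitive_integral[OF Lb load_nonneg] this]
    show ?thesis by blast
  qed
  have claim4: "fm t = - ((1 / real N) *\<^sub>R (\<Sum>i=1..N. fs i t))"
    if "balanced_gains N Kp \<gamma>" "t0 \<le> t"
      "\<forall>\<tau>\<in>{t - hS..t}. vm \<tau> = 0 \<and> (\<forall>i\<in>{1..N}. vs i \<tau> = 0)"
      "am t = 0" "\<forall>i\<in>{1..N}. as i t = 0" for t
    using that unfolding balanced_gains_def by (intro force_tracking) blast+
  show ?thesis
    using claim1 claim2 claim3 claim4 by blast
qed

end
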